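(* Let $c\in\mathbb{C}$. The Lie algebra of (infinitesimal) Lie point symmetries of the Gauss-Codazzi system $$(\log U)_{z\bar z}+\tfrac12(H^2-c^2)U-2QRU^{-1}=0,\qquad Q_{\bar z}-\tfrac12H_zU=0,\qquad R_z-\tfrac12H_{\bar z}U=0$$ in the independent variables $z,\bar z$ and the dependent variables $U,H,Q,R$ is the infinite-dimensional Lie algebra generated by the vector fields $$X(F)=F(z)\partial_z+F'(z)\left(-2Q\partial_Q-U\partial_U\right),\qquad Y(G)=G(\bar z)\partial_{\bar z}+G'(\bar z)\left(-2R\partial_R-U\partial_U\right),$$ where $F,G$ are arbitrary functions of one variable, together with, only in the case $c=0$, $$a=-H\partial_H+Q\partial_Q+R\partial_R+2U\partial_U.$$ Its commutation relations are $$[X(F_1),X(F_2)]=X(F_1F_2'-F_1'F_2),\qquad [Y(G_1),Y(G_2)]=Y(G_1G_2'-G_1'G_2),$$ $$[X(F),Y(G)]=0,\qquad [X(F),a]=0,\qquad [Y(G),a]=0.$$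
   Context: Here $U=e^u$ and $R=\overline Q$ in the geometric setting, but $z,\bar z$ are treated as independent complex variables and $U,H,Q,R$ as independent complex dependent variables. A Lie point symmetry is a vector field on the space of variables $(z,\bar z,U,H,Q,R)$ whose prolongation is tangent to the system, i.e. whose local flow maps solutions to solutions. *)

theory Defs
  imports "HOL-Analysis.Analysis" "HOL-Library.Function_Algebras"
begin

section \<open>Jets of maps from complex p-space to complex q-space\<close>

text \<open>
  A point of the space of independent and dependent variables is a pair \<open>(x, u)\<close>; a 1-jet is
  \<open>((x, u), p)\<close> and a 2-jet is \<open>(((x, u), p), s)\<close>, where \<open>p $ \<alpha> $ i\<close> stands for the derivative of
  \<open>u $ \<alpha>\<close> by \<open>x $ i\<close>, and \<open>s $ \<alpha> $ i $ j\<close> for the second derivative of \<open>u $ \<alpha>\<close> by \<open>x $ i\<close> and \<open>x $ j\<close>.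
  The type of 2-jets does not enforce that \<open>s\<close> is symmetric in \<open>i, j\<close>; see \<open>jets2\<close>.
\<close>

type_synonym ('p, 'q) jet0 = "(complex, 'p) vec \<times> (complex, 'q) vec"
type_synonym ('p, 'q) jet1 = "('p, 'q) jet0 \<times> ((complex, 'p) vec, 'q) vec"
type_synonym ('p, 'q) jet2 = "('p, 'q) jet1 \<times> (((complex, 'p) vec, 'p) vec, 'q) vec"

definition jets2 :: "('p::finite, 'q::finite) jet0 set \<Rightarrow> ('p, 'q) jet2 set" where
  "jets2 M = {((y, p), s). y \<in> M \<and> (\<forall>\<alpha> i j. s $ \<alpha> $ i $ j = s $ \<alpha> $ j $ i)}"

text \<open>
  All maps differentiated below are complex differentiable, so the real Frechet derivative in a
  direction \<open>h\<close> is the complex directional derivative. The total derivative \<open>D\<^sub>i\<close> of a function of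
  the 0-jet (1-jet) is a function of the 1-jet (2-jet).
\<close>

definition total_deriv0 ::
    "'p::finite \<Rightarrow> (('p, 'q::finite) jet0 \<Rightarrow> complex) \<Rightarrow> ('p, 'q) jet1 \<Rightarrow> complex" where
  "total_deriv0 i f = (\<lambda>(y, p). frechet_derivative f (at y) (axis i 1, \<chi> \<alpha>. p $ \<alpha> $ i))"

definition total_deriv1 ::
    "'p::finite \<Rightarrow> (('p, 'q::finite) jet1 \<Rightarrow> complex) \<Rightarrow> ('p, 'q) jet2 \<Rightarrow> complex" where
  "total_deriv1 i f = (\<lambda>((y, p), s). frechet_derivative f (at (y, p))
     ((axis i 1, \<chi> \<alpha>. p $ \<alpha> $ i), \<chi> \<alpha> j. s $ \<alpha> $ j $ i))"

section \<open>Vector fields and their Lie algebra\<close>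

definition cscale :: "complex \<Rightarrow> ('p::finite, 'q::finite) jet0 \<Rightarrow> ('p, 'q) jet0" where
  "cscale c y = (c *s fst y, c *s snd y)"

text \<open>
  The field \<open>\<Sum>\<^sub>i \<xi>\<^sub>i \<partial>/\<partial>x\<^sub>i + \<Sum>\<^sub>\<alpha> \<phi>\<^sub>\<alpha> \<partial>/\<partial>u\<^sub>\<alpha>\<close> on \<open>M\<close> is the map \<open>y \<mapsto> (\<xi> y, \<phi> y)\<close>, with the value 0 outside \<open>M\<close>,
  so that equality of fields on \<open>M\<close> is equality of functions.
\<close>

type_synonym ('p, 'q) vfield = "('p, 'q) jet0 \<Rightarrow> ('p, 'q) jet0"

definition field_on :: "('p::finite, 'q::finite) jet0 set \<Rightarrow> ('p, 'q) vfield \<Rightarrow> ('p, 'q) vfield" where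
  "field_on M v = (\<lambda>y. if y \<in> M then v y else 0)"

definition holomorphic_fields :: "('p::finite, 'q::finite) jet0 set \<Rightarrow> ('p, 'q) vfield set" where
  "holomorphic_fields M = {v. (\<forall>y. y \<notin> M \<longrightarrow> v y = 0) \<and>
     (\<forall>y\<in>M. \<exists>D. (v has_derivative D) (at y) \<and> (\<forall>c h. D (cscale c h) = cscale c (D h)))}"

definition vscale :: "complex \<Rightarrow> ('p::finite, 'q::finite) vfield \<Rightarrow> ('p, 'q) vfield" where
  "vscale c v = (\<lambda>y. cscale c (v y))"

lemma vector_space_vscale:
  "vector_space (vscale :: complex \<Rightarrow> ('p::finite, 'q::finite) vfield \<Rightarrow> ('p, 'q) vfield)"
  by unfold_locales
    (auto simp: vscale_def cscale_def fun_eq_iff prod_eq_iff vec_eq_iff algebra_simps)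

definition lie_bracket ::
    "('p::finite, 'q::finite) jet0 set \<Rightarrow> ('p, 'q) vfield \<Rightarrow> ('p, 'q) vfield \<Rightarrow> ('p, 'q) vfield" where
  "lie_bracket M v w = field_on M (\<lambda>y.
     frechet_derivative w (at y) (v y) - frechet_derivative v (at y) (w y))"

definition lie_subalgebra :: "('p::finite, 'q::finite) jet0 set \<Rightarrow> ('p, 'q) vfield set \<Rightarrow> bool" where
  "lie_subalgebra M L \<longleftrightarrow> module.subspace vscale L \<and> (\<forall>v\<in>L. \<forall>w\<in>L. lie_bracket M v w \<in> L)"

definition lie_generated ::
    "('p::finite, 'q::finite) jet0 set \<Rightarrow> ('p, 'q) vfield set \<Rightarrow> ('p, 'q) vfield set" where
  "lie_generated M S = lie_subalgebra M hull S"

section \<open>Prolongation and Lie point symmetries\<close>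

text \<open>
  The recursive prolongation formula
  \<open>\<phi>\<^sub>\<alpha>\<^sub>,\<^sub>i = D\<^sub>i \<phi>\<^sub>\<alpha> - \<Sum>\<^sub>k (D\<^sub>i \<xi>\<^sub>k) u\<^sub>\<alpha>\<^sub>,\<^sub>k\<close> and \<open>\<phi>\<^sub>\<alpha>\<^sub>,\<^sub>i\<^sub>j = D\<^sub>j \<phi>\<^sub>\<alpha>\<^sub>,\<^sub>i - \<Sum>\<^sub>k (D\<^sub>j \<xi>\<^sub>k) u\<^sub>\<alpha>\<^sub>,\<^sub>i\<^sub>k\<close>.
\<close>

definition prolong_coeff1 ::
    "('p::finite, 'q::finite) vfield \<Rightarrow> 'q \<Rightarrow> 'p \<Rightarrow> ('p, 'q) jet1 \<Rightarrow> complex" where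
  "prolong_coeff1 v \<alpha> i = (\<lambda>(y, p). total_deriv0 i (\<lambda>y. snd (v y) $ \<alpha>) (y, p)
     - (\<Sum>k\<in>UNIV. total_deriv0 i (\<lambda>y. fst (v y) $ k) (y, p) * p $ \<alpha> $ k))"

definition prolong_coeff2 ::
    "('p::finite, 'q::finite) vfield \<Rightarrow> 'q \<Rightarrow> 'p \<Rightarrow> 'p \<Rightarrow> ('p, 'q) jet2 \<Rightarrow> complex" where
  "prolong_coeff2 v \<alpha> i j = (\<lambda>((y, p), s). total_deriv1 j (prolong_coeff1 v \<alpha> i) ((y, p), s)
     - (\<Sum>k\<in>UNIV. total_deriv0 j (\<lambda>y. fst (v y) $ k) (y, p) * s $ \<alpha> $ i $ k))"

definition prolong2 :: "('p::finite, 'q::finite) vfield \<Rightarrow> ('p, 'q) jet2 \<Rightarrow> ('p, 'q) jet2" where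
  "prolong2 v = (\<lambda>((y, p), s).
     ((v y, \<chi> \<alpha> i. prolong_coeff1 v \<alpha> i (y, p)), \<chi> \<alpha> i j. prolong_coeff2 v \<alpha> i j ((y, p), s)))"

text \<open>
  A system of partial differential equations of order at most two is given by the set \<open>E1\<close> of the
  left-hand sides of its first-order equations and the set \<open>E2\<close> of those of its second-order ones.
  The 2-jet of a solution also satisfies the equations obtained by differentiating a first-order
  equation once, so these belong to the equations of the system in the space of 2-jets. Without
  them that variety would contain 2-jets of no solution, and tangency to it could not be expected
  to be equivalent to the local flow mapping solutions to solutions.
\<close>

definition jet2_equations ::
    "(('p::finite, 'q::finite) jet1 \<Rightarrow> complex) set \<Rightarrow> (('p, 'q) jet2 \<Rightarrow> complex) set
     \<Rightarrow> (('p, 'q) jet2 \<Rightarrow> complex) set" where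
  "jet2_equations E1 E2 = E2 \<union> {\<lambda>J. e (fst J) | e. e \<in> E1} \<union> {total_deriv1 i e | i e. e \<in> E1}"

definition equation_manifold ::
    "('p::finite, 'q::finite) jet0 set \<Rightarrow> (('p, 'q) jet1 \<Rightarrow> complex) set
     \<Rightarrow> (('p, 'q) jet2 \<Rightarrow> complex) set \<Rightarrow> ('p, 'q) jet2 set" where
  "equation_manifold M E1 E2 = {J \<in> jets2 M. \<forall>e\<in>jet2_equations E1 E2. e J = 0}"

definition lie_point_symmetries ::
    "('p::finite, 'q::finite) jet0 set \<Rightarrow> (('p, 'q) jet1 \<Rightarrow> complex) set
     \<Rightarrow> (('p, 'q) jet2 \<Rightarrow> complex) set \<Rightarrow> ('p, 'q) vfield set" where
  "lie_point_symmetries M E1 E2 = {v \<in> holomorphic_fields M.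
     \<forall>J\<in>equation_manifold M E1 E2. \<forall>e\<in>jet2_equations E1 E2.
       frechet_derivative e (at J) (prolong2 v J) = 0}"

section \<open>The Gauss-Codazzi system\<close>

abbreviation iz :: 2 where "iz \<equiv> 1"
abbreviation izb :: 2 where "izb \<equiv> 2"
abbreviation iU :: 4 where "iU \<equiv> 1"
abbreviation iH :: 4 where "iH \<equiv> 2"
abbreviation iQ :: 4 where "iQ \<equiv> 3"
abbreviation iR :: 4 where "iR \<equiv> 4"

text \<open>
  In the Gauss equation, \<open>(log U)\<close> differentiated by \<open>z\<close> and \<open>zb\<close> is \<open>U\<^sub>z\<^sub>,\<^sub>z\<^sub>b / U - U\<^sub>z U\<^sub>z\<^sub>b / U\<^sup>2\<close>
  for every local branch of the complex logarithm; \<open>Ln\<close> would not be differentiable on its cut.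
\<close>

definition gauss :: "complex \<Rightarrow> (2, 4) jet2 \<Rightarrow> complex" where
  "gauss c = (\<lambda>(((x, u), p), s).
     (s $ iU $ iz $ izb / u $ iU - p $ iU $ iz * p $ iU $ izb / (u $ iU)\<^sup>2)
     + 1/2 * ((u $ iH)\<^sup>2 - c\<^sup>2) * u $ iU - 2 * u $ iQ * u $ iR * inverse (u $ iU))"

definition codazzi_Q :: "(2, 4) jet1 \<Rightarrow> complex" where
  "codazzi_Q = (\<lambda>((x, u), p). p $ iQ $ izb - 1/2 * p $ iH $ iz * u $ iU)"

definition codazzi_R :: "(2, 4) jet1 \<Rightarrow> complex" where
  "codazzi_R = (\<lambda>((x, u), p). p $ iR $ iz - 1/2 * p $ iH $ izb * u $ iU)"

definition gc_domain :: "complex set \<Rightarrow> complex set \<Rightarrow> (complex ^ 4) set \<Rightarrow> (2, 4) jet0 set" where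
  "gc_domain A B V = {(x, u). x $ iz \<in> A \<and> x $ izb \<in> B \<and> u \<in> V}"

definition gc_symmetries :: "(2, 4) jet0 set \<Rightarrow> complex \<Rightarrow> (2, 4) vfield set" where
  "gc_symmetries M c = lie_point_symmetries M {codazzi_Q, codazzi_R} {gauss c}"

definition gc_X :: "(2, 4) jet0 set \<Rightarrow> (complex \<Rightarrow> complex) \<Rightarrow> (2, 4) vfield" where
  "gc_X M F = field_on M (\<lambda>(x, u).
     (axis iz (F (x $ iz)),
      axis iQ (deriv F (x $ iz) * (- 2 * u $ iQ)) + axis iU (deriv F (x $ iz) * (- u $ iU))))"

definition gc_Y :: "(2, 4) jet0 set \<Rightarrow> (complex \<Rightarrow> complex) \<Rightarrow> (2, 4) vfield" where
  "gc_Y M G = field_on M (\<lambda>(x, u).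
     (axis izb (G (x $ izb)),
      axis iR (deriv G (x $ izb) * (- 2 * u $ iR)) + axis iU (deriv G (x $ izb) * (- u $ iU))))"

definition gc_a :: "(2, 4) jet0 set \<Rightarrow> (2, 4) vfield" where
  "gc_a M = field_on M (\<lambda>(x, u).
     (0, axis iH (- u $ iH) + axis iQ (u $ iQ) + axis iR (u $ iR) + axis iU (2 * u $ iU)))"

end

theory Submission
  imports Defs "HOL-Complex_Analysis.Cauchy_Integral_Formula"
begin

text \<open>
  Tangency to the first Codazzi equation is a polynomial identity in the free first derivatives
  \<open>U\<^sub>z, U\<^sub>z\<^sub>b, H\<^sub>z, H\<^sub>z\<^sub>b, Q\<^sub>z, R\<^sub>z\<^sub>b\<close>; comparing coefficients, and doing the same for the second one, gives linear
  equations between the first partial derivatives of the coefficients of a symmetry. Some of these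
  have the form \<open>f = U g\<close> with \<open>f\<close> and \<open>g\<close> constant in the direction of \<open>U\<close>, so that \<open>f = g = 0\<close>; comparing
  points that differ by such a shift replaces differentiating the equations once more, and hence
  avoids the theorem that holomorphic functions of several variables have holomorphic partial
  derivatives. The outcome is \<open>\<xi> = F z\<close>, \<open>\<eta> = G zb\<close>, \<open>\<phi>\<^sub>H = h H\<close>, \<open>\<phi>\<^sub>Q = (K - 2 F') Q + f z\<close>,
  \<open>\<phi>\<^sub>R = (K - 2 G') R + g zb\<close> and \<open>\<phi>\<^sub>U = U (K - F' - G' - h')\<close> with a constant \<open>K\<close>, where \<open>h\<close> is at first only
  known locally. The coefficient of \<open>H\<^sub>z\<^sub>z\<^sub>b\<close> in the tangency condition of the Gauss equation is
  \<open>- h''\<close>, so \<open>h\<close> is affine, and separating the powers of \<open>U, H, Q, R\<close> in the rest of that condition leaves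
  \<open>h H = - K H\<close>, \<open>f = g = 0\<close> and \<open>c\<^sup>2 K = 0\<close>.
\<close>

section \<open>Holomorphic functions on the jet space of order zero\<close>

text \<open>Regularity forces the Codazzi equations to come before the Gauss equation. A holomorphic
  field is only assumed to be complex differentiable at every point. Its first prolongation is
  therefore meaningful at once, but the second one is a \<open>frechet_derivative\<close> of first
  partial derivatives, about which nothing is known yet. The Codazzi equations involve the first
  prolongation alone. Their consequences write \<open>\<phi>\<^sub>U\<close> locally as
  \<open>U\<close> times a sum of functions of one complex variable each, and for such functions
  Cauchy's theory supplies all further derivatives. The constant \<open>K\<close> appears because
  each Codazzi equation gives an expression for \<open>\<phi>\<^sub>U\<close>: equating the two says
  that a function of \<open>z, Q\<close> agrees with a function of \<open>zb, R\<close>. The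
  function \<open>h\<close> is at first only local because \<open>V\<close> is merely open and
  connected: the part of \<open>V\<close> with fixed \<open>H\<close> may be disconnected.
  \<open>F\<close> and \<open>G\<close> are global at once, since for fixed \<open>z\<close> or
  fixed \<open>zb\<close> the other variables range over a connected set.\<close>

definition holomorphic0_at ::
    "(('p::finite, 'q::finite) jet0 \<Rightarrow> complex) \<Rightarrow> ('p, 'q) jet0 \<Rightarrow> bool" where
  "holomorphic0_at f y \<longleftrightarrow>
     (\<exists>D. (f has_derivative D) (at y) \<and> (\<forall>c h. D (cscale c h) = c * D h))"

definition partial_x ::
    "'p::finite \<Rightarrow> (('p, 'q::finite) jet0 \<Rightarrow> complex) \<Rightarrow> ('p, 'q) jet0 \<Rightarrow> complex" where
  "partial_x i f y = frechet_derivative f (at y) (axis i 1, 0)"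

definition partial_u ::
    "'q::finite \<Rightarrow> (('p::finite, 'q) jet0 \<Rightarrow> complex) \<Rightarrow> ('p, 'q) jet0 \<Rightarrow> complex" where
  "partial_u \<alpha> f y = frechet_derivative f (at y) (0, axis \<alpha> 1)"

lemma frechet_derivative_eq: "(f has_derivative D) (at y) \<Longrightarrow> frechet_derivative f (at y) = D"
  by (rule frechet_derivative_at[symmetric])

lemma has_derivative_nth [derivative_intros]:
  fixes f :: "'a::real_normed_vector \<Rightarrow> 'b::real_normed_vector ^ 'n::finite"
  shows "(f has_derivative D) F \<Longrightarrow> ((\<lambda>x. f x $ i) has_derivative (\<lambda>h. D h $ i)) F"
  by (rule bounded_linear.has_derivative[OF bounded_linear_vec_nth])

lemma has_derivative_axis [derivative_intros]:
  fixes f :: "'a::real_normed_vector \<Rightarrow> 'b::euclidean_space"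
  assumes "(f has_derivative D) F"
  shows "((\<lambda>x. axis i (f x) :: 'b ^ 'n::finite) has_derivative (\<lambda>h. axis i (D h))) F"
proof -
  have "linear (axis i :: 'b \<Rightarrow> 'b ^ 'n)" by (auto intro!: linearI simp: axis_def vec_eq_iff)
  then show ?thesis
    by (intro bounded_linear.has_derivative[OF _ assms]) (simp add: linear_conv_bounded_linear)
qed

lemma has_derivative_vec_lambda [derivative_intros]:
  fixes f :: "'a::real_normed_vector \<Rightarrow> 'n::finite \<Rightarrow> 'b::euclidean_space"
  assumes "\<And>i. ((\<lambda>x. f x i) has_derivative D i) (at x)"
  shows "((\<lambda>x. \<chi> i. f x i) has_derivative (\<lambda>h. \<chi> i. D i h)) (at x)"
proof -
  have "((\<lambda>x. \<Sum>i\<in>UNIV. axis i (f x i)) has_derivative (\<lambda>h. \<Sum>i\<in>UNIV. axis i (D i h))) (at x)"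
    by (intro has_derivative_sum has_derivative_axis assms)
  moreover have "(\<Sum>i\<in>UNIV. axis i (g i)) = (\<chi> i. g i)" for g :: "'n \<Rightarrow> 'b"
    by (simp add: vec_eq_iff axis_def)
  ultimately show ?thesis by simp
qed

lemma jet0_expansion:
  fixes h :: "('p::finite, 'q::finite) jet0"
  shows "h = (\<Sum>i\<in>UNIV. cscale (fst h $ i) (axis i 1, 0)) + (\<Sum>\<alpha>\<in>UNIV. cscale (snd h $ \<alpha>) (0, axis \<alpha> 1))"
  by (auto simp: prod_eq_iff vec_eq_iff cscale_def fst_sum snd_sum axis_def if_distrib cong: if_cong)

text \<open>Complex linearity reduces the derivative to its values at the vectors
  \<open>axis i 1\<close>; a merely real-linear map would also need the directions
  \<open>axis i \<i>\<close>.\<close>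

lemma holomorphic0_at_has_derivative:
  fixes f :: "('p::finite, 'q::finite) jet0 \<Rightarrow> complex"
  assumes "holomorphic0_at f y"
  shows "(f has_derivative (\<lambda>h. (\<Sum>i\<in>UNIV. fst h $ i * partial_x i f y)
           + (\<Sum>\<alpha>\<in>UNIV. snd h $ \<alpha> * partial_u \<alpha> f y))) (at y)"
proof -
  obtain D where D: "(f has_derivative D) (at y)" and c: "\<And>c h. D (cscale c h) = c * D h"
    using assms unfolding holomorphic0_at_def by blast
  interpret D: linear D using D by (rule has_derivative_linear)
  have fr: "frechet_derivative f (at y) = D"
    using D by (rule frechet_derivative_eq)
  have "D h = (\<Sum>i\<in>UNIV. fst h $ i * partial_x i f y) + (\<Sum>\<alpha>\<in>UNIV. snd h $ \<alpha> * partial_u \<alpha> f y)" for h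
    by (subst jet0_expansion) (simp add: D.add D.sum c partial_x_def partial_u_def fr)
  then have "D = (\<lambda>h. (\<Sum>i\<in>UNIV. fst h $ i * partial_x i f y)
           + (\<Sum>\<alpha>\<in>UNIV. snd h $ \<alpha> * partial_u \<alpha> f y))" by blast
  then show ?thesis using D by simp
qed

lemma holomorphic0_at_frechet:
  assumes "holomorphic0_at f y"
  shows "frechet_derivative f (at y) h = (\<Sum>i\<in>UNIV. fst h $ i * partial_x i f y)
           + (\<Sum>\<alpha>\<in>UNIV. snd h $ \<alpha> * partial_u \<alpha> f y)"
  by (rule fun_cong[OF frechet_derivative_eq[OF holomorphic0_at_has_derivative[OF assms]]])

lemma total_deriv0_holomorphic:
  assumes "holomorphic0_at f y"
  shows "total_deriv0 i f (y, p) = partial_x i f y + (\<Sum>\<alpha>\<in>UNIV. p $ \<alpha> $ i * partial_u \<alpha> f y)"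
  using assms by (simp add: total_deriv0_def holomorphic0_at_frechet axis_def if_distrib[of "\<lambda>x. x * _"] cong: if_cong)

text \<open>The converse passage: once a derivative is displayed as a linear form, its coefficients
  are the partial derivatives. This is how the partial derivatives of explicit functions are
  computed.\<close>

lemma holomorphic0_atI:
  fixes f :: "('p::finite, 'q::finite) jet0 \<Rightarrow> complex"
  assumes "(f has_derivative D) (at y)"
    and "\<And>h. D h = (\<Sum>i\<in>UNIV. fst h $ i * a i) + (\<Sum>\<alpha>\<in>UNIV. snd h $ \<alpha> * b \<alpha>)"
  shows "holomorphic0_at f y" "partial_x i f y = a i" "partial_u \<alpha> f y = b \<alpha>"
proof -
  show "holomorphic0_at f y"
    unfolding holomorphic0_at_def
    using assms by (intro exI[of _ D]) (auto simp: cscale_def sum_distrib_left algebra_simps)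
  have "frechet_derivative f (at y) = D" by (rule frechet_derivative_eq[OF assms(1)])
  then show "partial_x i f y = a i" "partial_u \<alpha> f y = b \<alpha>"
    using assms(2) by (simp_all add: partial_x_def partial_u_def axis_def if_distrib[of "\<lambda>x. x * _"] cong: if_cong)
qed

lemma holomorphic_fields_nth:
  assumes "v \<in> holomorphic_fields M" "y \<in> M"
  shows "holomorphic0_at (\<lambda>y. fst (v y) $ i) y" "holomorphic0_at (\<lambda>y. snd (v y) $ \<alpha>) y"
proof -
  obtain D where D: "(v has_derivative D) (at y)" "\<And>c h. D (cscale c h) = cscale c (D h)"
    using assms unfolding holomorphic_fields_def by blast
  show "holomorphic0_at (\<lambda>y. fst (v y) $ i) y" "holomorphic0_at (\<lambda>y. snd (v y) $ \<alpha>) y"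
    unfolding holomorphic0_at_def
    using D by (auto simp: cscale_def intro!: exI derivative_eq_intros)
qed

lemma holomorphic_fieldsI:
  fixes v :: "('p::finite, 'q::finite) vfield"
  assumes "\<And>y. y \<notin> M \<Longrightarrow> v y = 0"
    and "\<And>y i. y \<in> M \<Longrightarrow> holomorphic0_at (\<lambda>y. fst (v y) $ i) y"
    and "\<And>y \<alpha>. y \<in> M \<Longrightarrow> holomorphic0_at (\<lambda>y. snd (v y) $ \<alpha>) y"
  shows "v \<in> holomorphic_fields M"
  unfolding holomorphic_fields_def
proof (intro CollectI conjI allI impI ballI)
  fix y assume y: "y \<in> M"
  obtain D where D: "\<And>i. ((\<lambda>y. fst (v y) $ i) has_derivative D i) (at y)"
      "\<And>i c h. D i (cscale c h) = c * D i h"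
    using assms(2)[OF y] unfolding holomorphic0_at_def by metis
  obtain E where E: "\<And>i. ((\<lambda>y. snd (v y) $ i) has_derivative E i) (at y)"
      "\<And>i c h. E i (cscale c h) = c * E i h"
    using assms(3)[OF y] unfolding holomorphic0_at_def by metis
  have "((\<lambda>y. (\<chi> i. fst (v y) $ i, \<chi> i. snd (v y) $ i)) has_derivative
      (\<lambda>h. (\<chi> i. D i h, \<chi> i. E i h))) (at y)"
    by (intro derivative_intros D E)
  then show "\<exists>D. (v has_derivative D) (at y) \<and> (\<forall>c h. D (cscale c h) = cscale c (D h))"
    by (intro exI[of _ "\<lambda>h. (\<chi> i. D i h, \<chi> i. E i h)"] conjI allI; simp only: D(2) E(2))
      (simp_all add: cscale_def vec_eq_iff)
qed (use assms in auto)

lemma holomorphic_fields_frechet_nth: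
  assumes "v \<in> holomorphic_fields M" "y \<in> M"
  shows "fst (frechet_derivative v (at y) h) $ i = frechet_derivative (\<lambda>y. fst (v y) $ i) (at y) h"
    "snd (frechet_derivative v (at y) h) $ \<alpha> = frechet_derivative (\<lambda>y. snd (v y) $ \<alpha>) (at y) h"
proof -
  obtain D where D: "(v has_derivative D) (at y)"
    using assms unfolding holomorphic_fields_def by blast
  have fr: "frechet_derivative v (at y) = D" by (rule frechet_derivative_eq[OF D])
  have "((\<lambda>y. fst (v y) $ i) has_derivative (\<lambda>h. fst (D h) $ i)) (at y)"
    "((\<lambda>y. snd (v y) $ \<alpha>) has_derivative (\<lambda>h. snd (D h) $ \<alpha>)) (at y)"
    by (intro derivative_intros D)+
  then show "fst (frechet_derivative v (at y) h) $ i = frechet_derivative (\<lambda>y. fst (v y) $ i) (at y) h"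
    "snd (frechet_derivative v (at y) h) $ \<alpha> = frechet_derivative (\<lambda>y. snd (v y) $ \<alpha>) (at y) h"
    by (simp_all add: fr frechet_derivative_eq)
qed

lemma holomorphic0_at_local:
  assumes "holomorphic0_at f y" "open S" "y \<in> S" "\<And>y. y \<in> S \<Longrightarrow> g y = f y"
  shows "holomorphic0_at g y" "frechet_derivative g (at y) = frechet_derivative f (at y)"
    "partial_x i g y = partial_x i f y" "partial_u \<alpha> g y = partial_u \<alpha> f y"
proof -
  obtain D where D: "(f has_derivative D) (at y)" "\<And>c h. D (cscale c h) = c * D h"
    using assms(1) unfolding holomorphic0_at_def by blast
  have D': "(g has_derivative D) (at y)"
    by (rule has_derivative_transform_within_open[OF D(1) assms(2,3)]) (simp add: assms(4))
  show "holomorphic0_at g y" unfolding holomorphic0_at_def using D' D(2) by blast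
  show *: "frechet_derivative g (at y) = frechet_derivative f (at y)"
    using D' D(1) by (simp add: frechet_derivative_eq)
  show "partial_x i g y = partial_x i f y" "partial_u \<alpha> g y = partial_u \<alpha> f y"
    by (simp_all add: partial_x_def partial_u_def *)
qed

section \<open>Functions that are constant in some directions\<close>

text \<open>By the chain rule the derivative along the segment from \<open>y\<close> to
  \<open>y + h\<close> is a sum of products of a coordinate of \<open>h\<close> with the partial
  derivative in that direction, and in each product one factor vanishes. Convexity of
  \<open>S\<close> keeps the segment inside.\<close>

lemma shift_value:
  fixes f :: "('p::finite, 'q::finite) jet0 \<Rightarrow> complex"
  assumes "convex S" "y \<in> S" "y + h \<in> S"
    and "\<And>y. y \<in> S \<Longrightarrow> holomorphic0_at f y"
    and "\<And>y i. y \<in> S \<Longrightarrow> fst h $ i = 0 \<or> partial_x i f y = 0"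
    and "\<And>y \<alpha>. y \<in> S \<Longrightarrow> snd h $ \<alpha> = 0 \<or> partial_u \<alpha> f y = 0"
  shows "f (y + h) = f y"
proof -
  have "((\<lambda>t. f (y + t *\<^sub>R h)) has_derivative (\<lambda>_. 0)) (at t within {0..1})" if "t \<in> {0..1}" for t
  proof -
    have "y + t *\<^sub>R h = (1 - t) *\<^sub>R y + t *\<^sub>R (y + h)" by (simp add: algebra_simps)
    then have S: "y + t *\<^sub>R h \<in> S"
      using assms(1-3) that by (simp add: convexD_alt)
    let ?D = "\<lambda>h. (\<Sum>i\<in>UNIV. fst h $ i * partial_x i f (y + t *\<^sub>R h))
           + (\<Sum>\<alpha>\<in>UNIV. snd h $ \<alpha> * partial_u \<alpha> f (y + t *\<^sub>R h))"
    have "fst h $ i * partial_x i f (y + t *\<^sub>R h) = 0" for i using assms(5)[OF S, of i] by auto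
    moreover have "snd h $ \<alpha> * partial_u \<alpha> f (y + t *\<^sub>R h) = 0" for \<alpha> using assms(6)[OF S, of \<alpha>] by auto
    ultimately have z: "?D h = 0" by (simp only: sum.neutral_const add_0_left)
    have "((\<lambda>t. f (y + t *\<^sub>R h)) has_derivative (\<lambda>s. (\<Sum>i\<in>UNIV. fst (s *\<^sub>R h) $ i * partial_x i f (y + t *\<^sub>R h))
           + (\<Sum>\<alpha>\<in>UNIV. snd (s *\<^sub>R h) $ \<alpha> * partial_u \<alpha> f (y + t *\<^sub>R h)))) (at t within {0..1})"
      by (rule has_derivative_compose[where f = "\<lambda>t. y + t *\<^sub>R h" and f' = "\<lambda>s. s *\<^sub>R h" and g = f])
        (use holomorphic0_at_has_derivative[OF assms(4)[OF S]] in \<open>auto intro!: derivative_eq_intros\<close>)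
    also have "(\<lambda>s. (\<Sum>i\<in>UNIV. fst (s *\<^sub>R h) $ i * partial_x i f (y + t *\<^sub>R h))
           + (\<Sum>\<alpha>\<in>UNIV. snd (s *\<^sub>R h) $ \<alpha> * partial_u \<alpha> f (y + t *\<^sub>R h))) = (\<lambda>s. s *\<^sub>R ?D h)"
      by (simp add: scaleR_add_right scaleR_sum_right)
    finally show ?thesis by (simp add: z)
  qed
  then obtain c where "f (y + t *\<^sub>R h) = c" if "t \<in> {0..1}" for t
    using has_derivative_zero_constant[of "{0..1::real}" "\<lambda>t. f (y + t *\<^sub>R h)"] by auto
  from this[of 0] this[of 1] show ?thesis by simp
qed

text \<open>Near \<open>y\<close> the function coincides with its translate by \<open>h\<close>, so
  the derivatives at \<open>y\<close> and \<open>y + h\<close> agree. The first partial derivatives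
  thus inherit the constancy although nothing is known about their own differentiability.\<close>

lemma shift_frechet:
  fixes f :: "('p::finite, 'q::finite) jet0 \<Rightarrow> complex"
  assumes "convex S" "open S" "y \<in> S" "y + h \<in> S"
    and "\<And>y. y \<in> S \<Longrightarrow> holomorphic0_at f y"
    and "\<And>y i. y \<in> S \<Longrightarrow> fst h $ i = 0 \<or> partial_x i f y = 0"
    and "\<And>y \<alpha>. y \<in> S \<Longrightarrow> snd h $ \<alpha> = 0 \<or> partial_u \<alpha> f y = 0"
  shows "frechet_derivative f (at (y + h)) = frechet_derivative f (at y)"
proof -
  \<comment> \<open>The points of \<open>S\<close> whose translate also lies in \<open>S\<close>: an
    open neighbourhood of \<open>y\<close> on which \<open>f\<close> and its translate
    agree.\<close>
  define T where "T = S \<inter> (\<lambda>y. y + h) -` S"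
  have T: "open T" "y \<in> T"
    unfolding T_def using assms(2-4) by (auto intro!: open_Int open_vimage continuous_intros)
  obtain D where D: "(f has_derivative D) (at (y + h))"
    using assms(5)[OF assms(4)] unfolding holomorphic0_at_def by blast
  have "((\<lambda>y. f (y + h)) has_derivative D) (at y)"
    by (rule has_derivative_compose[where f = "\<lambda>y. y + h" and g = f and f' = "\<lambda>h. h" and g' = D])
      (use D in \<open>auto intro!: derivative_eq_intros\<close>)
  then have "(f has_derivative D) (at y)"
    by (rule has_derivative_transform_within_open[OF _ T])
      (use shift_value[OF assms(1) _ _ assms(5-7)] in \<open>auto simp: T_def\<close>)
  then show ?thesis using D by (simp add: frechet_derivative_eq)
qed

lemma shift_partial:
  fixes f :: "('p::finite, 'q::finite) jet0 \<Rightarrow> complex"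
  assumes "convex S" "open S" "y \<in> S" "y + h \<in> S"
    and "\<And>y. y \<in> S \<Longrightarrow> holomorphic0_at f y"
    and "\<And>y i. y \<in> S \<Longrightarrow> fst h $ i = 0 \<or> partial_x i f y = 0"
    and "\<And>y \<alpha>. y \<in> S \<Longrightarrow> snd h $ \<alpha> = 0 \<or> partial_u \<alpha> f y = 0"
  shows "partial_x i f (y + h) = partial_x i f y" "partial_u \<alpha> f (y + h) = partial_u \<alpha> f y"
  by (simp_all add: partial_x_def partial_u_def shift_frechet[OF assms])

lemma constant_if_partials_vanish:
  fixes f :: "('p::finite, 'q::finite) jet0 \<Rightarrow> complex"
  assumes "open S" "connected S"
    and "\<And>y. y \<in> S \<Longrightarrow> holomorphic0_at f y"
    and "\<And>y i. y \<in> S \<Longrightarrow> partial_x i f y = 0" "\<And>y \<alpha>. y \<in> S \<Longrightarrow> partial_u \<alpha> f y = 0"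
  obtains k where "\<And>y. y \<in> S \<Longrightarrow> f y = k"
proof -
  have d: "(f has_derivative (\<lambda>_. 0)) (at y)" if "y \<in> S" for y
    using holomorphic0_at_has_derivative[OF assms(3)[OF that]] assms(4,5)[OF that] by simp
  then have "f constant_on S"
    by (intro has_derivative_zero_connected_constant_on[OF assms(2,1) finite.emptyI]
        continuous_at_imp_continuous_on ballI)
      (auto intro: has_derivative_at_withinI has_derivative_continuous)
  then show ?thesis using that unfolding constant_on_def by blast
qed

section \<open>Prolongation of fields that scale the dependent variables\<close>

lemma holomorphic_has_derivative:
  assumes "F holomorphic_on S" "open S" "f y \<in> S" "(f has_derivative D) (at y)"
  shows "((\<lambda>y. F (f y)) has_derivative (\<lambda>h. deriv F (f y) * D h)) (at y)"
proof -
  have "(F has_derivative (*) (deriv F (f y))) (at (f y))"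
    by (rule has_field_derivative_imp_has_derivative[OF holomorphic_derivI[OF assms(1-3)]])
  then show ?thesis using has_derivative_compose[OF assms(4)] by blast
qed

lemma has_derivative_coordinate:
  "((\<lambda>y. fst y $ i) has_derivative (\<lambda>h. fst h $ i)) F"
  "((\<lambda>y. snd y $ j) has_derivative (\<lambda>h. snd h $ j)) F"
  "((\<lambda>y. fst (fst y) $ k) has_derivative (\<lambda>h. fst (fst h) $ k)) G"
  "((\<lambda>y. snd (fst y) $ l) has_derivative (\<lambda>h. snd (fst h) $ l)) G"
  by (intro derivative_intros)+

text \<open>The shape common to the two computations of prolongations: \<open>\<xi> i\<close>
  depends on \<open>x $ i\<close> alone and \<open>u $ \<alpha>\<close> is multiplied by a weight.
  For the generators \<open>g\<close> is zero. For the \<open>U\<close>-component of an unknown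
  symmetry \<open>g\<close> is \<open>- h'\<close> in the variable \<open>H\<close>, and
  \<open>N\<close> is then only a small ball.\<close>

context
  fixes v :: "('p::finite, 'q::finite) vfield" and \<xi> :: "'p \<Rightarrow> complex \<Rightarrow> complex"
    and g :: "complex \<Rightarrow> complex" and S :: "'p \<Rightarrow> complex set" and T :: "complex set"
    and N :: "('p, 'q) jet0 set" and \<alpha> \<beta> :: 'q and \<kappa> :: complex and \<mu> :: "'p \<Rightarrow> complex"
  assumes N: "open N"
    and S: "\<And>i. open (S i)" "\<And>i. \<xi> i holomorphic_on S i" "\<And>i x u. (x, u) \<in> N \<Longrightarrow> x $ i \<in> S i"
    and T: "open T" "g holomorphic_on T" "\<And>x u. (x, u) \<in> N \<Longrightarrow> u $ \<beta> \<in> T"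
    and fst_v: "\<And>i x u. (x, u) \<in> N \<Longrightarrow> fst (v (x, u)) $ i = \<xi> i (x $ i)"
    and snd_v: "\<And>x u. (x, u) \<in> N \<Longrightarrow>
      snd (v (x, u)) $ \<alpha> = u $ \<alpha> * (\<kappa> + (\<Sum>i\<in>UNIV. \<mu> i * deriv (\<xi> i) (x $ i)) + g (u $ \<beta>))"
begin

lemma scaling_fst_has_derivative:
  assumes "(x, u) \<in> N"
  shows "((\<lambda>y. fst (v y) $ i) has_derivative (\<lambda>h. deriv (\<xi> i) (x $ i) * fst h $ i)) (at (x, u))"
proof (rule has_derivative_transform_within_open[OF _ N assms])
  show "((\<lambda>y. \<xi> i (fst y $ i)) has_derivative (\<lambda>h. deriv (\<xi> i) (x $ i) * fst h $ i)) (at (x, u))"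
    using holomorphic_has_derivative[OF S(2,1), of "\<lambda>y. fst y $ i" "(x, u)" i "\<lambda>h. fst h $ i"] S(3)[OF assms]
    by (auto simp: has_derivative_coordinate)
qed (auto simp: fst_v)

lemma scaling_snd_has_derivative:
  assumes "(x, u) \<in> N"
  shows "((\<lambda>y. snd (v y) $ \<alpha>) has_derivative (\<lambda>h.
     snd h $ \<alpha> * (\<kappa> + (\<Sum>i\<in>UNIV. \<mu> i * deriv (\<xi> i) (x $ i)) + g (u $ \<beta>))
     + u $ \<alpha> * ((\<Sum>i\<in>UNIV. \<mu> i * deriv (deriv (\<xi> i)) (x $ i) * fst h $ i) + deriv g (u $ \<beta>) * snd h $ \<beta>)))
     (at (x, u))"
proof (rule has_derivative_transform_within_open[OF _ N assms])
  have a: "((\<lambda>y. deriv (\<xi> i) (fst y $ i)) has_derivative (\<lambda>h. deriv (deriv (\<xi> i)) (x $ i) * fst h $ i)) (at (x, u))" for i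
    using holomorphic_has_derivative[OF holomorphic_deriv[OF S(2,1)] S(1), of "\<lambda>y. fst y $ i" "(x, u)" i "\<lambda>h. fst h $ i"] S(3)[OF assms]
    by (auto simp: has_derivative_coordinate)
  have b: "((\<lambda>y. g (snd y $ \<beta>)) has_derivative (\<lambda>h. deriv g (u $ \<beta>) * snd h $ \<beta>)) (at (x, u))"
    using holomorphic_has_derivative[OF T(2,1), of "\<lambda>y. snd y $ \<beta>" "(x, u)" "\<lambda>h. snd h $ \<beta>"] T(3)[OF assms]
    by (auto simp: has_derivative_coordinate)
  show "((\<lambda>y. snd y $ \<alpha> * (\<kappa> + (\<Sum>i\<in>UNIV. \<mu> i * deriv (\<xi> i) (fst y $ i)) + g (snd y $ \<beta>))) has_derivative (\<lambda>h.
     snd h $ \<alpha> * (\<kappa> + (\<Sum>i\<in>UNIV. \<mu> i * deriv (\<xi> i) (x $ i)) + g (u $ \<beta>))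
     + u $ \<alpha> * ((\<Sum>i\<in>UNIV. \<mu> i * deriv (deriv (\<xi> i)) (x $ i) * fst h $ i) + deriv g (u $ \<beta>) * snd h $ \<beta>)))
     (at (x, u))"
    by (rule has_derivative_eq_rhs, (rule a b derivative_intros)+) (simp add: fun_eq_iff algebra_simps)
qed (auto simp: snd_v)

lemma prolong_coeff1_scaling:
  assumes "(x, u) \<in> N"
  shows "prolong_coeff1 v \<alpha> i ((x, u), p) =
     p $ \<alpha> $ i * (\<kappa> + (\<Sum>i\<in>UNIV. \<mu> i * deriv (\<xi> i) (x $ i)) + g (u $ \<beta>) - deriv (\<xi> i) (x $ i))
     + u $ \<alpha> * (\<mu> i * deriv (deriv (\<xi> i)) (x $ i) + deriv g (u $ \<beta>) * p $ \<beta> $ i)"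
  by (simp add: prolong_coeff1_def total_deriv0_def frechet_derivative_eq[OF scaling_fst_has_derivative[OF assms]]
      frechet_derivative_eq[OF scaling_snd_has_derivative[OF assms]] axis_def if_distrib[of "\<lambda>x. _ * x"]
      if_distrib[of "\<lambda>x. x * _"] algebra_simps cong: if_cong)

text \<open>Obtained by differentiating the closed formula for the first prolongation coefficient.
  The terms under \<open>i = j\<close> arise because the derivatives of \<open>\<xi> i\<close> see
  only the direction \<open>i\<close>.\<close>

lemma prolong_coeff2_scaling:
  assumes "(x, u) \<in> N"
  shows "prolong_coeff2 v \<alpha> i j (((x, u), p), s) =
     s $ \<alpha> $ i $ j * (\<kappa> + (\<Sum>i\<in>UNIV. \<mu> i * deriv (\<xi> i) (x $ i)) + g (u $ \<beta>)
         - deriv (\<xi> i) (x $ i) - deriv (\<xi> j) (x $ j))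
     + p $ \<alpha> $ i * (\<mu> j * deriv (deriv (\<xi> j)) (x $ j) + deriv g (u $ \<beta>) * p $ \<beta> $ j
         - (if i = j then deriv (deriv (\<xi> i)) (x $ i) else 0))
     + p $ \<alpha> $ j * (\<mu> i * deriv (deriv (\<xi> i)) (x $ i) + deriv g (u $ \<beta>) * p $ \<beta> $ i)
     + u $ \<alpha> * ((if i = j then \<mu> i * deriv (deriv (deriv (\<xi> i))) (x $ i) else 0)
         + deriv (deriv g) (u $ \<beta>) * p $ \<beta> $ i * p $ \<beta> $ j + deriv g (u $ \<beta>) * s $ \<beta> $ i $ j)"
proof -
  let ?J = "((x, u), p)"
  have a: "((\<lambda>J. deriv (\<xi> i) (fst (fst J) $ i)) has_derivative (\<lambda>h. deriv (deriv (\<xi> i)) (x $ i) * fst (fst h) $ i)) (at ?J)"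
    and a2: "((\<lambda>J. deriv (deriv (\<xi> i)) (fst (fst J) $ i)) has_derivative (\<lambda>h. deriv (deriv (deriv (\<xi> i))) (x $ i) * fst (fst h) $ i)) (at ?J)" for i
    using holomorphic_has_derivative[OF holomorphic_deriv[OF S(2,1)] S(1), of "\<lambda>y. fst (fst y) $ i" ?J i "\<lambda>h. fst (fst h) $ i"]
      holomorphic_has_derivative[OF holomorphic_deriv[OF holomorphic_deriv[OF S(2,1)] S(1)] S(1), of "\<lambda>y. fst (fst y) $ i" ?J i "\<lambda>h. fst (fst h) $ i"]
      S(3)[OF assms]
    by (auto simp: has_derivative_coordinate)
  have b: "((\<lambda>J. g (snd (fst J) $ \<beta>)) has_derivative (\<lambda>h. deriv g (u $ \<beta>) * snd (fst h) $ \<beta>)) (at ?J)"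
    and b2: "((\<lambda>J. deriv g (snd (fst J) $ \<beta>)) has_derivative (\<lambda>h. deriv (deriv g) (u $ \<beta>) * snd (fst h) $ \<beta>)) (at ?J)"
    using holomorphic_has_derivative[OF T(2,1), of "\<lambda>y. snd (fst y) $ \<beta>" ?J "\<lambda>h. snd (fst h) $ \<beta>"]
     holomorphic_has_derivative[OF holomorphic_deriv[OF T(2,1)] T(1), of "\<lambda>y. snd (fst y) $ \<beta>" ?J "\<lambda>h. snd (fst h) $ \<beta>"]
     T(3)[OF assms]
    by (auto simp: has_derivative_coordinate)
  define D where "D = (\<lambda>h.
     snd h $ \<alpha> $ i * (\<kappa> + (\<Sum>i\<in>UNIV. \<mu> i * deriv (\<xi> i) (x $ i)) + g (u $ \<beta>) - deriv (\<xi> i) (x $ i))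
     + p $ \<alpha> $ i * ((\<Sum>i\<in>UNIV. \<mu> i * (deriv (deriv (\<xi> i)) (x $ i) * fst (fst h) $ i))
         + deriv g (u $ \<beta>) * snd (fst h) $ \<beta> - deriv (deriv (\<xi> i)) (x $ i) * fst (fst h) $ i)
     + snd (fst h) $ \<alpha> * (\<mu> i * deriv (deriv (\<xi> i)) (x $ i) + deriv g (u $ \<beta>) * p $ \<beta> $ i)
     + u $ \<alpha> * (\<mu> i * (deriv (deriv (deriv (\<xi> i))) (x $ i) * fst (fst h) $ i)
         + deriv (deriv g) (u $ \<beta>) * snd (fst h) $ \<beta> * p $ \<beta> $ i + deriv g (u $ \<beta>) * snd h $ \<beta> $ i))"
  have "((\<lambda>J. snd J $ \<alpha> $ i * (\<kappa> + (\<Sum>i\<in>UNIV. \<mu> i * deriv (\<xi> i) (fst (fst J) $ i)) + g (snd (fst J) $ \<beta>) - deriv (\<xi> i) (fst (fst J) $ i))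
     + snd (fst J) $ \<alpha> * (\<mu> i * deriv (deriv (\<xi> i)) (fst (fst J) $ i) + deriv g (snd (fst J) $ \<beta>) * snd J $ \<beta> $ i))
     has_derivative D) (at ?J)"
    by (rule has_derivative_eq_rhs, (rule a a2 b b2 derivative_intros)+) (simp add: D_def fun_eq_iff algebra_simps)
  \<comment> \<open>The formula for \<open>prolong_coeff1\<close> holds on the open set
    \<open>N \<times> UNIV\<close> and not just at the jet in question, so it may be
    differentiated.\<close>
  then have "(prolong_coeff1 v \<alpha> i has_derivative D) (at ?J)"
    by (rule has_derivative_transform_within_open[OF _ open_Times[OF N open_UNIV]])
      (use assms prolong_coeff1_scaling in auto)
  then have "total_deriv1 j (prolong_coeff1 v \<alpha> i) (((x, u), p), s) = D ((axis j 1, \<chi> \<alpha>. p $ \<alpha> $ j), \<chi> \<alpha> k. s $ \<alpha> $ k $ j)"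
    by (simp add: total_deriv1_def frechet_derivative_eq)
  then show ?thesis
    by (simp add: prolong_coeff2_def total_deriv0_def D_def frechet_derivative_eq[OF scaling_fst_has_derivative[OF assms]]
      axis_def if_distrib[of "\<lambda>x. _ * x"] if_distrib[of "\<lambda>x. x * _"] algebra_simps cong: if_cong)
qed

end

section \<open>The Gauss-Codazzi system\<close>

text \<open>Replaces \<open>frechet_derivative\<close> by an explicit linear form in the
  prolongation coefficients; the quotients are differentiable because \<open>U\<close> is
  nonzero.\<close>

lemma gauss_tangent:
  fixes v :: "(2, 4) vfield"
  assumes "u $ iU \<noteq> 0" "v (x, u) = (y, w)"
  shows "frechet_derivative (gauss c) (at (((x, u), p), s)) (prolong2 v (((x, u), p), s)) =
    prolong_coeff2 v iU iz izb (((x, u), p), s) / u $ iU - s $ iU $ iz $ izb * w $ iU / (u $ iU)\<^sup>2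
    - (prolong_coeff1 v iU iz ((x, u), p) * p $ iU $ izb + p $ iU $ iz * prolong_coeff1 v iU izb ((x, u), p)) / (u $ iU)\<^sup>2
    + 2 * p $ iU $ iz * p $ iU $ izb * w $ iU / (u $ iU)^3
    + w $ iH * u $ iH * u $ iU + 1/2 * ((u $ iH)\<^sup>2 - c\<^sup>2) * w $ iU
    - 2 * (w $ iQ * u $ iR + u $ iQ * w $ iR) / u $ iU + 2 * u $ iQ * u $ iR * w $ iU / (u $ iU)\<^sup>2"
proof -
  have "gauss c = (\<lambda>J. (snd J $ iU $ iz $ izb / snd (fst (fst J)) $ iU
      - snd (fst J) $ iU $ iz * snd (fst J) $ iU $ izb / (snd (fst (fst J)) $ iU)\<^sup>2)
      + 1/2 * ((snd (fst (fst J)) $ iH)\<^sup>2 - c\<^sup>2) * snd (fst (fst J)) $ iU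
      - 2 * snd (fst (fst J)) $ iQ * snd (fst (fst J)) $ iR * inverse (snd (fst (fst J)) $ iU))"
    by (simp add: gauss_def split_def)
  moreover have "(\<dots> has_derivative (\<lambda>h.
      snd h $ iU $ iz $ izb / u $ iU - s $ iU $ iz $ izb * snd (fst (fst h)) $ iU / (u $ iU)\<^sup>2
    - (snd (fst h) $ iU $ iz * p $ iU $ izb + p $ iU $ iz * snd (fst h) $ iU $ izb) / (u $ iU)\<^sup>2
    + 2 * p $ iU $ iz * p $ iU $ izb * snd (fst (fst h)) $ iU / (u $ iU)^3
    + snd (fst (fst h)) $ iH * u $ iH * u $ iU + 1/2 * ((u $ iH)\<^sup>2 - c\<^sup>2) * snd (fst (fst h)) $ iU
    - 2 * (snd (fst (fst h)) $ iQ * u $ iR + u $ iQ * snd (fst (fst h)) $ iR) / u $ iU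
    + 2 * u $ iQ * u $ iR * snd (fst (fst h)) $ iU / (u $ iU)\<^sup>2)) (at (((x, u), p), s))"
    by (rule has_derivative_eq_rhs, (rule derivative_intros | simp add: assms(1))+)
      (simp add: fun_eq_iff assms(1) field_simps power2_eq_square power3_eq_cube)
  ultimately have "(gauss c has_derivative (\<lambda>h.
      snd h $ iU $ iz $ izb / u $ iU - s $ iU $ iz $ izb * snd (fst (fst h)) $ iU / (u $ iU)\<^sup>2
    - (snd (fst h) $ iU $ iz * p $ iU $ izb + p $ iU $ iz * snd (fst h) $ iU $ izb) / (u $ iU)\<^sup>2
    + 2 * p $ iU $ iz * p $ iU $ izb * snd (fst (fst h)) $ iU / (u $ iU)^3
    + snd (fst (fst h)) $ iH * u $ iH * u $ iU + 1/2 * ((u $ iH)\<^sup>2 - c\<^sup>2) * snd (fst (fst h)) $ iU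
    - 2 * (snd (fst (fst h)) $ iQ * u $ iR + u $ iQ * snd (fst (fst h)) $ iR) / u $ iU
    + 2 * u $ iQ * u $ iR * snd (fst (fst h)) $ iU / (u $ iU)\<^sup>2)) (at (((x, u), p), s))"
    by (simp only:)
  from frechet_derivative_eq[OF this] show ?thesis
    by (simp add: prolong2_def assms(2))
qed

lemma codazzi_tangent:
  fixes v :: "(2, 4) vfield"
  assumes "v (x, u) = (y, w)"
  shows "frechet_derivative (\<lambda>J. codazzi_Q (fst J)) (at (((x, u), p), s)) (prolong2 v (((x, u), p), s)) =
      prolong_coeff1 v iQ izb ((x, u), p)
      - 1/2 * (prolong_coeff1 v iH iz ((x, u), p) * u $ iU + p $ iH $ iz * w $ iU)"
    and "frechet_derivative (\<lambda>J. codazzi_R (fst J)) (at (((x, u), p), s)) (prolong2 v (((x, u), p), s)) =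
      prolong_coeff1 v iR iz ((x, u), p)
      - 1/2 * (prolong_coeff1 v iH izb ((x, u), p) * u $ iU + p $ iH $ izb * w $ iU)"
proof -
  have "((\<lambda>J. codazzi_Q (fst J)) has_derivative (\<lambda>h. snd (fst h) $ iQ $ izb
      - 1/2 * (snd (fst h) $ iH $ iz * u $ iU + p $ iH $ iz * snd (fst (fst h)) $ iU))) (at (((x, u), p), s))"
    "((\<lambda>J. codazzi_R (fst J)) has_derivative (\<lambda>h. snd (fst h) $ iR $ iz
      - 1/2 * (snd (fst h) $ iH $ izb * u $ iU + p $ iH $ izb * snd (fst (fst h)) $ iU))) (at (((x, u), p), s))"
    unfolding codazzi_Q_def codazzi_R_def split_def
    by (rule has_derivative_eq_rhs, (rule derivative_intros)+, simp add: fun_eq_iff field_simps)+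
  from this[THEN frechet_derivative_eq]
  show "frechet_derivative (\<lambda>J. codazzi_Q (fst J)) (at (((x, u), p), s)) (prolong2 v (((x, u), p), s)) =
      prolong_coeff1 v iQ izb ((x, u), p)
      - 1/2 * (prolong_coeff1 v iH iz ((x, u), p) * u $ iU + p $ iH $ iz * w $ iU)"
    and "frechet_derivative (\<lambda>J. codazzi_R (fst J)) (at (((x, u), p), s)) (prolong2 v (((x, u), p), s)) =
      prolong_coeff1 v iR iz ((x, u), p)
      - 1/2 * (prolong_coeff1 v iH izb ((x, u), p) * u $ iU + p $ iH $ izb * w $ iU)"
    by (simp_all add: prolong2_def assms)
qed

lemma total_deriv1_codazzi:
  "total_deriv1 i codazzi_Q = (\<lambda>(((x, u), p), s).
     s $ iQ $ izb $ i - 1/2 * (s $ iH $ iz $ i * u $ iU + p $ iH $ iz * p $ iU $ i))"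
  "total_deriv1 i codazzi_R = (\<lambda>(((x, u), p), s).
     s $ iR $ iz $ i - 1/2 * (s $ iH $ izb $ i * u $ iU + p $ iH $ izb * p $ iU $ i))"
proof -
  have "(codazzi_Q has_derivative (\<lambda>h. snd h $ iQ $ izb
      - 1/2 * (snd h $ iH $ iz * u $ iU + p $ iH $ iz * snd (fst h) $ iU))) (at ((x, u), p))"
    "(codazzi_R has_derivative (\<lambda>h. snd h $ iR $ iz
      - 1/2 * (snd h $ iH $ izb * u $ iU + p $ iH $ izb * snd (fst h) $ iU))) (at ((x, u), p))" for x u p
    unfolding codazzi_Q_def codazzi_R_def split_def
    by (rule has_derivative_eq_rhs, (rule derivative_intros)+, simp add: fun_eq_iff field_simps)+
  from this[THEN frechet_derivative_eq]
  show "total_deriv1 i codazzi_Q = (\<lambda>(((x, u), p), s).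
     s $ iQ $ izb $ i - 1/2 * (s $ iH $ iz $ i * u $ iU + p $ iH $ iz * p $ iU $ i))"
    "total_deriv1 i codazzi_R = (\<lambda>(((x, u), p), s).
     s $ iR $ iz $ i - 1/2 * (s $ iH $ izb $ i * u $ iU + p $ iH $ izb * p $ iU $ i))"
    by (simp_all add: total_deriv1_def fun_eq_iff)
qed

lemma total_deriv1_codazzi_tangent:
  fixes v :: "(2, 4) vfield"
  assumes "v (x, u) = (y, w)"
  shows "frechet_derivative (total_deriv1 i codazzi_Q) (at (((x, u), p), s)) (prolong2 v (((x, u), p), s)) =
      prolong_coeff2 v iQ izb i (((x, u), p), s)
      - 1/2 * (prolong_coeff2 v iH iz i (((x, u), p), s) * u $ iU + s $ iH $ iz $ i * w $ iU
        + prolong_coeff1 v iH iz ((x, u), p) * p $ iU $ i + p $ iH $ iz * prolong_coeff1 v iU i ((x, u), p))"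
    and "frechet_derivative (total_deriv1 i codazzi_R) (at (((x, u), p), s)) (prolong2 v (((x, u), p), s)) =
      prolong_coeff2 v iR iz i (((x, u), p), s)
      - 1/2 * (prolong_coeff2 v iH izb i (((x, u), p), s) * u $ iU + s $ iH $ izb $ i * w $ iU
        + prolong_coeff1 v iH izb ((x, u), p) * p $ iU $ i + p $ iH $ izb * prolong_coeff1 v iU i ((x, u), p))"
proof -
  have "(total_deriv1 i codazzi_Q has_derivative (\<lambda>h. snd h $ iQ $ izb $ i
      - 1/2 * (snd h $ iH $ iz $ i * u $ iU + s $ iH $ iz $ i * snd (fst (fst h)) $ iU
        + snd (fst h) $ iH $ iz * p $ iU $ i + p $ iH $ iz * snd (fst h) $ iU $ i))) (at (((x, u), p), s))"
    "(total_deriv1 i codazzi_R has_derivative (\<lambda>h. snd h $ iR $ iz $ i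
      - 1/2 * (snd h $ iH $ izb $ i * u $ iU + s $ iH $ izb $ i * snd (fst (fst h)) $ iU
        + snd (fst h) $ iH $ izb * p $ iU $ i + p $ iH $ izb * snd (fst h) $ iU $ i))) (at (((x, u), p), s))"
    unfolding total_deriv1_codazzi split_def
    by (rule has_derivative_eq_rhs, (rule derivative_intros)+, simp add: fun_eq_iff field_simps)+
  from this[THEN frechet_derivative_eq]
  show "frechet_derivative (total_deriv1 i codazzi_Q) (at (((x, u), p), s)) (prolong2 v (((x, u), p), s)) =
      prolong_coeff2 v iQ izb i (((x, u), p), s)
      - 1/2 * (prolong_coeff2 v iH iz i (((x, u), p), s) * u $ iU + s $ iH $ iz $ i * w $ iU
        + prolong_coeff1 v iH iz ((x, u), p) * p $ iU $ i + p $ iH $ iz * prolong_coeff1 v iU i ((x, u), p))"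
    and "frechet_derivative (total_deriv1 i codazzi_R) (at (((x, u), p), s)) (prolong2 v (((x, u), p), s)) =
      prolong_coeff2 v iR iz i (((x, u), p), s)
      - 1/2 * (prolong_coeff2 v iH izb i (((x, u), p), s) * u $ iU + s $ iH $ izb $ i * w $ iU
        + prolong_coeff1 v iH izb ((x, u), p) * p $ iU $ i + p $ iH $ izb * prolong_coeff1 v iU i ((x, u), p))"
    by (simp_all add: prolong2_def assms)
qed

lemma jet2_equations_gc:
  "jet2_equations {codazzi_Q, codazzi_R} {gauss c} =
     {gauss c, \<lambda>J. codazzi_Q (fst J), \<lambda>J. codazzi_R (fst J)}
     \<union> range (\<lambda>i. total_deriv1 i codazzi_Q) \<union> range (\<lambda>i. total_deriv1 i codazzi_R)"
  unfolding jet2_equations_def by auto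

text \<open>The Codazzi equations and their derivatives appear in solved form: the derivatives of
  \<open>Q\<close> involving \<open>zb\<close> and those of \<open>R\<close> involving
  \<open>z\<close> are given by the entries for \<open>U\<close> and \<open>H\<close>.\<close>

lemma equation_manifold_gc:
  "(((x, u), p), s) \<in> equation_manifold M {codazzi_Q, codazzi_R} {gauss c} \<longleftrightarrow>
     (x, u) \<in> M \<and> (\<forall>\<alpha> i j. s $ \<alpha> $ i $ j = s $ \<alpha> $ j $ i) \<and> gauss c (((x, u), p), s) = 0
     \<and> p $ iQ $ izb = 1/2 * p $ iH $ iz * u $ iU \<and> p $ iR $ iz = 1/2 * p $ iH $ izb * u $ iU
     \<and> (\<forall>i. s $ iQ $ izb $ i = 1/2 * (s $ iH $ iz $ i * u $ iU + p $ iH $ iz * p $ iU $ i))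
     \<and> (\<forall>i. s $ iR $ iz $ i = 1/2 * (s $ iH $ izb $ i * u $ iU + p $ iH $ izb * p $ iU $ i))"
  unfolding equation_manifold_def jet2_equations_gc jets2_def total_deriv1_codazzi
  by (simp add: ball_Un codazzi_Q_def codazzi_R_def)

lemma open_gc_domain: "open A \<Longrightarrow> open B \<Longrightarrow> open V \<Longrightarrow> open (gc_domain A B V)"
proof -
  assume o: "open A" "open B" "open V"
  have "gc_domain A B V = (\<lambda>y. fst y $ iz) -` A \<inter> (\<lambda>y. fst y $ izb) -` B \<inter> snd -` V"
    by (auto simp: gc_domain_def)
  also have "open \<dots>"
    using o by (auto intro!: open_Int open_vimage continuous_intros)
  finally show ?thesis .
qed

section \<open>The fields X(F) + Y(G) + k a and their tangency to the system\<close>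

locale gauss_codazzi_domain =
  fixes A B :: "complex set" and V :: "(complex ^ 4) set" and M :: "(2, 4) jet0 set"
  assumes A: "open A" "connected A" "A \<noteq> {}"
    and B: "open B" "connected B" "B \<noteq> {}"
    and V: "open V" "connected V" "V \<noteq> {}" "\<And>u. u \<in> V \<Longrightarrow> u $ iU \<noteq> 0"
    and M_def: "M = gc_domain A B V"
begin

lemma M_iff: "(x, u) \<in> M \<longleftrightarrow> x $ iz \<in> A \<and> x $ izb \<in> B \<and> u \<in> V"
  by (simp add: M_def gc_domain_def)

lemma open_M: "open M"
  using A(1) B(1) V(1) by (simp add: M_def open_gc_domain)

text \<open>One family carries the rest of the proof: the generators are special members, the
  symmetries turn out to be the members with \<open>c = 0 \<or> k = 0\<close>, and brackets are
  computed once for two arbitrary members.\<close>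

definition gc_field :: "(complex \<Rightarrow> complex) \<Rightarrow> (complex \<Rightarrow> complex) \<Rightarrow> complex \<Rightarrow> (2, 4) vfield" where
  "gc_field F G k = gc_X M F + gc_Y M G + vscale k (gc_a M)"

lemma gc_field_outside: "y \<notin> M \<Longrightarrow> gc_field F G k y = 0"
  by (simp add: gc_field_def gc_X_def gc_Y_def gc_a_def field_on_def vscale_def cscale_def zero_prod_def)

lemma gc_field_nth:
  assumes "(x, u) \<in> M"
  shows "fst (gc_field F G k (x, u)) $ iz = F (x $ iz)" "fst (gc_field F G k (x, u)) $ izb = G (x $ izb)"
    and "snd (gc_field F G k (x, u)) $ iU = u $ iU * (2 * k - deriv F (x $ iz) - deriv G (x $ izb))"
    and "snd (gc_field F G k (x, u)) $ iH = u $ iH * (- k)"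
    and "snd (gc_field F G k (x, u)) $ iQ = u $ iQ * (k - 2 * deriv F (x $ iz))"
    and "snd (gc_field F G k (x, u)) $ iR = u $ iR * (k - 2 * deriv G (x $ izb))"
  using assms
  by (simp_all add: gc_field_def gc_X_def gc_Y_def gc_a_def field_on_def vscale_def cscale_def axis_def algebra_simps)

text \<open>The numbers \<open>\<kappa>, m, n\<close> are the weights with which
  \<open>u $ \<alpha>\<close> is scaled: \<open>2 k, -1, -1\<close> for \<open>U\<close>, then
  \<open>- k, 0, 0\<close> for \<open>H\<close>, \<open>k, -2, 0\<close> for \<open>Q\<close> and
  \<open>k, 0, -2\<close> for \<open>R\<close>.\<close>

lemma gc_field_prolong:
  assumes F: "F holomorphic_on A" and G: "G holomorphic_on B" and xu: "(x, u) \<in> M"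
    and \<alpha>: "\<And>x u. (x, u) \<in> M \<Longrightarrow> snd (gc_field F G k (x, u)) $ \<alpha> =
      u $ \<alpha> * (\<kappa> + m * deriv F (x $ iz) + n * deriv G (x $ izb))"
  defines "w \<equiv> \<kappa> + m * deriv F (x $ iz) + n * deriv G (x $ izb)" and "v \<equiv> gc_field F G k"
  shows "prolong_coeff1 v \<alpha> iz ((x, u), p) =
      p $ \<alpha> $ iz * (w - deriv F (x $ iz)) + u $ \<alpha> * (m * deriv (deriv F) (x $ iz))"
    and "prolong_coeff1 v \<alpha> izb ((x, u), p) =
      p $ \<alpha> $ izb * (w - deriv G (x $ izb)) + u $ \<alpha> * (n * deriv (deriv G) (x $ izb))"
    and "prolong_coeff2 v \<alpha> iz iz (((x, u), p), s) =
      s $ \<alpha> $ iz $ iz * (w - 2 * deriv F (x $ iz))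
      + p $ \<alpha> $ iz * ((2 * m - 1) * deriv (deriv F) (x $ iz)) + u $ \<alpha> * (m * deriv (deriv (deriv F)) (x $ iz))"
    and "prolong_coeff2 v \<alpha> iz izb (((x, u), p), s) =
      s $ \<alpha> $ iz $ izb * (w - deriv F (x $ iz) - deriv G (x $ izb))
      + p $ \<alpha> $ iz * (n * deriv (deriv G) (x $ izb)) + p $ \<alpha> $ izb * (m * deriv (deriv F) (x $ iz))"
    and "prolong_coeff2 v \<alpha> izb iz (((x, u), p), s) =
      s $ \<alpha> $ izb $ iz * (w - deriv F (x $ iz) - deriv G (x $ izb))
      + p $ \<alpha> $ iz * (n * deriv (deriv G) (x $ izb)) + p $ \<alpha> $ izb * (m * deriv (deriv F) (x $ iz))"
    and "prolong_coeff2 v \<alpha> izb izb (((x, u), p), s) =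
      s $ \<alpha> $ izb $ izb * (w - 2 * deriv G (x $ izb))
      + p $ \<alpha> $ izb * ((2 * n - 1) * deriv (deriv G) (x $ izb)) + u $ \<alpha> * (n * deriv (deriv (deriv G)) (x $ izb))"
proof -
  define \<xi> where "\<xi> = (\<lambda>i :: 2. if i = iz then F else G)"
  define \<mu> where "\<mu> = (\<lambda>i :: 2. if i = iz then m else n)"
  define S where "S = (\<lambda>i :: 2. if i = iz then A else B)"
  have h: "open (S i)" "\<xi> i holomorphic_on S i" "\<And>x u. (x, u) \<in> M \<Longrightarrow> x $ i \<in> S i"
    "\<And>x u. (x, u) \<in> M \<Longrightarrow> fst (v (x, u)) $ i = \<xi> i (x $ i)" for i
    using A B F G exhaust_2[of i] by (auto simp: S_def \<xi>_def M_iff v_def gc_field_nth)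
  have \<alpha>': "snd (v (x, u)) $ \<alpha> = u $ \<alpha> * (\<kappa> + (\<Sum>i\<in>UNIV. \<mu> i * deriv (\<xi> i) (x $ i)) + 0)" if "(x, u) \<in> M" for x u
    using \<alpha>[OF that] by (simp add: v_def \<xi>_def \<mu>_def sum_2 algebra_simps)
  note pc = prolong_coeff1_scaling[where T = UNIV and g = "\<lambda>_. 0" and \<beta> = \<alpha>, OF open_M h(1-3) open_UNIV holomorphic_on_const UNIV_I h(4) \<alpha>' xu]
    prolong_coeff2_scaling[where T = UNIV and g = "\<lambda>_. 0" and \<beta> = \<alpha>, OF open_M h(1-3) open_UNIV holomorphic_on_const UNIV_I h(4) \<alpha>' xu]
  show "prolong_coeff1 v \<alpha> iz ((x, u), p) =
      p $ \<alpha> $ iz * (w - deriv F (x $ iz)) + u $ \<alpha> * (m * deriv (deriv F) (x $ iz))"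
    and "prolong_coeff1 v \<alpha> izb ((x, u), p) =
      p $ \<alpha> $ izb * (w - deriv G (x $ izb)) + u $ \<alpha> * (n * deriv (deriv G) (x $ izb))"
    and "prolong_coeff2 v \<alpha> iz iz (((x, u), p), s) =
      s $ \<alpha> $ iz $ iz * (w - 2 * deriv F (x $ iz))
      + p $ \<alpha> $ iz * ((2 * m - 1) * deriv (deriv F) (x $ iz)) + u $ \<alpha> * (m * deriv (deriv (deriv F)) (x $ iz))"
    and "prolong_coeff2 v \<alpha> iz izb (((x, u), p), s) =
      s $ \<alpha> $ iz $ izb * (w - deriv F (x $ iz) - deriv G (x $ izb))
      + p $ \<alpha> $ iz * (n * deriv (deriv G) (x $ izb)) + p $ \<alpha> $ izb * (m * deriv (deriv F) (x $ iz))"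
    and "prolong_coeff2 v \<alpha> izb iz (((x, u), p), s) =
      s $ \<alpha> $ izb $ iz * (w - deriv F (x $ iz) - deriv G (x $ izb))
      + p $ \<alpha> $ iz * (n * deriv (deriv G) (x $ izb)) + p $ \<alpha> $ izb * (m * deriv (deriv F) (x $ iz))"
    and "prolong_coeff2 v \<alpha> izb izb (((x, u), p), s) =
      s $ \<alpha> $ izb $ izb * (w - 2 * deriv G (x $ izb))
      + p $ \<alpha> $ izb * ((2 * n - 1) * deriv (deriv G) (x $ izb)) + u $ \<alpha> * (n * deriv (deriv (deriv G)) (x $ izb))"
    by (simp_all only: pc) (simp_all add: w_def \<xi>_def \<mu>_def sum_2 algebra_simps)
qed

lemma gc_field_holomorphic:
  assumes F: "F holomorphic_on A" and G: "G holomorphic_on B"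
  shows "gc_field F G k \<in> holomorphic_fields M"
proof (rule holomorphic_fieldsI)
  fix y i \<alpha> assume "y \<in> M"
  then obtain x u where y: "y = (x, u)" "(x, u) \<in> M" by (cases y) auto
  define \<xi> where "\<xi> = (\<lambda>i :: 2. if i = iz then F else G)"
  define S where "S = (\<lambda>i :: 2. if i = iz then A else B)"
  have h: "open (S i)" "\<xi> i holomorphic_on S i" "\<And>x u. (x, u) \<in> M \<Longrightarrow> x $ i \<in> S i"
    "\<And>x u. (x, u) \<in> M \<Longrightarrow> fst (gc_field F G k (x, u)) $ i = \<xi> i (x $ i)" for i
    using A B F G exhaust_2[of i] by (auto simp: S_def \<xi>_def M_iff gc_field_nth)
  obtain \<kappa> \<mu> where \<alpha>: "snd (gc_field F G k (x, u)) $ \<alpha> = u $ \<alpha> * (\<kappa> + (\<Sum>i\<in>UNIV. \<mu> i * deriv (\<xi> i) (x $ i)) + 0)"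
    if "(x, u) \<in> M" for x u
  proof -
    consider "\<alpha> = iU" | "\<alpha> = iH" | "\<alpha> = iQ" | "\<alpha> = iR" using exhaust_4[of \<alpha>] by blast
    then show ?thesis
    proof cases
      case 1 then show ?thesis
        by (intro that[of "2 * k" "\<lambda>_. - 1"]) (simp add: gc_field_nth sum_2 \<xi>_def algebra_simps)
    next
      case 2 then show ?thesis
        by (intro that[of "- k" "\<lambda>_. 0"]) (simp add: gc_field_nth sum_2 \<xi>_def algebra_simps)
    next
      case 3 then show ?thesis
        by (intro that[of "k" "\<lambda>i. if i = iz then - 2 else 0"]) (simp add: gc_field_nth sum_2 \<xi>_def algebra_simps)
    next
      case 4 then show ?thesis
        by (intro that[of "k" "\<lambda>i. if i = iz then 0 else - 2"]) (simp add: gc_field_nth sum_2 \<xi>_def algebra_simps)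
    qed
  qed
  note D = scaling_fst_has_derivative[where T = UNIV and g = "\<lambda>_. 0" and \<beta> = \<alpha>,
      OF open_M h(1-3) open_UNIV holomorphic_on_const UNIV_I h(4) \<alpha> y(2)]
    scaling_snd_has_derivative[where T = UNIV and g = "\<lambda>_. 0" and \<beta> = \<alpha>,
      OF open_M h(1-3) open_UNIV holomorphic_on_const UNIV_I h(4) \<alpha> y(2)]
  show "holomorphic0_at (\<lambda>y. fst (gc_field F G k y) $ i) y"
    unfolding y(1) holomorphic0_at_def by (intro exI conjI, rule D) (auto simp: cscale_def)
  show "holomorphic0_at (\<lambda>y. snd (gc_field F G k y) $ \<alpha>) y"
    unfolding y(1) holomorphic0_at_def
    by (intro exI conjI, rule D) (auto simp: cscale_def sum_distrib_left algebra_simps)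
qed (rule gc_field_outside)

text \<open>The left-hand sides are relative invariants up to one term. The prolonged field
  multiplies \<open>codazzi_Q\<close> by \<open>k - 2 F' - G'\<close> and \<open>codazzi_R\<close>
  by \<open>k - F' - 2 G'\<close>, so it sends their total derivatives to combinations of these
  equations and their derivatives. It multiplies \<open>gauss\<close> by \<open>- F' - G'\<close>,
  apart from the extra term \<open>- k c\<^sup>2 U\<close>: the summand with
  \<open>c\<^sup>2\<close> does not scale under \<open>a\<close> like the one with
  \<open>H\<^sup>2\<close>.\<close>

lemma gc_field_symmetry:
  assumes F: "F holomorphic_on A" and G: "G holomorphic_on B" and k: "c = 0 \<or> k = 0"
  shows "gc_field F G k \<in> gc_symmetries M c"
  unfolding gc_symmetries_def lie_point_symmetries_def
proof (intro CollectI conjI ballI)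
  fix J e assume J: "J \<in> equation_manifold M {codazzi_Q, codazzi_R} {gauss c}"
    and e: "e \<in> jet2_equations {codazzi_Q, codazzi_R} {gauss c}"
  obtain x u p s where J_eq: "J = (((x, u), p), s)" by (metis prod.collapse)
  from J have xu: "(x, u) \<in> M" and sym: "\<And>\<alpha> i j. s $ \<alpha> $ i $ j = s $ \<alpha> $ j $ i"
    and gs: "gauss c (((x, u), p), s) = 0"
    and q: "p $ iQ $ izb = 1/2 * p $ iH $ iz * u $ iU" and r: "p $ iR $ iz = 1/2 * p $ iH $ izb * u $ iU"
    and qi: "\<And>i. s $ iQ $ izb $ i = 1/2 * (s $ iH $ iz $ i * u $ iU + p $ iH $ iz * p $ iU $ i)"
    and ri: "\<And>i. s $ iR $ iz $ i = 1/2 * (s $ iH $ izb $ i * u $ iU + p $ iH $ izb * p $ iU $ i)"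
    unfolding J_eq equation_manifold_gc by blast+
  have U: "u $ iU \<noteq> 0" using xu V(4) by (simp add: M_iff)
  define v where "v = gc_field F G k"
  obtain y w where yw: "v (x, u) = (y, w)" by fastforce
  have wU: "w $ iU = u $ iU * (2 * k - deriv F (x $ iz) - deriv G (x $ izb))"
    and wH: "w $ iH = u $ iH * (- k)"
    and wQ: "w $ iQ = u $ iQ * (k - 2 * deriv F (x $ iz))"
    and wR: "w $ iR = u $ iR * (k - 2 * deriv G (x $ izb))"
    using gc_field_nth[OF xu, of F G k] yw by (simp_all add: v_def)
  have "\<And>x u. (x, u) \<in> M \<Longrightarrow> snd (gc_field F G k (x, u)) $ iU = u $ iU * (2 * k + - 1 * deriv F (x $ iz) + - 1 * deriv G (x $ izb))"
    by (simp add: gc_field_nth)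
  note pU = gc_field_prolong[OF F G xu this, folded v_def]
  have "\<And>x u. (x, u) \<in> M \<Longrightarrow> snd (gc_field F G k (x, u)) $ iH = u $ iH * (- k + 0 * deriv F (x $ iz) + 0 * deriv G (x $ izb))"
    by (simp add: gc_field_nth)
  note pH = gc_field_prolong[OF F G xu this, folded v_def]
  have "\<And>x u. (x, u) \<in> M \<Longrightarrow> snd (gc_field F G k (x, u)) $ iQ = u $ iQ * (k + - 2 * deriv F (x $ iz) + 0 * deriv G (x $ izb))"
    by (simp add: gc_field_nth)
  note pQ = gc_field_prolong[OF F G xu this, folded v_def]
  have "\<And>x u. (x, u) \<in> M \<Longrightarrow> snd (gc_field F G k (x, u)) $ iR = u $ iR * (k + 0 * deriv F (x $ iz) + - 2 * deriv G (x $ izb))"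
    by (simp add: gc_field_nth)
  note pR = gc_field_prolong[OF F G xu this, folded v_def]
  consider "e = gauss c" | "e = (\<lambda>J. codazzi_Q (fst J))" | "e = (\<lambda>J. codazzi_R (fst J))"
    | i where "e = total_deriv1 i codazzi_Q" | i where "e = total_deriv1 i codazzi_R"
    using e unfolding jet2_equations_gc by blast
  then have "frechet_derivative e (at (((x, u), p), s)) (prolong2 v (((x, u), p), s)) = 0"
  proof cases
    case 1
    have "frechet_derivative e (at (((x, u), p), s)) (prolong2 v (((x, u), p), s)) =
      - (deriv F (x $ iz) + deriv G (x $ izb)) * gauss c (((x, u), p), s) - k * c\<^sup>2 * u $ iU"
      \<comment> \<open>Writing the quotients with \<open>inverse\<close> and adding the equations
        for the inverses of \<open>U\<close> and of 2 turns the claim into a polynomial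
        identity.\<close>
      by (simp only: 1 gauss_tangent[where v = v, OF U yw] pU wU wH wQ wR,
          simp only: gauss_def prod.case divide_inverse power_inverse[symmetric])
        (use right_inverse[OF U] right_inverse[of "2 :: complex", OF zero_neq_numeral[symmetric]] in algebra)
    then show ?thesis using k gs by auto
  next
    case 2 show ?thesis
      by (simp only: 2 codazzi_tangent(1)[where v = v, OF yw] pQ pH wU q) (simp add: algebra_simps)
  next
    case 3 show ?thesis
      by (simp only: 3 codazzi_tangent(2)[where v = v, OF yw] pR pH wU r) (simp add: algebra_simps)
  next
    case (4 i)
    consider "i = iz" | "i = izb" using exhaust_2 by blast
    then show ?thesis
      by cases (simp_all only: 4 total_deriv1_codazzi_tangent(1)[where v = v, OF yw] pQ pH pU wU q qi,
          simp_all add: sym[of _ izb iz] field_simps)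
  next
    case (5 i)
    consider "i = iz" | "i = izb" using exhaust_2 by blast
    then show ?thesis
      by cases (simp_all only: 5 total_deriv1_codazzi_tangent(2)[where v = v, OF yw] pR pH pU wU r ri,
          simp_all add: sym[of _ izb iz] field_simps)
  qed
  then show "frechet_derivative e (at J) (prolong2 (gc_field F G k) J) = 0"
    by (simp add: J_eq v_def)
qed (rule gc_field_holomorphic[OF F G])

end

section \<open>Determining equations from the two Codazzi equations\<close>

text \<open>For the first Codazzi equation the letters \<open>f, h, m, n\<close> denote the
  coefficients of the field at \<open>Q, H, z, zb\<close>, and \<open>w\<close> the one at
  \<open>U\<close>. A suffix \<open>U, H, Q, R\<close> names the variable of derivation;
  \<open>f0, m0, n0\<close> are derivatives by \<open>zb\<close>, and \<open>h0, m1, n1\<close> by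
  \<open>z\<close>. The free first derivatives \<open>U_z, U_zb, H_z, H_zb, Q_z, R_zb\<close> are
  \<open>a, b, p, q, r, s\<close>, and the equations have replaced \<open>Q_zb\<close> and
  \<open>R_z\<close> by \<open>1/2 * p * U\<close> and \<open>1/2 * q * U\<close>.\<close>

lemma codazzi_coefficients:
  fixes U w f0 fU fH fQ fR m0 m1 mU mH mQ mR n0 n1 nU nH nQ nR h0 hU hH hQ hR :: complex
  assumes U: "U \<noteq> 0"
    and E: "\<And>a b p q r s.
      f0 + b * fU + q * fH + 1/2 * p * U * fQ + s * fR
      - ((m0 + b * mU + q * mH + 1/2 * p * U * mQ + s * mR) * r
         + (n0 + b * nU + q * nH + 1/2 * p * U * nQ + s * nR) * (1/2 * p * U))
      - 1/2 * ((h0 + a * hU + p * hH + r * hQ + 1/2 * q * U * hR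
          - ((m1 + a * mU + p * mH + r * mQ + 1/2 * q * U * mR) * p
             + (n1 + a * nU + p * nH + r * nQ + 1/2 * q * U * nR) * q)) * U + p * w) = 0"
  shows "hU = 0" "fU = 0" "fR = 0" "mU = 0" "nU = 0" "mR = 0" "nR = 0"
    and "2 * mH = U * nQ" "2 * f0 = U * h0" "- 2 * m0 = U * hQ"
    and "4 * fH - U\<^sup>2 * hR + 2 * U * n1 = 0"
    and "w = U * (fQ - n0 - hH + m1)"
proof -
  \<comment> \<open>Multiplication by 4 clears the fractions, which leaves integral coefficients for
    \<open>algebra\<close>.\<close>
  have E': "4 * f0 + 4 * b * fU + 4 * q * fH + 2 * p * U * fQ + 4 * s * fR
      - ((4 * m0 + 4 * b * mU + 4 * q * mH + 2 * p * U * mQ + 4 * s * mR) * r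
         + (2 * n0 + 2 * b * nU + 2 * q * nH + p * U * nQ + 2 * s * nR) * (p * U))
      - ((2 * h0 + 2 * a * hU + 2 * p * hH + 2 * r * hQ + q * U * hR
          - ((2 * m1 + 2 * a * mU + 2 * p * mH + 2 * r * mQ + q * U * mR) * p
             + (2 * n1 + 2 * a * nU + 2 * p * nH + 2 * r * nQ + q * U * nR) * q)) * U + 2 * p * w) = 0" for a b p q r s
    using arg_cong[OF E[of b q p s r a], of "(*) 4"] by (simp add: algebra_simps)
  \<comment> \<open>The positions stand for \<open>b, q, p, s, r, a\<close>, the order of first
    occurrence. The values 1 and -1 separate the linear from the quadratic part in \<open>p\<close>
    and in \<open>q\<close>; setting two letters to 1 isolates their product.\<close>
  note E0 = E'[of 0 0 0 0 0 0]
    and Ea = E'[of 0 0 0 0 0 1] and Eb = E'[of 1 0 0 0 0 0]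
    and Er = E'[of 0 0 0 0 1 0] and Es = E'[of 0 0 0 1 0 0]
    and Ep = E'[of 0 0 1 0 0 0] E'[of 0 0 "-1" 0 0 0]
    and Eq = E'[of 0 1 0 0 0 0] E'[of 0 "-1" 0 0 0 0]
    and Eap = E'[of 0 0 1 0 0 1] and Eaq = E'[of 0 1 0 0 0 1]
    and Epq = E'[of 0 1 1 0 0 0]
  have "2 * (2 * f0) = 2 * (U * h0)" using E0 by algebra
  then show "2 * f0 = U * h0" by (simp only: mult_cancel_left) simp
  have "2 * (U * hU) = 0" using E0 Ea by algebra
  then show hU: "hU = 0" using U by simp
  have "4 * fU = 0" using E0 Eb by algebra
  then show "fU = 0" by simp
  have "4 * fR = 0" using E0 Es by algebra
  then show "fR = 0" by simp
  have "2 * (- 2 * m0) = 2 * (U * hQ)" using E0 Er by algebra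
  then show "- 2 * m0 = U * hQ" by (simp only: mult_cancel_left) simp
  have "2 * U * (2 * mH - U * nQ) = 0" using Ep E0 by algebra
  then show "2 * mH = U * nQ" using U by simp
  have "4 * w = 4 * (U * (fQ - n0 - hH + m1))" using Ep by algebra
  then show "w = U * (fQ - n0 - hH + m1)" by simp
  have "2 * U * U * nR = 0" using Eq E0 by algebra
  then show "nR = 0" using U by simp
  have "2 * (4 * fH - U\<^sup>2 * hR + 2 * U * n1) = 0" using Eq by algebra
  then show "4 * fH - U\<^sup>2 * hR + 2 * U * n1 = 0" by (simp only: mult_eq_0_iff) simp
  have "2 * U * mU = 0" using Eap Ep(1) Ea E0 by algebra
  then show "mU = 0" using U by simp
  have "2 * U * nU = 0" using Eaq Eq(1) Ea E0 by algebra
  then show "nU = 0" using U by simp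
  \<comment> \<open>The letter \<open>nH\<close> enters the coefficient of \<open>p * q\<close>
    twice with opposite signs, so only \<open>mR\<close> is left there.\<close>
  have "U * U * mR = 0" using Epq Eq(1) Ep(1) E0 by algebra
  then show "mR = 0" using U by simp
qed

text \<open>The Gauss equation can be solved for \<open>U_z_zb\<close>, the Codazzi equations for
  \<open>Q_zb\<close> and \<open>R_z\<close>, and their derivatives for the second derivatives of
  \<open>Q\<close> involving \<open>zb\<close> and of \<open>R\<close> involving \<open>z\<close>.
  Hence six first derivatives and \<open>t = H_z_zb\<close> may be prescribed at will; the latter
  isolates \<open>h''\<close> in the Gauss condition.\<close>

lemma gc_jet_exists:
  fixes x :: "complex ^ 2" and u :: "complex ^ 4"
  assumes "(x, u) \<in> M" "u $ iU \<noteq> 0"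
  obtains P S where "(((x, u), P), S) \<in> equation_manifold M {codazzi_Q, codazzi_R} {gauss c}"
    "P $ iU $ iz = a" "P $ iU $ izb = b" "P $ iH $ iz = p" "P $ iH $ izb = q" "P $ iQ $ iz = r" "P $ iR $ izb = s"
    "P $ iQ $ izb = 1/2 * p * u $ iU" "P $ iR $ iz = 1/2 * q * u $ iU" "S $ iH $ iz $ izb = t"
proof -
  define P :: "(complex ^ 2) ^ 4" where "P = (\<chi> \<alpha> i. if \<alpha> = iU then if i = iz then a else b else
    if \<alpha> = iH then if i = iz then p else q else
    if \<alpha> = iQ then if i = iz then r else 1/2 * p * u $ iU else
    if i = iz then 1/2 * q * u $ iU else s)"
  \<comment> \<open>Entries that are neither prescribed nor forced are 0, except in the block of
    \<open>U\<close>, which is filled uniformly with the value that \<open>gauss\<close> forces on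
    \<open>U_z_zb\<close>.\<close>
  define S :: "((complex ^ 2) ^ 2) ^ 4" where "S = (\<chi> \<alpha> i j.
    if \<alpha> = iU then (a * b / (u $ iU)\<^sup>2 - 1/2 * ((u $ iH)\<^sup>2 - c\<^sup>2) * u $ iU + 2 * u $ iQ * u $ iR * inverse (u $ iU)) * u $ iU else
    if \<alpha> = iH then if i = j then 0 else t else
    if \<alpha> = iQ then if i = iz \<and> j = iz then 0 else if i = izb \<and> j = izb then 1/2 * (t * u $ iU + p * b) else 1/2 * p * a else
    if i = izb \<and> j = izb then 0 else if i = iz \<and> j = iz then 1/2 * (t * u $ iU + q * a) else 1/2 * q * b)"
  show ?thesis
  proof (rule that[of P S])
    show "(((x, u), P), S) \<in> equation_manifold M {codazzi_Q, codazzi_R} {gauss c}"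
      unfolding equation_manifold_gc
      using assms by (auto simp: P_def S_def forall_2 gauss_def)
  qed (simp_all add: P_def S_def)
qed

lemma prolong_coeff1_gc:
  assumes "v \<in> holomorphic_fields M" "y \<in> M"
  shows "prolong_coeff1 v \<alpha> i (y, p) =
    partial_x i (\<lambda>y. snd (v y) $ \<alpha>) y + (\<Sum>\<beta>\<in>UNIV. p $ \<beta> $ i * partial_u \<beta> (\<lambda>y. snd (v y) $ \<alpha>) y)
    - (\<Sum>k\<in>UNIV. (partial_x i (\<lambda>y. fst (v y) $ k) y
        + (\<Sum>\<beta>\<in>UNIV. p $ \<beta> $ i * partial_u \<beta> (\<lambda>y. fst (v y) $ k) y)) * p $ \<alpha> $ k)"
  by (simp add: prolong_coeff1_def total_deriv0_holomorphic holomorphic_fields_nth[OF assms])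

locale gc_symmetry = gauss_codazzi_domain +
  fixes v :: "(2, 4) vfield" and c :: complex
  assumes symmetry: "v \<in> gc_symmetries M c"
begin

abbreviation \<xi> :: "2 \<Rightarrow> (2, 4) jet0 \<Rightarrow> complex" where "\<xi> i \<equiv> \<lambda>y. fst (v y) $ i"
abbreviation \<phi> :: "4 \<Rightarrow> (2, 4) jet0 \<Rightarrow> complex" where "\<phi> \<alpha> \<equiv> \<lambda>y. snd (v y) $ \<alpha>"

lemma v_holomorphic: "v \<in> holomorphic_fields M"
  using symmetry by (simp add: gc_symmetries_def lie_point_symmetries_def)

lemmas component_holomorphic = holomorphic_fields_nth[OF v_holomorphic]

lemma tangent:
  assumes "J \<in> equation_manifold M {codazzi_Q, codazzi_R} {gauss c}"
    "e \<in> jet2_equations {codazzi_Q, codazzi_R} {gauss c}"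
  shows "frechet_derivative e (at J) (prolong2 v J) = 0"
  using symmetry assms by (simp add: gc_symmetries_def lie_point_symmetries_def)

lemma U_nonzero: "y \<in> M \<Longrightarrow> snd y $ iU \<noteq> 0"
  using V(4) by (cases y) (simp add: M_iff)

text \<open>Comparison of coefficients by \<open>codazzi_coefficients\<close>. The last equation
  expresses \<open>\<phi> iU\<close> through first partial derivatives of the other
  coefficients.\<close>

lemma codazzi_Q_determining:
  assumes "y \<in> M"
  shows "partial_u iU (\<phi> iH) y = 0"
    "partial_u iU (\<phi> iQ) y = 0"
    "partial_u iR (\<phi> iQ) y = 0"
    "partial_u iU (\<xi> iz) y = 0"
    "partial_u iU (\<xi> izb) y = 0"
    "partial_u iR (\<xi> iz) y = 0"
    "partial_u iR (\<xi> izb) y = 0"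
    "2 * partial_u iH (\<xi> iz) y = snd y $ iU * partial_u iQ (\<xi> izb) y"
    "2 * partial_x izb (\<phi> iQ) y = snd y $ iU * partial_x iz (\<phi> iH) y"
    "- 2 * partial_x izb (\<xi> iz) y = snd y $ iU * partial_u iQ (\<phi> iH) y"
    "4 * partial_u iH (\<phi> iQ) y - (snd y $ iU)\<^sup>2 * partial_u iR (\<phi> iH) y + 2 * snd y $ iU * partial_x iz (\<xi> izb) y = 0"
    "\<phi> iU y = snd y $ iU * (partial_u iQ (\<phi> iQ) y - partial_x izb (\<xi> izb) y - partial_u iH (\<phi> iH) y + partial_x iz (\<xi> iz) y)"
proof -
  obtain x u where y: "y = (x, u)" by (cases y) auto
  have U: "snd y $ iU \<noteq> 0" by (rule U_nonzero[OF assms])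
  have E: "partial_x izb (\<phi> iQ) y + b * partial_u iU (\<phi> iQ) y + q * partial_u iH (\<phi> iQ) y + 1/2 * p * snd y $ iU * partial_u iQ (\<phi> iQ) y + s * partial_u iR (\<phi> iQ) y
      - ((partial_x izb (\<xi> iz) y + b * partial_u iU (\<xi> iz) y + q * partial_u iH (\<xi> iz) y + 1/2 * p * snd y $ iU * partial_u iQ (\<xi> iz) y + s * partial_u iR (\<xi> iz) y) * r
         + (partial_x izb (\<xi> izb) y + b * partial_u iU (\<xi> izb) y + q * partial_u iH (\<xi> izb) y + 1/2 * p * snd y $ iU * partial_u iQ (\<xi> izb) y + s * partial_u iR (\<xi> izb) y) * (1/2 * p * snd y $ iU))
      - 1/2 * ((partial_x iz (\<phi> iH) y + a * partial_u iU (\<phi> iH) y + p * partial_u iH (\<phi> iH) y + r * partial_u iQ (\<phi> iH) y + 1/2 * q * snd y $ iU * partial_u iR (\<phi> iH) y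
          - ((partial_x iz (\<xi> iz) y + a * partial_u iU (\<xi> iz) y + p * partial_u iH (\<xi> iz) y + r * partial_u iQ (\<xi> iz) y + 1/2 * q * snd y $ iU * partial_u iR (\<xi> iz) y) * p
             + (partial_x iz (\<xi> izb) y + a * partial_u iU (\<xi> izb) y + p * partial_u iH (\<xi> izb) y + r * partial_u iQ (\<xi> izb) y + 1/2 * q * snd y $ iU * partial_u iR (\<xi> izb) y) * q)) * snd y $ iU + p * \<phi> iU y) = 0" for a b p q r s
  proof -
    obtain P S where J: "(((x, u), P), S) \<in> equation_manifold M {codazzi_Q, codazzi_R} {gauss c}"
      and P: "P $ iU $ iz = a" "P $ iU $ izb = b" "P $ iH $ iz = p" "P $ iH $ izb = q" "P $ iQ $ iz = r" "P $ iR $ izb = s"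
        "P $ iQ $ izb = 1/2 * p * snd y $ iU" "P $ iR $ iz = 1/2 * q * snd y $ iU"
      by (rule gc_jet_exists[where x = x and u = u and M = M and c = c and a = a and b = b and p = p and q = q and r = r and s = s and t = 0])
        (use assms U in \<open>auto simp: y\<close>)
    have "(\<lambda>J. codazzi_Q (fst J)) \<in> jet2_equations {codazzi_Q, codazzi_R} {gauss c}"
      by (simp add: jet2_equations_gc)
    from tangent[OF J this] have "prolong_coeff1 v iQ izb (y, P)
        - 1/2 * (prolong_coeff1 v iH iz (y, P) * snd y $ iU + P $ iH $ iz * \<phi> iU y) = 0"
      using codazzi_tangent(1)[of v x u "fst (v y)" "snd (v y)" P S] by (simp add: y)
    then show ?thesis
      unfolding prolong_coeff1_gc[OF v_holomorphic assms] sum_2 sum_4 P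
      by (simp only: add.assoc add.commute add.left_commute)
  qed
  from codazzi_coefficients[OF U E]
  show "partial_u iU (\<phi> iH) y = 0"
    "partial_u iU (\<phi> iQ) y = 0"
    "partial_u iR (\<phi> iQ) y = 0"
    "partial_u iU (\<xi> iz) y = 0"
    "partial_u iU (\<xi> izb) y = 0"
    "partial_u iR (\<xi> iz) y = 0"
    "partial_u iR (\<xi> izb) y = 0"
    "2 * partial_u iH (\<xi> iz) y = snd y $ iU * partial_u iQ (\<xi> izb) y"
    "2 * partial_x izb (\<phi> iQ) y = snd y $ iU * partial_x iz (\<phi> iH) y"
    "- 2 * partial_x izb (\<xi> iz) y = snd y $ iU * partial_u iQ (\<phi> iH) y"
    "4 * partial_u iH (\<phi> iQ) y - (snd y $ iU)\<^sup>2 * partial_u iR (\<phi> iH) y + 2 * snd y $ iU * partial_x iz (\<xi> izb) y = 0"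
    "\<phi> iU y = snd y $ iU * (partial_u iQ (\<phi> iQ) y - partial_x izb (\<xi> izb) y - partial_u iH (\<phi> iH) y + partial_x iz (\<xi> iz) y)"
    by blast+
qed

text \<open>The system is unchanged when \<open>z\<close> and \<open>zb\<close>, and at the same
  time \<open>Q\<close> and \<open>R\<close>, are interchanged. The jet is therefore prescribed with
  these roles exchanged, which gives the tangency condition exactly the form required by
  \<open>codazzi_coefficients\<close>.\<close>

lemma codazzi_R_determining:
  assumes "y \<in> M"
  shows "partial_u iU (\<phi> iH) y = 0"
    "partial_u iU (\<phi> iR) y = 0"
    "partial_u iQ (\<phi> iR) y = 0"
    "partial_u iU (\<xi> izb) y = 0"
    "partial_u iU (\<xi> iz) y = 0"
    "partial_u iQ (\<xi> izb) y = 0"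
    "partial_u iQ (\<xi> iz) y = 0"
    "2 * partial_u iH (\<xi> izb) y = snd y $ iU * partial_u iR (\<xi> iz) y"
    "2 * partial_x iz (\<phi> iR) y = snd y $ iU * partial_x izb (\<phi> iH) y"
    "- 2 * partial_x iz (\<xi> izb) y = snd y $ iU * partial_u iR (\<phi> iH) y"
    "4 * partial_u iH (\<phi> iR) y - (snd y $ iU)\<^sup>2 * partial_u iQ (\<phi> iH) y + 2 * snd y $ iU * partial_x izb (\<xi> iz) y = 0"
    "\<phi> iU y = snd y $ iU * (partial_u iR (\<phi> iR) y - partial_x iz (\<xi> iz) y - partial_u iH (\<phi> iH) y + partial_x izb (\<xi> izb) y)"
proof -
  obtain x u where y: "y = (x, u)" by (cases y) auto
  have U: "snd y $ iU \<noteq> 0" by (rule U_nonzero[OF assms])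
  have E: "partial_x iz (\<phi> iR) y + b * partial_u iU (\<phi> iR) y + q * partial_u iH (\<phi> iR) y + 1/2 * p * snd y $ iU * partial_u iR (\<phi> iR) y + s * partial_u iQ (\<phi> iR) y
      - ((partial_x iz (\<xi> izb) y + b * partial_u iU (\<xi> izb) y + q * partial_u iH (\<xi> izb) y + 1/2 * p * snd y $ iU * partial_u iR (\<xi> izb) y + s * partial_u iQ (\<xi> izb) y) * r
         + (partial_x iz (\<xi> iz) y + b * partial_u iU (\<xi> iz) y + q * partial_u iH (\<xi> iz) y + 1/2 * p * snd y $ iU * partial_u iR (\<xi> iz) y + s * partial_u iQ (\<xi> iz) y) * (1/2 * p * snd y $ iU))
      - 1/2 * ((partial_x izb (\<phi> iH) y + a * partial_u iU (\<phi> iH) y + p * partial_u iH (\<phi> iH) y + r * partial_u iR (\<phi> iH) y + 1/2 * q * snd y $ iU * partial_u iQ (\<phi> iH) y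
          - ((partial_x izb (\<xi> izb) y + a * partial_u iU (\<xi> izb) y + p * partial_u iH (\<xi> izb) y + r * partial_u iR (\<xi> izb) y + 1/2 * q * snd y $ iU * partial_u iQ (\<xi> izb) y) * p
             + (partial_x izb (\<xi> iz) y + a * partial_u iU (\<xi> iz) y + p * partial_u iH (\<xi> iz) y + r * partial_u iR (\<xi> iz) y + 1/2 * q * snd y $ iU * partial_u iQ (\<xi> iz) y) * q)) * snd y $ iU + p * \<phi> iU y) = 0" for a b p q r s
  proof -
    obtain P S where J: "(((x, u), P), S) \<in> equation_manifold M {codazzi_Q, codazzi_R} {gauss c}"
      and P: "P $ iU $ iz = b" "P $ iU $ izb = a" "P $ iH $ iz = q" "P $ iH $ izb = p" "P $ iQ $ iz = s" "P $ iR $ izb = r"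
        "P $ iQ $ izb = 1/2 * q * snd y $ iU" "P $ iR $ iz = 1/2 * p * snd y $ iU"
      by (rule gc_jet_exists[where x = x and u = u and M = M and c = c and a = b and b = a and p = q and q = p and r = s and s = r and t = 0])
        (use assms U in \<open>auto simp: y\<close>)
    have "(\<lambda>J. codazzi_R (fst J)) \<in> jet2_equations {codazzi_Q, codazzi_R} {gauss c}"
      by (simp add: jet2_equations_gc)
    from tangent[OF J this] have "prolong_coeff1 v iR iz (y, P)
        - 1/2 * (prolong_coeff1 v iH izb (y, P) * snd y $ iU + P $ iH $ izb * \<phi> iU y) = 0"
      using codazzi_tangent(2)[of v x u "fst (v y)" "snd (v y)" P S] by (simp add: y)
    then show ?thesis
      unfolding prolong_coeff1_gc[OF v_holomorphic assms] sum_2 sum_4 P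
      by (simp only: add.assoc add.commute add.left_commute)
  qed
  from codazzi_coefficients[OF U E]
  show "partial_u iU (\<phi> iH) y = 0"
    "partial_u iU (\<phi> iR) y = 0"
    "partial_u iQ (\<phi> iR) y = 0"
    "partial_u iU (\<xi> izb) y = 0"
    "partial_u iU (\<xi> iz) y = 0"
    "partial_u iQ (\<xi> izb) y = 0"
    "partial_u iQ (\<xi> iz) y = 0"
    "2 * partial_u iH (\<xi> izb) y = snd y $ iU * partial_u iR (\<xi> iz) y"
    "2 * partial_x iz (\<phi> iR) y = snd y $ iU * partial_x izb (\<phi> iH) y"
    "- 2 * partial_x iz (\<xi> izb) y = snd y $ iU * partial_u iR (\<phi> iH) y"
    "4 * partial_u iH (\<phi> iR) y - (snd y $ iU)\<^sup>2 * partial_u iQ (\<phi> iH) y + 2 * snd y $ iU * partial_x izb (\<xi> iz) y = 0"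
    "\<phi> iU y = snd y $ iU * (partial_u iR (\<phi> iR) y - partial_x iz (\<xi> iz) y - partial_u iH (\<phi> iH) y + partial_x izb (\<xi> izb) y)"
    by blast+
qed

end

section \<open>Dependence of each coefficient on its own variables only\<close>

lemma norm_axis: "norm (axis \<alpha> (t :: complex) :: complex ^ 'n::finite) = norm t"
  by (simp add: norm_vec_def L2_set_def axis_def if_distrib[of norm] if_distrib[of "\<lambda>x. x\<^sup>2"] cong: if_cong)

context gc_symmetry
begin

lemma ball_in_M:
  assumes "y \<in> M" obtains r where "r > 0" "ball y r \<subseteq> M"
  using open_M assms open_contains_ball by blast

text \<open>A single \<open>\<epsilon>\<close> serves all functions \<open>f\<close>, so that a
  relation between several functions can be evaluated at one and the same shifted point.\<close>

lemma shift_u: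
  assumes "y \<in> M"
  obtains \<epsilon> :: real where "\<epsilon> > 0" "\<And>\<tau>. norm \<tau> < \<epsilon> \<Longrightarrow> y + (0, axis \<alpha> \<tau>) \<in> M"
    and "\<And>\<tau> f. norm \<tau> < \<epsilon> \<Longrightarrow> (\<And>y. y \<in> M \<Longrightarrow> holomorphic0_at f y) \<Longrightarrow> (\<And>y. y \<in> M \<Longrightarrow> partial_u \<alpha> f y = 0)
       \<Longrightarrow> f (y + (0, axis \<alpha> \<tau>)) = f y"
    and "\<And>\<tau> f i. norm \<tau> < \<epsilon> \<Longrightarrow> (\<And>y. y \<in> M \<Longrightarrow> holomorphic0_at f y) \<Longrightarrow> (\<And>y. y \<in> M \<Longrightarrow> partial_u \<alpha> f y = 0)
       \<Longrightarrow> partial_x i f (y + (0, axis \<alpha> \<tau>)) = partial_x i f y"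
    and "\<And>\<tau> f \<beta>. norm \<tau> < \<epsilon> \<Longrightarrow> (\<And>y. y \<in> M \<Longrightarrow> holomorphic0_at f y) \<Longrightarrow> (\<And>y. y \<in> M \<Longrightarrow> partial_u \<alpha> f y = 0)
       \<Longrightarrow> partial_u \<beta> f (y + (0, axis \<alpha> \<tau>)) = partial_u \<beta> f y"
proof -
  obtain r where r: "r > 0" "ball y r \<subseteq> M" using ball_in_M[OF assms] by blast
  have b: "y + (0, axis \<alpha> \<tau>) \<in> ball y r" if "norm \<tau> < r" for \<tau> :: complex
    using that by (simp add: dist_norm norm_Pair norm_axis)
  have y: "y \<in> ball y r" using r by simp
  show ?thesis
  proof (rule that[OF r(1)])
    show "y + (0, axis \<alpha> \<tau>) \<in> M" if "norm \<tau> < r" for \<tau> using b[OF that] r by blast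
  next
    fix \<tau> :: complex and f :: "(2, 4) jet0 \<Rightarrow> complex" and i \<beta>
    assume *: "norm \<tau> < r" "\<And>y. y \<in> M \<Longrightarrow> holomorphic0_at f y" "\<And>y. y \<in> M \<Longrightarrow> partial_u \<alpha> f y = 0"
    have s: "fst (0 :: complex ^ 2, axis \<alpha> \<tau>) $ i = 0 \<or> partial_x i f z = 0"
      "snd (0 :: complex ^ 2, axis \<alpha> \<tau>) $ \<beta> = 0 \<or> partial_u \<beta> f z = 0" "holomorphic0_at f z" if "z \<in> ball y r" for z i \<beta>
      using that *(2,3)[of z] r by (auto simp: axis_def)
    show "f (y + (0, axis \<alpha> \<tau>)) = f y"
      by (rule shift_value[OF convex_ball y b[OF *(1)]]; erule s)
    show "partial_x i f (y + (0, axis \<alpha> \<tau>)) = partial_x i f y"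
      by (rule shift_partial[OF convex_ball open_ball y b[OF *(1)]]; erule s)
    show "partial_u \<beta> f (y + (0, axis \<alpha> \<tau>)) = partial_u \<beta> f y"
      by (rule shift_partial[OF convex_ball open_ball y b[OF *(1)]]; erule s)
  qed
qed

text \<open>The derivatives by \<open>U\<close> vanish by either Codazzi equation, those by
  \<open>R\<close> by the first and those by \<open>Q\<close> by the second. The two relations for
  the derivatives by \<open>H\<close> then have right-hand side 0.\<close>

lemma xi_u:
  assumes "y \<in> M" shows "partial_u \<beta> (\<xi> i) y = 0"
proof -
  have "partial_u \<beta> (\<xi> iz) y = 0 \<and> partial_u \<beta> (\<xi> izb) y = 0"
    using codazzi_Q_determining(4-8)[OF assms] codazzi_R_determining(4-8)[OF assms] exhaust_4[of \<beta>] by auto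
  then show ?thesis using exhaust_2[of i] by auto
qed

lemma separate_powers_of_U:
  assumes y: "y \<in> M"
    and f: "\<And>y. y \<in> M \<Longrightarrow> holomorphic0_at f y" "\<And>y. y \<in> M \<Longrightarrow> partial_u iU f y = 0"
    and g: "\<And>y. y \<in> M \<Longrightarrow> holomorphic0_at g y" "\<And>y. y \<in> M \<Longrightarrow> partial_u iU g y = 0"
    and P: "P = partial_x i \<or> P = partial_u \<alpha>"
    and eq: "\<And>y. y \<in> M \<Longrightarrow> k * partial_x j f y = snd y $ iU * P g y" and k: "k \<noteq> 0"
  shows "partial_x j f y = 0" "P g y = 0"
proof -
  obtain \<epsilon> where \<epsilon>: "\<epsilon> > 0" "\<And>\<tau>. norm \<tau> < \<epsilon> \<Longrightarrow> y + (0, axis iU \<tau>) \<in> M"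
      "\<And>\<tau>. norm \<tau> < \<epsilon> \<Longrightarrow> partial_x j f (y + (0, axis iU \<tau>)) = partial_x j f y"
      "\<And>\<tau>. norm \<tau> < \<epsilon> \<Longrightarrow> P g (y + (0, axis iU \<tau>)) = P g y"
  proof (rule shift_u[OF y, of iU])
    fix \<epsilon> :: real
    assume \<epsilon>: "\<epsilon> > 0" "\<And>\<tau>. norm \<tau> < \<epsilon> \<Longrightarrow> y + (0, axis iU \<tau>) \<in> M"
      and x: "\<And>\<tau> f i. norm \<tau> < \<epsilon> \<Longrightarrow> (\<And>y. y \<in> M \<Longrightarrow> holomorphic0_at f y) \<Longrightarrow> (\<And>y. y \<in> M \<Longrightarrow> partial_u iU f y = 0)
       \<Longrightarrow> partial_x i f (y + (0, axis iU \<tau>)) = partial_x i f y"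
      and u: "\<And>\<tau> f \<beta>. norm \<tau> < \<epsilon> \<Longrightarrow> (\<And>y. y \<in> M \<Longrightarrow> holomorphic0_at f y) \<Longrightarrow> (\<And>y. y \<in> M \<Longrightarrow> partial_u iU f y = 0)
       \<Longrightarrow> partial_u \<beta> f (y + (0, axis iU \<tau>)) = partial_u \<beta> f y"
    show thesis
    proof (rule that[OF \<epsilon>])
      fix \<tau> :: complex assume \<tau>: "norm \<tau> < \<epsilon>"
      show "partial_x j f (y + (0, axis iU \<tau>)) = partial_x j f y" by (rule x[OF \<tau> f])
      show "P g (y + (0, axis iU \<tau>)) = P g y"
        using P
      proof
        assume "P = partial_x i"
        then show ?thesis by (simp only: x[OF \<tau> g])
      next
        assume "P = partial_u \<alpha>"
        then show ?thesis by (simp only: u[OF \<tau> g])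
      qed
    qed
  qed
  \<comment> \<open>Any nonzero shift shorter than \<open>\<epsilon>\<close> would do: subtracting
    the relations at the two points leaves \<open>\<tau> * P g y = 0\<close>.\<close>
  define \<tau> :: complex where "\<tau> = of_real (\<epsilon> / 2)"
  have \<tau>: "norm \<tau> < \<epsilon>" "\<tau> \<noteq> 0" using \<epsilon>(1) by (auto simp: \<tau>_def)
  have "k * partial_x j f y = (snd y $ iU + \<tau>) * P g y"
    using eq[OF \<epsilon>(2)[OF \<tau>(1)]] \<epsilon>(3,4)[OF \<tau>(1)] by simp
  with eq[OF y] have "\<tau> * P g y = 0" by (simp add: algebra_simps)
  then show "P g y = 0" using \<tau> by simp
  then show "partial_x j f y = 0" using eq[OF y] k by simp
qed

text \<open>Four relations, two from each Codazzi equation, have the form treated by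
  \<open>separate_powers_of_U\<close>. In the three-term relations only the derivatives of
  \<open>\<phi> iQ\<close> and \<open>\<phi> iR\<close> by \<open>H\<close> then survive.\<close>

lemma mixed_partials:
  assumes y: "y \<in> M"
  shows "partial_x izb (\<xi> iz) y = 0" "partial_x iz (\<xi> izb) y = 0"
    "partial_u iQ (\<phi> iH) y = 0" "partial_u iR (\<phi> iH) y = 0"
    "partial_x iz (\<phi> iH) y = 0" "partial_x izb (\<phi> iH) y = 0"
    "partial_x izb (\<phi> iQ) y = 0" "partial_x iz (\<phi> iR) y = 0"
    "partial_u iH (\<phi> iQ) y = 0" "partial_u iH (\<phi> iR) y = 0"
proof -
  note h = component_holomorphic and Q = codazzi_Q_determining and R = codazzi_R_determining
  show *: "partial_x izb (\<xi> iz) y = 0" "partial_u iQ (\<phi> iH) y = 0"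
    by (rule separate_powers_of_U[where f = "\<xi> iz" and g = "\<phi> iH" and P = "partial_u iQ" and k = "- 2"
        and i = iz and \<alpha> = iQ and j = izb, OF y h(1) xi_u h(2) Q(1) disjI2[OF refl] Q(10)]; simp)+
  show **: "partial_x iz (\<xi> izb) y = 0" "partial_u iR (\<phi> iH) y = 0"
    by (rule separate_powers_of_U[where f = "\<xi> izb" and g = "\<phi> iH" and P = "partial_u iR" and k = "- 2"
        and i = iz and \<alpha> = iR and j = iz, OF y h(1) xi_u h(2) Q(1) disjI2[OF refl] R(10)]; simp)+
  show "partial_x izb (\<phi> iQ) y = 0" "partial_x iz (\<phi> iH) y = 0"
    by (rule separate_powers_of_U[where f = "\<phi> iQ" and g = "\<phi> iH" and P = "partial_x iz" and k = "2"
        and i = iz and \<alpha> = iR and j = izb, OF y h(2) Q(2) h(2) Q(1) disjI1[OF refl] Q(9)]; simp)+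
  show "partial_x iz (\<phi> iR) y = 0" "partial_x izb (\<phi> iH) y = 0"
    by (rule separate_powers_of_U[where f = "\<phi> iR" and g = "\<phi> iH" and P = "partial_x izb" and k = "2"
        and i = izb and \<alpha> = iR and j = iz, OF y h(2) R(2) h(2) R(1) disjI1[OF refl] R(9)]; simp)+
  show "partial_u iH (\<phi> iQ) y = 0" "partial_u iH (\<phi> iR) y = 0"
    using Q(11)[OF y] R(11)[OF y] * ** by simp_all
qed

lemma phi_H_partials:
  assumes "y \<in> M" shows "partial_x i (\<phi> iH) y = 0" "\<alpha> \<noteq> iH \<Longrightarrow> partial_u \<alpha> (\<phi> iH) y = 0"
  using mixed_partials[OF assms] codazzi_Q_determining(1)[OF assms] exhaust_2[of i] exhaust_4[of \<alpha>] by auto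

lemma phi_Q_partials:
  assumes "y \<in> M" shows "i \<noteq> iz \<Longrightarrow> partial_x i (\<phi> iQ) y = 0" "\<alpha> \<noteq> iQ \<Longrightarrow> partial_u \<alpha> (\<phi> iQ) y = 0"
  using mixed_partials[OF assms] codazzi_Q_determining(2,3)[OF assms] exhaust_2[of i] exhaust_4[of \<alpha>] by auto

lemma phi_R_partials:
  assumes "y \<in> M" shows "i \<noteq> izb \<Longrightarrow> partial_x i (\<phi> iR) y = 0" "\<alpha> \<noteq> iR \<Longrightarrow> partial_u \<alpha> (\<phi> iR) y = 0"
  using mixed_partials[OF assms] codazzi_R_determining(2,3)[OF assms] exhaust_2[of i] exhaust_4[of \<alpha>] by auto

lemma xi_x: "y \<in> M \<Longrightarrow> i \<noteq> j \<Longrightarrow> partial_x i (\<xi> j) y = 0"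
  using mixed_partials[of y] exhaust_2[of i] exhaust_2[of j] by auto

text \<open>Both Codazzi equations express \<open>\<phi> iU\<close>. When they are equated,
  \<open>\<phi> iH\<close> drops out and the nonzero factor \<open>U\<close> cancels.\<close>

lemma K_eq:
  assumes "y \<in> M"
  shows "partial_u iQ (\<phi> iQ) y + 2 * partial_x iz (\<xi> iz) y = partial_u iR (\<phi> iR) y + 2 * partial_x izb (\<xi> izb) y"
proof -
  have "snd y $ iU * (partial_u iQ (\<phi> iQ) y - partial_x izb (\<xi> izb) y - partial_u iH (\<phi> iH) y + partial_x iz (\<xi> iz) y)
    = snd y $ iU * (partial_u iR (\<phi> iR) y - partial_x iz (\<xi> iz) y - partial_u iH (\<phi> iH) y + partial_x izb (\<xi> izb) y)"
    using codazzi_Q_determining(12)[OF assms] codazzi_R_determining(12)[OF assms] by (simp only:)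
  then show ?thesis unfolding mult_left_cancel[OF U_nonzero[OF assms]] by algebra
qed

lemma (in gauss_codazzi_domain) connected_M: "connected M"
proof -
  have "M = (\<lambda>(a, b, u). ((\<chi> i. if i = iz then a else b), u)) ` (A \<times> B \<times> V)"
  proof (intro set_eqI iffI)
    fix y assume "y \<in> M"
    then show "y \<in> (\<lambda>(a, b, u). ((\<chi> i. if i = iz then a else b), u)) ` (A \<times> B \<times> V)"
      by (intro image_eqI[where x = "(fst y $ iz, fst y $ izb, snd y)"])
        (cases y; simp add: M_iff vec_eq_iff forall_2)+
  qed (auto simp: M_iff)
  moreover have "continuous_on (A \<times> B \<times> V) (\<lambda>(a :: complex, b, u :: complex ^ 4). ((\<chi> i :: 2. if i = iz then a else b), u))"
  proof -
    have "continuous_on S (\<lambda>x. if i = iz then fst x else fst (snd x))" for i :: 2 and S :: "(complex \<times> complex \<times> (complex ^ 4)) set"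
      by (cases "i = iz") (auto intro!: continuous_intros)
    then show ?thesis unfolding split_def by (auto intro!: continuous_intros)
  qed
  ultimately show ?thesis
    using connected_continuous_image A(2) B(2) V(2) connected_Times by metis
qed

text \<open>Of the two expressions related by \<open>K_eq\<close>, one is insensitive to every
  direction other than \<open>z\<close> and \<open>Q\<close>, the other to every direction other
  than \<open>zb\<close> and \<open>R\<close>. Moving in two stages shows local constancy, which
  also supplies the differentiability of a function built from partial derivatives; connectedness of
  \<open>M\<close> does the rest.\<close>

lemma K_constant:
  obtains K where "\<And>y. y \<in> M \<Longrightarrow> partial_u iQ (\<phi> iQ) y = K - 2 * partial_x iz (\<xi> iz) y"
    "\<And>y. y \<in> M \<Longrightarrow> partial_u iR (\<phi> iR) y = K - 2 * partial_x izb (\<xi> izb) y"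
proof -
  define K where "K = (\<lambda>y. partial_u iQ (\<phi> iQ) y + 2 * partial_x iz (\<xi> iz) y)"
  have loc: "holomorphic0_at K y \<and> partial_x i K y = 0 \<and> partial_u \<alpha> K y = 0" if y: "y \<in> M" for y i \<alpha>
  proof -
    obtain r where r: "r > 0" "ball y r \<subseteq> M" using ball_in_M[OF y] by blast
    have K: "K z = K y" if "z \<in> ball y r" for z
    proof -
      \<comment> \<open>\<open>h1\<close> is the displacement with its components along
        \<open>z\<close> and \<open>Q\<close> deleted, and \<open>h2\<close> is what was deleted.
        Along \<open>h1\<close> the expression in \<open>\<phi> iQ\<close> and
        \<open>\<xi> iz\<close> is constant, along \<open>h2\<close> the one in
        \<open>\<phi> iR\<close> and \<open>\<xi> izb\<close>.\<close>
      define h1 :: "(2, 4) jet0" where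
        "h1 = (\<chi> i. if i = iz then 0 else fst (z - y) $ i, \<chi> \<alpha>. if \<alpha> = iQ then 0 else snd (z - y) $ \<alpha>)"
      define h2 where "h2 = z - y - h1"
      \<comment> \<open>Deleting components does not increase the norm, so the intermediate point
        stays in the ball.\<close>
      have "norm h1 \<le> norm (z - y)"
        unfolding norm_prod_def h1_def
        by (intro real_sqrt_le_mono add_mono power_mono) (auto intro!: norm_le_componentwise_cart)
      then have b: "y + h1 \<in> ball y r" using that by (simp add: dist_norm norm_minus_commute)
      have z: "z = y + h1 + h2" by (simp add: h2_def)
      have b2: "y + h1 + h2 \<in> ball y r" using that z by simp
      have y: "y \<in> ball y r" using r by simp
      have 1: "fst h1 $ i = 0 \<or> partial_x i (\<xi> iz) w = 0" "fst h1 $ i = 0 \<or> partial_x i (\<phi> iQ) w = 0"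
        "snd h1 $ \<alpha> = 0 \<or> partial_u \<alpha> (\<phi> iQ) w = 0" if "w \<in> ball y r" for w i \<alpha>
        using phi_Q_partials[of w] xi_x[of w] r that by (auto simp: h1_def)
      have 2: "fst h2 $ i = 0 \<or> partial_x i (\<xi> izb) w = 0" "fst h2 $ i = 0 \<or> partial_x i (\<phi> iR) w = 0"
        "snd h2 $ \<alpha> = 0 \<or> partial_u \<alpha> (\<phi> iR) w = 0" if "w \<in> ball y r" for w i \<alpha>
        using phi_R_partials[of w] xi_x[of w] r that by (auto simp: h1_def h2_def)
      have h: "holomorphic0_at (\<xi> i) w" "holomorphic0_at (\<phi> \<alpha>) w" "snd h $ \<beta> = 0 \<or> partial_u \<beta> (\<xi> i) w = 0"
        if "w \<in> ball y r" for w i \<alpha> \<beta> and h :: "(2, 4) jet0"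
      proof -
        have "w \<in> M" using that r by blast
        then show "holomorphic0_at (\<xi> i) w" "holomorphic0_at (\<phi> \<alpha>) w" "snd h $ \<beta> = 0 \<or> partial_u \<beta> (\<xi> i) w = 0"
          by (simp_all add: component_holomorphic xi_u)
      qed
      have "partial_u iQ (\<phi> iQ) (y + h1) = partial_u iQ (\<phi> iQ) y"
        by (rule shift_partial[OF convex_ball open_ball y b]; (erule h 1)?)
      moreover have "partial_x iz (\<xi> iz) (y + h1) = partial_x iz (\<xi> iz) y"
        by (rule shift_partial[OF convex_ball open_ball y b]; (erule h 1)?)
      moreover have "partial_u iR (\<phi> iR) (y + h1 + h2) = partial_u iR (\<phi> iR) (y + h1)"
        by (rule shift_partial[OF convex_ball open_ball b b2]; (erule h 2)?)
      moreover have "partial_x izb (\<xi> izb) (y + h1 + h2) = partial_x izb (\<xi> izb) (y + h1)"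
        by (rule shift_partial[OF convex_ball open_ball b b2]; (erule h 2)?)
      moreover have "y + h1 \<in> M" "y + h1 + h2 \<in> M" using b b2 r by blast+
      ultimately show ?thesis using z K_eq[of "y + h1"] K_eq[of "y + h1 + h2"] by (simp add: K_def)
    qed
    have c: "holomorphic0_at (\<lambda>_. K y) y" "partial_x i (\<lambda>_. K y) y = 0" "partial_u \<alpha> (\<lambda>_. K y) y = 0"
      by (rule holomorphic0_atI[where D = "\<lambda>_. 0" and a = "\<lambda>_. 0" and b = "\<lambda>_. 0"]; simp)+
    have "y \<in> ball y r" using r by simp
    from holomorphic0_at_local[OF c(1) open_ball this K] c show ?thesis by simp
  qed
  obtain k where "\<And>y. y \<in> M \<Longrightarrow> K y = k"
    using constant_if_partials_vanish[OF open_M connected_M, of K] loc by blast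
  then show ?thesis using that[of k] K_eq by (simp add: K_def algebra_simps)
qed

end

section \<open>Reduction to functions of one complex variable\<close>

text \<open>For a fixed value of \<open>x $ i\<close> the other variables range over the connected
  set \<open>D \<times> W\<close>, so \<open>f\<close> is constant there and \<open>F\<close> is
  defined on all of \<open>C\<close> at once. The indices are kept general to serve \<open>z\<close>
  as well as \<open>zb\<close>.\<close>

lemma function_of_x:
  fixes f :: "(2, 'q::finite) jet0 \<Rightarrow> complex" and i j :: 2
  assumes ij: "i \<noteq> j" and N: "\<And>x u. (x, u) \<in> N \<longleftrightarrow> x $ i \<in> C \<and> x $ j \<in> D \<and> u \<in> W"
    and C: "open C" and D: "open D" "connected D" "D \<noteq> {}" and W: "open W" "connected W" "W \<noteq> {}"
    and f: "\<And>y. y \<in> N \<Longrightarrow> holomorphic0_at f y" "\<And>y. y \<in> N \<Longrightarrow> partial_x j f y = 0"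
      "\<And>y \<alpha>. y \<in> N \<Longrightarrow> partial_u \<alpha> f y = 0"
  obtains F where "F holomorphic_on C" "\<And>x u. (x, u) \<in> N \<Longrightarrow> f (x, u) = F (x $ i)"
    "\<And>x u. (x, u) \<in> N \<Longrightarrow> partial_x i f (x, u) = deriv F (x $ i)"
proof -
  define X where "X t w = (axis i t + axis j w :: complex ^ 2)" for t w
  have X: "X t w $ i = t" "X t w $ j = w" for t w using ij by (auto simp: X_def axis_def)
  have UNIV2: "k = i \<or> k = j" for k using ij exhaust_2[of i] exhaust_2[of j] exhaust_2[of k] by auto
  have sum2: "sum g UNIV = g i + g j" for g :: "2 \<Rightarrow> complex"
    using ij exhaust_2[of i] exhaust_2[of j] by (auto simp: sum_2)
  have Xx: "X (x $ i) (x $ j) = x" for x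
    unfolding vec_eq_iff using X UNIV2 by metis
  obtain w0 u0 where w0: "w0 \<in> D" "u0 \<in> W" using D W by blast
  define F where "F t = f (X t w0, u0)" for t
  have const: "f (X t w, u) = F t" if t: "t \<in> C" and wu: "w \<in> D" "u \<in> W" for t w u
  proof -
    let ?g = "\<lambda>z. f (X t (fst z), snd z)"
    have d: "(?g has_derivative (\<lambda>_. 0)) (at z)" if z: "z \<in> D \<times> W" for z
    proof -
      have zN: "(X t (fst z), snd z) \<in> N" using z t by (auto simp: N X)
      have "((\<lambda>z. (X t (fst z), snd z)) has_derivative (\<lambda>h. (X 0 (fst h), snd h))) (at z)"
        unfolding X_def by (rule has_derivative_eq_rhs, (rule derivative_intros)+) simp
      from has_derivative_compose[where g = f, OF this holomorphic0_at_has_derivative[OF f(1)[OF zN]]]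
      show ?thesis
        using f(2,3)[OF zN] by (simp add: sum2 X)
    qed
    have "?g constant_on (D \<times> W)"
      by (rule has_derivative_zero_connected_constant_on[of _ "{}"])
        (use D W d in \<open>auto intro!: connected_Times open_Times continuous_at_imp_continuous_on
            intro: has_derivative_at_withinI has_derivative_continuous\<close>)
    then have "?g (w, u) = ?g (w0, u0)" using w0 wu unfolding constant_on_def by (metis SigmaI)
    then show ?thesis by (simp add: F_def)
  qed
  have F': "(F has_field_derivative partial_x i f (X t w0, u0)) (at t)" if t: "t \<in> C" for t
  proof -
    have zN: "(X t w0, u0) \<in> N" using w0 t by (auto simp: N X)
    have "((\<lambda>t. (X t w0, u0)) has_derivative (\<lambda>h. (X h 0, 0))) (at t)"
      unfolding X_def by (rule has_derivative_eq_rhs, (rule derivative_intros)+) simp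
    from has_derivative_compose[where g = f, OF this holomorphic0_at_has_derivative[OF f(1)[OF zN]]]
    show ?thesis
      using f(2,3)[OF zN] by (simp add: sum2 X has_field_derivative_def F_def[abs_def] mult.commute[of _ "partial_x i f _"])
  qed
  have holF: "F holomorphic_on C"
    using F' C by (auto simp: holomorphic_on_open)
  have feq: "f (x, u) = F (x $ i)" if "(x, u) \<in> N" for x u
    using const[of "x $ i" "x $ j" u] that by (simp add: N Xx)
  show ?thesis
  proof (rule that[OF holF feq])
    fix x u assume xu: "(x, u) \<in> N"
    have "((\<lambda>y. F (fst y $ i)) has_derivative (\<lambda>h. deriv F (x $ i) * fst h $ i)) (at (x, u))"
      using holomorphic_has_derivative[OF holF C, of "\<lambda>y. fst y $ i" "(x, u)"] xu
      by (simp add: N has_derivative_coordinate)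
    note Fd = holomorphic0_atI[where a = "\<lambda>k. if k = i then deriv F (x $ i) else 0" and b = "\<lambda>_. 0", OF this]
    have oN: "open N"
    proof -
      have "N = (\<lambda>y. fst y $ i) -` C \<inter> (\<lambda>y. fst y $ j) -` D \<inter> snd -` W" using N by auto
      then show ?thesis using C D W by (auto intro!: open_Int open_vimage continuous_intros)
    qed
    have "partial_x i f (x, u) = partial_x i (\<lambda>y. F (fst y $ i)) (x, u)"
      by (rule holomorphic0_at_local[OF _ oN xu]) (use Fd feq ij in \<open>auto simp: sum2\<close>)
    then show "partial_x i f (x, u) = deriv F (x $ i)" using Fd(2)[of i] ij by (simp add: sum2)
  qed
qed

text \<open>In a ball every point is joined by a segment to the point with the same
  \<open>u $ \<alpha>\<close> on the complex line through the centre in that direction, and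
  \<open>f\<close> is constant along the segment. In a general domain the points with a given
  \<open>u $ \<alpha>\<close> need not form a connected set.\<close>

lemma function_of_u_local:
  fixes f :: "('p::finite, 'q::finite) jet0 \<Rightarrow> complex"
  assumes r: "r > 0" and f: "\<And>y. y \<in> ball y0 r \<Longrightarrow> holomorphic0_at f y"
    "\<And>y i. y \<in> ball y0 r \<Longrightarrow> partial_x i f y = 0"
    "\<And>y \<beta>. y \<in> ball y0 r \<Longrightarrow> \<beta> \<noteq> \<alpha> \<Longrightarrow> partial_u \<beta> f y = 0"
  obtains g where "g holomorphic_on ball (snd y0 $ \<alpha>) r" "\<And>y. y \<in> ball y0 r \<Longrightarrow> snd y $ \<alpha> \<in> ball (snd y0 $ \<alpha>) r"
    "\<And>y. y \<in> ball y0 r \<Longrightarrow> f y = g (snd y $ \<alpha>)"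
    "\<And>y. y \<in> ball y0 r \<Longrightarrow> partial_u \<alpha> f y = deriv g (snd y $ \<alpha>)"
proof -
  define e where "e = (\<lambda>t. y0 + (0, axis \<alpha> (t - snd y0 $ \<alpha>)))"
  define g where "g t = f (e t)" for t
  have e: "e t \<in> ball y0 r" if "t \<in> ball (snd y0 $ \<alpha>) r" for t
    using that by (simp add: e_def dist_norm norm_Pair norm_axis norm_minus_commute)
  have nth: "snd y $ \<alpha> \<in> ball (snd y0 $ \<alpha>) r" if "y \<in> ball y0 r" for y
  proof -
    have "norm (snd (y0 - y)) \<le> norm (y0 - y)" by (metis norm_snd_le prod.collapse)
    then have "norm ((snd (y0 - y)) $ \<alpha>) \<le> norm (y0 - y)"
      by (rule order_trans[OF Finite_Cartesian_Product.norm_nth_le])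
    then show ?thesis using that by (simp add: dist_norm)
  qed
  have feq: "f y = g (snd y $ \<alpha>)" if y: "y \<in> ball y0 r" for y
  proof -
    define h where "h = y - e (snd y $ \<alpha>)"
    have h: "snd h $ \<alpha> = 0" "e (snd y $ \<alpha>) + h = y" by (simp_all add: h_def e_def)
    have hz: "snd h $ \<beta> = 0 \<or> partial_u \<beta> f z = 0" if "z \<in> ball y0 r" for z \<beta>
      using f(3)[OF that, of \<beta>] h(1) by (cases "\<beta> = \<alpha>") auto
    have "f (e (snd y $ \<alpha>) + h) = f (e (snd y $ \<alpha>))"
      by (rule shift_value[OF convex_ball e[OF nth[OF y]]]) (use y h(2) f hz in auto)
    then show ?thesis by (simp add: h g_def)
  qed
  have g': "(g has_field_derivative partial_u \<alpha> f (e t)) (at t)" if t: "t \<in> ball (snd y0 $ \<alpha>) r" for t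
  proof -
    have "(e has_derivative (\<lambda>h. (0, axis \<alpha> h))) (at t)"
      unfolding e_def by (rule has_derivative_eq_rhs, (rule derivative_intros)+) simp
    from has_derivative_compose[where g = f, OF this holomorphic0_at_has_derivative[OF f(1)[OF e[OF t]]]]
    have "(g has_derivative (\<lambda>h. \<Sum>\<beta>\<in>UNIV. axis \<alpha> h $ \<beta> * partial_u \<beta> f (e t))) (at t)"
      by (simp add: g_def[abs_def])
    also have "(\<lambda>h. \<Sum>\<beta>\<in>UNIV. axis \<alpha> h $ \<beta> * partial_u \<beta> f (e t)) = (*) (partial_u \<alpha> f (e t))"
      by (simp add: axis_def if_distrib[of "\<lambda>x. x * _"] fun_eq_iff cong: if_cong)
    finally show ?thesis by (simp add: has_field_derivative_def)
  qed
  have holg: "g holomorphic_on ball (snd y0 $ \<alpha>) r"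
    unfolding holomorphic_on_open[OF open_ball] using g' by blast
  show ?thesis
  proof (rule that[OF holg nth feq])
    fix y assume y: "y \<in> ball y0 r"
    have "((\<lambda>y. g (snd y $ \<alpha>)) has_derivative (\<lambda>h. deriv g (snd y $ \<alpha>) * snd h $ \<alpha>)) (at y)"
      by (rule holomorphic_has_derivative[where f = "\<lambda>y. snd y $ \<alpha>", OF holg open_ball]) (use nth[OF y] in \<open>simp_all add: has_derivative_coordinate\<close>)
    note gd = holomorphic0_atI[where b = "\<lambda>\<beta>. if \<beta> = \<alpha> then deriv g (snd y $ \<alpha>) else 0" and a = "\<lambda>_. 0", OF this]
    have "partial_u \<alpha> f y = partial_u \<alpha> (\<lambda>y. g (snd y $ \<alpha>)) y"
      by (rule holomorphic0_at_local[OF _ open_ball y]) (use gd feq in \<open>auto simp: if_distrib[of "\<lambda>x. _ * x"] cong: if_cong\<close>)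
    then show "partial_u \<alpha> f y = deriv g (snd y $ \<alpha>)"
      using gd(3)[of \<alpha>] by (simp add: if_distrib[of "\<lambda>x. _ * x"] cong: if_cong)
  qed
qed

section \<open>Tangency to the Gauss equation\<close>

text \<open>Here \<open>i\<close> is the inverse of \<open>U\<close> as a separate letter,
  \<open>m\<close> the weight of \<open>\<phi>\<^sub>U\<close>, \<open>g\<close> its derivative by
  \<open>H\<close>, \<open>S\<close> is \<open>F' + G'\<close>, \<open>C\<close> is
  \<open>H\<^sup>2 - c\<^sup>2\<close>, \<open>s\<close> is \<open>U_z_zb\<close> and
  \<open>t\<close> is \<open>H_z_zb\<close>. Multiplication by \<open>U\<close> clears the
  denominators, and the Gauss equation itself eliminates \<open>s\<close>.\<close>

lemma gauss_tangent_reduced: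
  fixes U i s w m S h H q Q r R g t C y :: complex
  assumes i: "U * i = 1"
    and tan: "y * i - s * w * i\<^sup>2 + h * H * U + 1/2 * C * w - 2 * (q * R + Q * r) * i + 2 * Q * R * w * i\<^sup>2 = 0"
    and y: "y = s * (m - S) + U * g * t" and w: "w = U * m"
    and s: "s * i + 1/2 * C * U - 2 * Q * R * i = 0"
  shows "U\<^sup>2 * (H * h + 1/2 * C * (m + S)) - 2 * (q * R + r * Q) + 2 * Q * R * (m - S) + U * g * t = 0"
proof -
  have "0 = U * (s * i + 1/2 * C * U - 2 * Q * R * i)" using s by simp
  also have "\<dots> = s * (U * i) + 1/2 * C * U\<^sup>2 - 2 * Q * R * (U * i)" by (simp add: algebra_simps power2_eq_square)
  finally have s': "s = 2 * Q * R - 1/2 * C * U\<^sup>2" by (simp add: i algebra_simps)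
  have "0 = U * (y * i - s * w * i\<^sup>2 + h * H * U + 1/2 * C * w - 2 * (q * R + Q * r) * i + 2 * Q * R * w * i\<^sup>2)"
    using tan by simp
  also have "\<dots> = y * (U * i) - s * m * (U * i)\<^sup>2 + U\<^sup>2 * (h * H + 1/2 * C * m) - 2 * (q * R + Q * r) * (U * i)
      + 2 * Q * R * m * (U * i)\<^sup>2"
    by (simp add: w algebra_simps power2_eq_square)
  finally show ?thesis unfolding i y s' power_one mult_1_right by algebra
qed

context gc_symmetry
begin

lemma xi_functions:
  obtains F G where "F holomorphic_on A" "G holomorphic_on B"
    "\<And>x u. (x, u) \<in> M \<Longrightarrow> \<xi> iz (x, u) = F (x $ iz)" "\<And>x u. (x, u) \<in> M \<Longrightarrow> partial_x iz (\<xi> iz) (x, u) = deriv F (x $ iz)"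
    "\<And>x u. (x, u) \<in> M \<Longrightarrow> \<xi> izb (x, u) = G (x $ izb)" "\<And>x u. (x, u) \<in> M \<Longrightarrow> partial_x izb (\<xi> izb) (x, u) = deriv G (x $ izb)"
proof -
  obtain F where F: "F holomorphic_on A" "\<And>x u. (x, u) \<in> M \<Longrightarrow> \<xi> iz (x, u) = F (x $ iz)"
    "\<And>x u. (x, u) \<in> M \<Longrightarrow> partial_x iz (\<xi> iz) (x, u) = deriv F (x $ iz)"
    by (rule function_of_x[where i = iz and j = izb and f = "\<xi> iz" and N = M and C = A and D = B and W = V])
      (use A B V in \<open>auto simp: M_iff component_holomorphic xi_u xi_x\<close>)
  obtain G where G: "G holomorphic_on B" "\<And>x u. (x, u) \<in> M \<Longrightarrow> \<xi> izb (x, u) = G (x $ izb)"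
    "\<And>x u. (x, u) \<in> M \<Longrightarrow> partial_x izb (\<xi> izb) (x, u) = deriv G (x $ izb)"
    by (rule function_of_x[where i = izb and j = iz and f = "\<xi> izb" and N = M and C = B and D = A and W = V])
      (use A B V in \<open>auto simp: M_iff component_holomorphic xi_u xi_x\<close>)
  show ?thesis by (rule that[OF F(1) G(1) F(2,3) G(2,3)])
qed

text \<open>Near the given point \<open>\<phi> iH\<close> is a function \<open>h\<close> of
  \<open>H\<close>, so \<open>\<alpha>\<close> is \<open>h'\<close> and \<open>\<phi> iU\<close> has
  the scaling form with \<open>g = - h'\<close>. This makes the second prolongation computable over
  the point. The derivative of \<open>g\<close> vanishes since it multiplies the free derivative
  \<open>H_z_zb\<close>.\<close>

lemma gauss_determining:
  assumes F: "F holomorphic_on A" "\<And>x u. (x, u) \<in> M \<Longrightarrow> \<xi> iz (x, u) = F (x $ iz)"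
      "\<And>x u. (x, u) \<in> M \<Longrightarrow> partial_x iz (\<xi> iz) (x, u) = deriv F (x $ iz)"
    and G: "G holomorphic_on B" "\<And>x u. (x, u) \<in> M \<Longrightarrow> \<xi> izb (x, u) = G (x $ izb)"
      "\<And>x u. (x, u) \<in> M \<Longrightarrow> partial_x izb (\<xi> izb) (x, u) = deriv G (x $ izb)"
    and K: "\<And>y. y \<in> M \<Longrightarrow> partial_u iQ (\<phi> iQ) y = K - 2 * partial_x iz (\<xi> iz) y"
    and xu: "(x, u) \<in> M"
  defines "\<alpha> \<equiv> partial_u iH (\<phi> iH)"
  shows "holomorphic0_at \<alpha> (x, u)" "partial_x i \<alpha> (x, u) = 0" "partial_u \<beta> \<alpha> (x, u) = 0"
    and "(u $ iU)\<^sup>2 * (u $ iH * \<phi> iH (x, u) + 1/2 * ((u $ iH)\<^sup>2 - c\<^sup>2) * (K - \<alpha> (x, u)))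
      - 2 * (\<phi> iQ (x, u) * u $ iR + \<phi> iR (x, u) * u $ iQ)
      + 2 * u $ iQ * u $ iR * (K - \<alpha> (x, u) - 2 * deriv F (x $ iz) - 2 * deriv G (x $ izb)) = 0"
    and "\<phi> iU (x, u) = u $ iU * (K - deriv F (x $ iz) - deriv G (x $ izb) - \<alpha> (x, u))"
proof -
  have phi_U: "\<phi> iU (x, u) = u $ iU * (K - deriv F (x $ iz) - deriv G (x $ izb) - \<alpha> (x, u))" if "(x, u) \<in> M" for x u
    unfolding codazzi_Q_determining(12)[OF that] K[OF that] F(3)[OF that] G(3)[OF that] \<alpha>_def
    by (simp add: algebra_simps)
  from this[OF xu] show "\<phi> iU (x, u) = u $ iU * (K - deriv F (x $ iz) - deriv G (x $ izb) - \<alpha> (x, u))" .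
  have U: "u $ iU \<noteq> 0" using U_nonzero[OF xu] by simp
  obtain r where r: "r > 0" "ball (x, u) r \<subseteq> M" using ball_in_M[OF xu] by blast
  have hol: "holomorphic0_at (\<phi> iH) y" "partial_x i (\<phi> iH) y = 0" "\<beta> \<noteq> iH \<Longrightarrow> partial_u \<beta> (\<phi> iH) y = 0"
    if "y \<in> ball (x, u) r" for y i \<beta>
    using component_holomorphic[of y] phi_H_partials[of y] that r(2) by auto
  obtain h where "h holomorphic_on ball (snd (x, u) $ iH) r"
    "\<And>y. y \<in> ball (x, u) r \<Longrightarrow> snd y $ iH \<in> ball (snd (x, u) $ iH) r"
    "\<And>y. y \<in> ball (x, u) r \<Longrightarrow> \<phi> iH y = h (snd y $ iH)"
    "\<And>y. y \<in> ball (x, u) r \<Longrightarrow> partial_u iH (\<phi> iH) y = deriv h (snd y $ iH)"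
    by (rule function_of_u_local[OF r(1) hol], assumption+, rule that) simp_all
  then have h: "h holomorphic_on ball (u $ iH) r" "\<And>y. y \<in> ball (x, u) r \<Longrightarrow> snd y $ iH \<in> ball (u $ iH) r"
    "\<And>y. y \<in> ball (x, u) r \<Longrightarrow> \<alpha> y = deriv h (snd y $ iH)"
    by (simp_all add: \<alpha>_def)
  define g where "g t = - deriv h t" for t
  have g: "g holomorphic_on ball (u $ iH) r" unfolding g_def using h(1) by (intro holomorphic_intros) auto
  have ctr: "(x, u) \<in> ball (x, u) r" "u $ iH \<in> ball (u $ iH) r" using r by auto
  define \<zeta> where "\<zeta> = (\<lambda>i :: 2. if i = iz then F else G)"
  define S where "S = (\<lambda>i :: 2. if i = iz then A else B)"
  have z: "open (S i)" "\<zeta> i holomorphic_on S i" "\<And>x' u'. (x', u') \<in> ball (x, u) r \<Longrightarrow> x' $ i \<in> S i"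
    "\<And>x' u'. (x', u') \<in> ball (x, u) r \<Longrightarrow> fst (v (x', u')) $ i = \<zeta> i (x' $ i)" for i
    using A B F(1,2) G(1,2) exhaust_2[of i] r(2) by (auto simp: S_def \<zeta>_def M_iff subset_iff)
  have gH: "u' $ iH \<in> ball (u $ iH) r" if "(x', u') \<in> ball (x, u) r" for x' u' using h(2)[OF that] by simp
  have vU: "snd (v (x', u')) $ iU = u' $ iU * (K + (\<Sum>i\<in>UNIV. - 1 * deriv (\<zeta> i) (x' $ i)) + g (u' $ iH))"
    if "(x', u') \<in> ball (x, u) r" for x' u'
    using phi_U[of x' u'] that r(2) h(3)[OF that] by (simp add: subset_iff \<zeta>_def sum_2 g_def algebra_simps)
  have pc2: "prolong_coeff2 v iU iz izb (((x, u), p), s) =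
     s $ iU $ iz $ izb * (K - 2 * deriv F (x $ iz) - 2 * deriv G (x $ izb) + g (u $ iH))
     + p $ iU $ iz * (- deriv (deriv G) (x $ izb) + deriv g (u $ iH) * p $ iH $ izb)
     + p $ iU $ izb * (- deriv (deriv F) (x $ iz) + deriv g (u $ iH) * p $ iH $ iz)
     + u $ iU * (deriv (deriv g) (u $ iH) * p $ iH $ iz * p $ iH $ izb + deriv g (u $ iH) * s $ iH $ iz $ izb)" for p s
  proof -
    have "prolong_coeff2 v iU iz izb (((x, u), p), s) =
     s $ iU $ iz $ izb * (K + (\<Sum>i\<in>UNIV. - 1 * deriv (\<zeta> i) (x $ i)) + g (u $ iH)
         - deriv (\<zeta> iz) (x $ iz) - deriv (\<zeta> izb) (x $ izb))
     + p $ iU $ iz * (- 1 * deriv (deriv (\<zeta> izb)) (x $ izb) + deriv g (u $ iH) * p $ iH $ izb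
         - (if iz = izb then deriv (deriv (\<zeta> iz)) (x $ iz) else 0))
     + p $ iU $ izb * (- 1 * deriv (deriv (\<zeta> iz)) (x $ iz) + deriv g (u $ iH) * p $ iH $ iz)
     + u $ iU * ((if iz = izb then - 1 * deriv (deriv (deriv (\<zeta> iz))) (x $ iz) else 0)
         + deriv (deriv g) (u $ iH) * p $ iH $ iz * p $ iH $ izb + deriv g (u $ iH) * s $ iH $ iz $ izb)"
      by (rule prolong_coeff2_scaling[where v = v and \<xi> = \<zeta> and S = S and T = "ball (u $ iH) r" and g = g and \<alpha> = iU and \<beta> = iH
            and \<kappa> = K and \<mu> = "\<lambda>_. - 1" and N = "ball (x, u) r"]) (rule open_ball z g gH vU ctr, assumption?)+
    then show ?thesis by (simp add: \<zeta>_def sum_2 diff_diff_eq algebra_simps)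
  qed
  have \<alpha>: "\<alpha> (x, u) = - g (u $ iH)" using h(3)[OF ctr(1)] by (simp add: g_def)
  have E: "(u $ iU)\<^sup>2 * (u $ iH * \<phi> iH (x, u) + 1/2 * ((u $ iH)\<^sup>2 - c\<^sup>2) * (K - \<alpha> (x, u)))
      - 2 * (\<phi> iQ (x, u) * u $ iR + \<phi> iR (x, u) * u $ iQ)
      + 2 * u $ iQ * u $ iR * (K - \<alpha> (x, u) - 2 * deriv F (x $ iz) - 2 * deriv G (x $ izb))
      + u $ iU * deriv g (u $ iH) * t = 0" for t
  proof -
    \<comment> \<open>With all free first derivatives equal to 0 the first-order terms of
      \<open>pc2\<close> disappear; only \<open>t\<close> stays arbitrary.\<close>
    obtain P s where J: "(((x, u), P), s) \<in> equation_manifold M {codazzi_Q, codazzi_R} {gauss c}"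
      and P: "P $ iU $ iz = 0" "P $ iU $ izb = 0" "P $ iH $ iz = 0" "P $ iH $ izb = 0"
        "P $ iQ $ iz = 0" "P $ iR $ izb = 0" "P $ iQ $ izb = 1/2 * 0 * u $ iU" "P $ iR $ iz = 1/2 * 0 * u $ iU"
        "s $ iH $ iz $ izb = t"
      by (rule gc_jet_exists[OF xu U])
    define i where "i = inverse (u $ iU)"
    have i: "u $ iU * i = 1" using U by (simp add: i_def)
    have div: "a / u $ iU = a * i" "a / (u $ iU)\<^sup>2 = a * i\<^sup>2" for a
      by (simp_all only: i_def divide_inverse power_inverse)
    have "gauss c (((x, u), P), s) = 0" using J unfolding equation_manifold_gc by blast
    then have s: "s $ iU $ iz $ izb * i + 1/2 * ((u $ iH)\<^sup>2 - c\<^sup>2) * u $ iU - 2 * u $ iQ * u $ iR * i = 0"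
      unfolding gauss_def prod.case P div i_def[symmetric] by simp
    have "gauss c \<in> jet2_equations {codazzi_Q, codazzi_R} {gauss c}" by (simp add: jet2_equations_gc)
    from tangent[OF J this] have tan: "prolong_coeff2 v iU iz izb (((x, u), P), s) * i
        - s $ iU $ iz $ izb * \<phi> iU (x, u) * i\<^sup>2
        + \<phi> iH (x, u) * u $ iH * u $ iU + 1/2 * ((u $ iH)\<^sup>2 - c\<^sup>2) * \<phi> iU (x, u)
        - 2 * (\<phi> iQ (x, u) * u $ iR + u $ iQ * \<phi> iR (x, u)) * i
        + 2 * u $ iQ * u $ iR * \<phi> iU (x, u) * i\<^sup>2 = 0"
      unfolding gauss_tangent[where v = v, OF U surjective_pairing] P div by simp
    let ?m = "K - deriv F (x $ iz) - deriv G (x $ izb) - \<alpha> (x, u)" and ?S = "deriv F (x $ iz) + deriv G (x $ izb)"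
    have "prolong_coeff2 v iU iz izb (((x, u), P), s) = s $ iU $ iz $ izb * (?m - ?S) + u $ iU * deriv g (u $ iH) * t"
      unfolding pc2 by (simp add: P \<alpha> algebra_simps)
    from gauss_tangent_reduced[OF i tan this phi_U[OF xu] s]
    show ?thesis by (simp add: diff_diff_eq algebra_simps)
  qed
  from E[of 0] show "(u $ iU)\<^sup>2 * (u $ iH * \<phi> iH (x, u) + 1/2 * ((u $ iH)\<^sup>2 - c\<^sup>2) * (K - \<alpha> (x, u)))
      - 2 * (\<phi> iQ (x, u) * u $ iR + \<phi> iR (x, u) * u $ iQ)
      + 2 * u $ iQ * u $ iR * (K - \<alpha> (x, u) - 2 * deriv F (x $ iz) - 2 * deriv G (x $ izb)) = 0" by simp
  \<comment> \<open>The condition is affine in \<open>t\<close>, so its values at 0 and 1 isolate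
    the slope.\<close>
  have "u $ iU * deriv g (u $ iH) = 0" using E[of 0] E[of 1] by algebra
  then have g0: "deriv g (u $ iH) = 0" using U by simp
  have "((\<lambda>y. - g (snd y $ iH)) has_derivative (\<lambda>h. - (deriv g (snd (x, u) $ iH) * snd h $ iH))) (at (x, u))"
    by (intro has_derivative_minus holomorphic_has_derivative[where f = "\<lambda>y. snd y $ iH", OF g open_ball]) (use ctr(2) in \<open>simp_all add: has_derivative_coordinate\<close>)
  then have g': "((\<lambda>y. - g (snd y $ iH)) has_derivative (\<lambda>h. 0)) (at (x, u))" by (simp add: g0)
  have *: "holomorphic0_at (\<lambda>y. - g (snd y $ iH)) (x, u)" "partial_x i (\<lambda>y. - g (snd y $ iH)) (x, u) = 0"
    "partial_u \<beta> (\<lambda>y. - g (snd y $ iH)) (x, u) = 0"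
    by (rule holomorphic0_atI[where D = "\<lambda>_. 0" and a = "\<lambda>_. 0" and b = "\<lambda>_. 0"], rule g', simp)+
  have eq: "\<alpha> y = - g (snd y $ iH)" if "y \<in> ball (x, u) r" for y using h(3)[OF that] by (simp add: g_def)
  show "holomorphic0_at \<alpha> (x, u)" "partial_x i \<alpha> (x, u) = 0" "partial_u \<beta> \<alpha> (x, u) = 0"
    using holomorphic0_at_local[where g = \<alpha> and S = "ball (x, u) r", OF *(1) open_ball ctr(1) eq]
    by (simp_all only: *)
qed

end

section \<open>Separation of powers and the normal form of a symmetry\<close>

lemma holomorphic0_at_diff:
  fixes f g :: "('p::finite, 'q::finite) jet0 \<Rightarrow> complex"
  assumes "holomorphic0_at f y" "holomorphic0_at g y"
  shows "holomorphic0_at (\<lambda>y. f y - g y) y"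
    "partial_x i (\<lambda>y. f y - g y) y = partial_x i f y - partial_x i g y"
    "partial_u \<alpha> (\<lambda>y. f y - g y) y = partial_u \<alpha> f y - partial_u \<alpha> g y"
  by (rule holomorphic0_atI[where a = "\<lambda>i. partial_x i f y - partial_x i g y"
        and b = "\<lambda>\<alpha>. partial_u \<alpha> f y - partial_u \<alpha> g y",
        OF has_derivative_diff[OF assms[THEN holomorphic0_at_has_derivative]]];
      simp add: sum_subtractf right_diff_distrib)+

text \<open>Describes the part of \<open>\<phi> iQ\<close> or \<open>\<phi> iR\<close> that is
  linear in its own variable and, with constant \<open>f\<close>, the linear part of
  \<open>\<phi> iH\<close>. These parts are subtracted so that the remainders have vanishing
  derivatives by the dependent variables.\<close>

lemma holomorphic0_at_coordinate_mult:
  fixes f :: "complex \<Rightarrow> complex" and y :: "('p::finite, 'q::finite) jet0"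
  assumes f: "f holomorphic_on S" "open S" "fst y $ i \<in> S"
  shows "holomorphic0_at (\<lambda>y. f (fst y $ i) * snd y $ \<alpha>) y"
    "partial_x j (\<lambda>y. f (fst y $ i) * snd y $ \<alpha>) y = (if j = i then deriv f (fst y $ i) * snd y $ \<alpha> else 0)"
    "partial_u \<beta> (\<lambda>y. f (fst y $ i) * snd y $ \<alpha>) y = (if \<beta> = \<alpha> then f (fst y $ i) else 0)"
proof -
  have 1: "((\<lambda>y. f (fst y $ i)) has_derivative (\<lambda>h. deriv f (fst y $ i) * fst h $ i)) (at y)"
    by (rule holomorphic_has_derivative[where f = "\<lambda>y. fst y $ i", OF f has_derivative_coordinate(1)])
  have "((\<lambda>y. f (fst y $ i) * snd y $ \<alpha>) has_derivative
      (\<lambda>h. f (fst y $ i) * snd h $ \<alpha> + deriv f (fst y $ i) * fst h $ i * snd y $ \<alpha>)) (at y)"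
    by (rule has_derivative_mult[OF 1 has_derivative_coordinate(2)])
  note * = holomorphic0_atI[where a = "\<lambda>j. if j = i then deriv f (fst y $ i) * snd y $ \<alpha> else 0"
      and b = "\<lambda>\<beta>. if \<beta> = \<alpha> then f (fst y $ i) else 0", OF this]
  show "holomorphic0_at (\<lambda>y. f (fst y $ i) * snd y $ \<alpha>) y"
    "partial_x j (\<lambda>y. f (fst y $ i) * snd y $ \<alpha>) y = (if j = i then deriv f (fst y $ i) * snd y $ \<alpha> else 0)"
    "partial_u \<beta> (\<lambda>y. f (fst y $ i) * snd y $ \<alpha>) y = (if \<beta> = \<alpha> then f (fst y $ i) else 0)"
    by (rule *; simp add: if_distrib[of "\<lambda>x. _ * x"] mult.commute cong: if_cong)+
qed

lemma (in gauss_codazzi_domain) M_nonempty: obtains y where "y \<in> M"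
proof -
  obtain a b u where "a \<in> A" "b \<in> B" "u \<in> V" using A B V by blast
  then have "((\<chi> i. if i = iz then a else b), u) \<in> M" by (simp add: M_iff)
  then show ?thesis by (rule that)
qed

text \<open>Finite differences do the work of differentiation, as \<open>f\<close> and
  \<open>g\<close> are unaffected by small shifts of the dependent variables. A second difference in
  \<open>U\<close> isolates the factor of \<open>U\<^sup>2\<close>; in that factor a second and a
  first difference in \<open>H\<close> give \<open>K + a = 0\<close> and \<open>b = 0\<close>, which
  leaves \<open>c\<^sup>2 K = 0\<close>. From \<open>f R + g Q = 0\<close> a shift of
  \<open>R\<close> gives \<open>f = 0\<close> and a shift of \<open>Q\<close> gives
  \<open>g = 0\<close>.\<close>

lemma (in gc_symmetry) reduced_coefficients:
  fixes K a b :: complex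
  assumes f: "\<And>y. y \<in> M \<Longrightarrow> holomorphic0_at f y" "\<And>y \<alpha>. y \<in> M \<Longrightarrow> partial_u \<alpha> f y = 0"
    and g: "\<And>y. y \<in> M \<Longrightarrow> holomorphic0_at g y" "\<And>y \<alpha>. y \<in> M \<Longrightarrow> partial_u \<alpha> g y = 0"
    and eq: "\<And>x u. (x, u) \<in> M \<Longrightarrow>
      (u $ iU)\<^sup>2 * (1/2 * (K + a) * (u $ iH)\<^sup>2 + b * u $ iH - 1/2 * c\<^sup>2 * (K - a))
      - 2 * (f (x, u) * u $ iR + g (x, u) * u $ iQ) - 2 * u $ iQ * u $ iR * (K + a) = 0"
  shows "a = - K" "b = 0" "c = 0 \<or> K = 0" "y \<in> M \<Longrightarrow> f y = 0" "y \<in> M \<Longrightarrow> g y = 0"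
proof -
  have shift: "\<exists>\<tau>. \<tau> \<noteq> 0 \<and> (x, u + axis \<alpha> \<tau>) \<in> M \<and> f (x, u + axis \<alpha> \<tau>) = f (x, u) \<and> g (x, u + axis \<alpha> \<tau>) = g (x, u)
      \<and> (x, u - axis \<alpha> \<tau>) \<in> M \<and> f (x, u - axis \<alpha> \<tau>) = f (x, u) \<and> g (x, u - axis \<alpha> \<tau>) = g (x, u)"
    if xu: "(x, u) \<in> M" for x u \<alpha>
  proof (rule shift_u[OF xu, of \<alpha>])
    fix \<epsilon> :: real
    assume e: "\<epsilon> > 0" "\<And>\<tau>. norm \<tau> < \<epsilon> \<Longrightarrow> (x, u) + (0, axis \<alpha> \<tau>) \<in> M"
      "\<And>\<tau> f. norm \<tau> < \<epsilon> \<Longrightarrow> (\<And>y. y \<in> M \<Longrightarrow> holomorphic0_at f y) \<Longrightarrow> (\<And>y. y \<in> M \<Longrightarrow> partial_u \<alpha> f y = 0)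
       \<Longrightarrow> f ((x, u) + (0, axis \<alpha> \<tau>)) = f (x, u)"
    define \<tau> :: complex where "\<tau> = of_real (\<epsilon> / 2)"
    have t: "norm \<tau> < \<epsilon>" "norm (- \<tau>) < \<epsilon>" "\<tau> \<noteq> 0" using e(1) by (auto simp: \<tau>_def)
    have m: "axis \<alpha> (- \<tau>) = - axis \<alpha> \<tau>" by (simp add: vec_eq_iff axis_def)
    show ?thesis
      using t(3) e(2)[OF t(1)] e(2)[OF t(2)] e(3)[OF t(1) f] e(3)[OF t(2) f] e(3)[OF t(1) g] e(3)[OF t(2) g]
      by (intro exI[of _ \<tau>]) (simp add: m)
  qed
  have q: "1/2 * (K + a) * (u $ iH)\<^sup>2 + b * u $ iH - 1/2 * c\<^sup>2 * (K - a) = 0" (is "?q = 0") if xu: "(x, u) \<in> M" for x u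
  proof -
    obtain \<tau> where \<tau>: "\<tau> \<noteq> 0" "(x, u + axis iU \<tau>) \<in> M" "f (x, u + axis iU \<tau>) = f (x, u)" "g (x, u + axis iU \<tau>) = g (x, u)"
      "(x, u - axis iU \<tau>) \<in> M" "f (x, u - axis iU \<tau>) = f (x, u)" "g (x, u - axis iU \<tau>) = g (x, u)"
      using shift[OF xu] by blast
    define r where "r = 2 * (f (x, u) * u $ iR + g (x, u) * u $ iQ) + 2 * u $ iQ * u $ iR * (K + a)"
    \<comment> \<open>The shifts by \<open>\<tau>\<close> and \<open>- \<tau>\<close> together give
      the nonzero factor \<open>2 * \<tau>\<^sup>2\<close>; one shift alone would give
      \<open>\<tau> * (2 * U + \<tau>)\<close>, which might vanish.\<close>
    have "(u $ iU + \<tau>)\<^sup>2 * ?q - r = 0" "(u $ iU - \<tau>)\<^sup>2 * ?q - r = 0" "(u $ iU)\<^sup>2 * ?q - r = 0"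
      using eq[OF \<tau>(2)] eq[OF \<tau>(5)] eq[OF xu] unfolding \<tau> r_def
      by (simp_all add: axis_def diff_diff_eq)
    then have "2 * \<tau>\<^sup>2 * ?q = 0" by algebra
    then show ?thesis using \<tau>(1) by simp
  qed
  obtain x0 u0 where xu0: "(x0, u0) \<in> M" using M_nonempty by (metis surj_pair)
  obtain \<tau> where \<tau>: "\<tau> \<noteq> 0" "(x0, u0 + axis iH \<tau>) \<in> M" "(x0, u0 - axis iH \<tau>) \<in> M"
    using shift[OF xu0] by blast
  have Q: "1/2 * (K + a) * (u0 $ iH + \<tau>)\<^sup>2 + b * (u0 $ iH + \<tau>) - 1/2 * c\<^sup>2 * (K - a) = 0"
    "1/2 * (K + a) * (u0 $ iH - \<tau>)\<^sup>2 + b * (u0 $ iH - \<tau>) - 1/2 * c\<^sup>2 * (K - a) = 0"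
    using q[OF \<tau>(2)] q[OF \<tau>(3)] by (simp_all add: axis_def)
  have "(K + a) * \<tau>\<^sup>2 = 0" using Q q[OF xu0] by algebra
  then have Ka: "K + a = 0" using \<tau> by simp
  then show a: "a = - K" by (simp add: add_eq_0_iff)
  have "b * \<tau> = 0" using Q(1) q[OF xu0] unfolding Ka by algebra
  then show b: "b = 0" using \<tau> by simp
  have "c\<^sup>2 * K = 0" using q[OF xu0] by (simp add: a b)
  then show "c = 0 \<or> K = 0" by simp
  have e: "f (x, u) * u $ iR + g (x, u) * u $ iQ = 0" if "(x, u) \<in> M" for x u
  proof -
    have "- (g (x, u) * u $ iQ) = f (x, u) * u $ iR"
      using eq[OF that, unfolded q[OF that], unfolded Ka] by (simp add: algebra_simps)
    from this[symmetric] show ?thesis by simp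
  qed
  show "f y = 0" if "y \<in> M"
  proof -
    obtain x u where y: "y = (x, u)" by (cases y)
    have xu: "(x, u) \<in> M" using that y by simp
    obtain \<tau> where \<tau>: "\<tau> \<noteq> 0" "(x, u + axis iR \<tau>) \<in> M" "f (x, u + axis iR \<tau>) = f (x, u)" "g (x, u + axis iR \<tau>) = g (x, u)"
      using shift[OF xu] by blast
    have "f (x, u) * (u $ iR + \<tau>) + g (x, u) * u $ iQ = 0" using e[OF \<tau>(2)] \<tau>(3,4) by (simp add: axis_def)
    then have "f (x, u) * \<tau> = 0" using e[OF xu] by algebra
    then show ?thesis using \<tau> y by simp
  qed
  show "g y = 0" if "y \<in> M"
  proof -
    obtain x u where y: "y = (x, u)" by (cases y)
    have xu: "(x, u) \<in> M" using that y by simp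
    obtain \<tau> where \<tau>: "\<tau> \<noteq> 0" "(x, u + axis iQ \<tau>) \<in> M" "f (x, u + axis iQ \<tau>) = f (x, u)" "g (x, u + axis iQ \<tau>) = g (x, u)"
      using shift[OF xu] by blast
    have "f (x, u) * u $ iR + g (x, u) * (u $ iQ + \<tau>) = 0" using e[OF \<tau>(2)] \<tau>(3,4) by (simp add: axis_def)
    then have "g (x, u) * \<tau> = 0" using e[OF xu] by algebra
    then show ?thesis using \<tau> y by simp
  qed
qed

text \<open>The letters \<open>F\<close> and \<open>G\<close> stand for the values of
  \<open>deriv F\<close> and \<open>deriv G\<close>. They cancel, in accordance with X(F) and Y(G)
  being symmetries for arbitrary functions.\<close>

lemma reduced_gauss_identity:
  fixes U H a b K c f g F G Q R :: complex
  shows "U\<^sup>2 * (H * (a * H + b) + 1/2 * (H\<^sup>2 - c\<^sup>2) * (K - a))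
      - 2 * ((f + (K - 2 * F) * Q) * R + (g + (K - 2 * G) * R) * Q)
      + 2 * Q * R * (K - a - 2 * F - 2 * G) =
    U\<^sup>2 * (1/2 * (K + a) * H\<^sup>2 + b * H - 1/2 * c\<^sup>2 * (K - a)) - 2 * (f * R + g * Q) - 2 * Q * R * (K + a)"
  by algebra

text \<open>With \<open>a = - K\<close> the constant part \<open>K - a\<close> of the weight of
  \<open>U\<close> becomes \<open>2 * K\<close>, so all components match
  \<open>gc_field F G K\<close>.\<close>

lemma (in gc_symmetry) symmetry_is_gc_field:
  obtains F G k where "F holomorphic_on A" "G holomorphic_on B" "c = 0 \<or> k = 0" "v = gc_field F G k"
proof -
  obtain F G where FG: "F holomorphic_on A" "G holomorphic_on B"
    "\<And>x u. (x, u) \<in> M \<Longrightarrow> \<xi> iz (x, u) = F (x $ iz)" "\<And>x u. (x, u) \<in> M \<Longrightarrow> partial_x iz (\<xi> iz) (x, u) = deriv F (x $ iz)"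
    "\<And>x u. (x, u) \<in> M \<Longrightarrow> \<xi> izb (x, u) = G (x $ izb)" "\<And>x u. (x, u) \<in> M \<Longrightarrow> partial_x izb (\<xi> izb) (x, u) = deriv G (x $ izb)"
    by (rule xi_functions, rule that) simp_all
  note F = FG(1,3,4) and G = FG(2,5,6)
  obtain K where KQ: "\<And>y. y \<in> M \<Longrightarrow> partial_u iQ (\<phi> iQ) y = K - 2 * partial_x iz (\<xi> iz) y"
    and KR: "\<And>y. y \<in> M \<Longrightarrow> partial_u iR (\<phi> iR) y = K - 2 * partial_x izb (\<xi> izb) y"
    by (rule K_constant, rule that) simp_all
  have gd: "holomorphic0_at (partial_u iH (\<phi> iH)) (x, u)" "partial_x i (partial_u iH (\<phi> iH)) (x, u) = 0"
      "partial_u \<beta> (partial_u iH (\<phi> iH)) (x, u) = 0"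
      "(u $ iU)\<^sup>2 * (u $ iH * \<phi> iH (x, u) + 1/2 * ((u $ iH)\<^sup>2 - c\<^sup>2) * (K - partial_u iH (\<phi> iH) (x, u)))
      - 2 * (\<phi> iQ (x, u) * u $ iR + \<phi> iR (x, u) * u $ iQ)
      + 2 * u $ iQ * u $ iR * (K - partial_u iH (\<phi> iH) (x, u) - 2 * deriv F (x $ iz) - 2 * deriv G (x $ izb)) = 0"
      "\<phi> iU (x, u) = u $ iU * (K - deriv F (x $ iz) - deriv G (x $ izb) - partial_u iH (\<phi> iH) (x, u))"
    if "(x, u) \<in> M" for x u i \<beta>
    by (rule gauss_determining[where F = F and G = G and K = K and x = x and u = u]; fact F G KQ that)+
  obtain a where a: "\<And>y. y \<in> M \<Longrightarrow> partial_u iH (\<phi> iH) y = a"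
  proof (rule constant_if_partials_vanish[OF open_M connected_M, of "partial_u iH (\<phi> iH)"])
    fix y i \<alpha> assume y: "y \<in> M"
    obtain x u where "y = (x, u)" by (cases y)
    with y gd(1-3)[of x u] show "holomorphic0_at (partial_u iH (\<phi> iH)) y"
      "partial_x i (partial_u iH (\<phi> iH)) y = 0" "partial_u \<alpha> (partial_u iH (\<phi> iH)) y = 0" by auto
  qed (rule that, simp)
  note h = component_holomorphic(2)
  have cH: "holomorphic0_at (\<lambda>y. a * snd y $ iH) y" "partial_x i (\<lambda>y. a * snd y $ iH) y = 0"
    "partial_u \<beta> (\<lambda>y. a * snd y $ iH) y = (if \<beta> = iH then a else 0)" for y :: "(2, 4) jet0" and i \<beta>
    using holomorphic0_at_coordinate_mult[where f = "\<lambda>_. a" and S = UNIV and i = i and y = y and \<alpha> = iH] by auto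
  \<comment> \<open>After removal of its linear part all partial derivatives of
    \<open>\<phi> iH\<close> vanish, and \<open>M\<close> is connected; the local functions
    \<open>h\<close> are thereby one affine function on all of \<open>M\<close>.\<close>
  obtain b where b: "\<And>y. y \<in> M \<Longrightarrow> \<phi> iH y - a * snd y $ iH = b"
  proof (rule constant_if_partials_vanish[OF open_M connected_M, of "\<lambda>y. \<phi> iH y - a * snd y $ iH"])
    fix y i \<alpha> assume y: "y \<in> M"
    show "holomorphic0_at (\<lambda>y. \<phi> iH y - a * snd y $ iH) y" "partial_x i (\<lambda>y. \<phi> iH y - a * snd y $ iH) y = 0"
       "partial_u \<alpha> (\<lambda>y. \<phi> iH y - a * snd y $ iH) y = 0"
      using holomorphic0_at_diff[OF h[OF y] cH(1)] cH(2,3) phi_H_partials[OF y] a[OF y] by simp_all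
  qed (rule that, simp)
  have hF: "(\<lambda>z. K - 2 * deriv F z) holomorphic_on A" and hG: "(\<lambda>z. K - 2 * deriv G z) holomorphic_on B"
    by (rule holomorphic_on_diff[OF holomorphic_on_const holomorphic_on_mult[OF holomorphic_on_const holomorphic_deriv]],
        rule F G, rule A B)+
  have MA: "fst y $ iz \<in> A" "fst y $ izb \<in> B" if "y \<in> M" for y using that by (cases y; simp add: M_iff)+
  \<comment> \<open>The remainder of \<open>\<phi> iQ\<close> after removal of its part linear in
    \<open>Q\<close>; \<open>g\<close> is its mirror image. By the choice of \<open>K\<close>
    neither varies locally with the dependent variables.\<close>
  define f where "f y = \<phi> iQ y - (K - 2 * deriv F (fst y $ iz)) * snd y $ iQ" for y
  define g where "g y = \<phi> iR y - (K - 2 * deriv G (fst y $ izb)) * snd y $ iR" for y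
  have f: "holomorphic0_at f y" "partial_u \<beta> f y = 0" if y: "y \<in> M" for y \<beta>
  proof -
    note p = holomorphic0_at_coordinate_mult[where f = "\<lambda>z. K - 2 * deriv F z" and \<alpha> = iQ and i = iz, OF hF A(1) MA(1)[OF y]]
    show "holomorphic0_at f y"
      unfolding f_def[abs_def] by (rule holomorphic0_at_diff(1)[OF h[OF y] p(1)])
    have "partial_u iQ (\<phi> iQ) y = K - 2 * deriv F (fst y $ iz)"
      using KQ[OF y] F(3)[of "fst y" "snd y"] y by simp
    then show "partial_u \<beta> f y = 0"
      unfolding f_def[abs_def] holomorphic0_at_diff(3)[OF h[OF y] p(1)] p(3)
      by (cases "\<beta> = iQ") (simp_all add: phi_Q_partials(2)[OF y])
  qed
  have g: "holomorphic0_at g y" "partial_u \<beta> g y = 0" if y: "y \<in> M" for y \<beta>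
  proof -
    note p = holomorphic0_at_coordinate_mult[where f = "\<lambda>z. K - 2 * deriv G z" and \<alpha> = iR and i = izb, OF hG B(1) MA(2)[OF y]]
    show "holomorphic0_at g y"
      unfolding g_def[abs_def] by (rule holomorphic0_at_diff(1)[OF h[OF y] p(1)])
    have "partial_u iR (\<phi> iR) y = K - 2 * deriv G (fst y $ izb)"
      using KR[OF y] G(3)[of "fst y" "snd y"] y by simp
    then show "partial_u \<beta> g y = 0"
      unfolding g_def[abs_def] holomorphic0_at_diff(3)[OF h[OF y] p(1)] p(3)
      by (cases "\<beta> = iR") (simp_all add: phi_R_partials(2)[OF y])
  qed
  have eq: "(u $ iU)\<^sup>2 * (1/2 * (K + a) * (u $ iH)\<^sup>2 + b * u $ iH - 1/2 * c\<^sup>2 * (K - a))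
      - 2 * (f (x, u) * u $ iR + g (x, u) * u $ iQ) - 2 * u $ iQ * u $ iR * (K + a) = 0" if xu: "(x, u) \<in> M" for x u
  proof -
    have "\<phi> iH (x, u) = a * u $ iH + b" "\<phi> iQ (x, u) = f (x, u) + (K - 2 * deriv F (x $ iz)) * u $ iQ"
      "\<phi> iR (x, u) = g (x, u) + (K - 2 * deriv G (x $ izb)) * u $ iR"
      using b[OF xu] by (simp_all add: f_def g_def algebra_simps)
    from gd(4)[OF xu, unfolded this a[OF xu]] show ?thesis
      by (rule trans[OF reduced_gauss_identity[symmetric]])
  qed
  have r: "a = - K" "b = 0" "c = 0 \<or> K = 0"
    by (rule reduced_coefficients(1-3)[where f = f and g = g and K = K and a = a and b = b]; fact f g eq)+
  have fg0: "f y = 0" "g y = 0" if "y \<in> M" for y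
    by (rule reduced_coefficients(4,5)[where f = f and g = g and K = K and a = a and b = b]; fact f g eq that)+
  have "v y = gc_field F G K y" for y
  proof (cases "y \<in> M")
    case True
    obtain x u where y: "y = (x, u)" by (cases y)
    have xu: "(x, u) \<in> M" using True y by simp
    have "\<phi> iU (x, u) = u $ iU * (2 * K - deriv F (x $ iz) - deriv G (x $ izb))"
      unfolding gd(5)[OF xu] a[OF xu] r(1) by (simp add: algebra_simps)
    moreover have "\<phi> iH (x, u) = u $ iH * (- K)"
      using b[OF xu] unfolding r(1,2) by (simp add: eq_neg_iff_add_eq_0 mult.commute)
    moreover have "\<phi> iQ (x, u) = u $ iQ * (K - 2 * deriv F (x $ iz))"
      using fg0(1)[OF xu] by (simp add: f_def mult.commute)
    moreover have "\<phi> iR (x, u) = u $ iR * (K - 2 * deriv G (x $ izb))"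
      using fg0(2)[OF xu] by (simp add: g_def mult.commute)
    ultimately show ?thesis
      unfolding y prod_eq_iff vec_eq_iff forall_2 forall_4 gc_field_nth[OF xu]
      using F(2)[OF xu] G(2)[OF xu] by blast
  next
    case False
    then have "v y = 0" using v_holomorphic unfolding holomorphic_fields_def by blast
    then show ?thesis by (simp add: gc_field_outside[OF False])
  qed
  then show ?thesis using that[OF F(1) G(1) r(3)] by blast
qed

section \<open>The Lie algebra of the fields X(F) + Y(G) + k a\<close>

text \<open>The two products of first derivatives cancel.\<close>

lemma deriv_wronskian:
  assumes "F holomorphic_on S" "G holomorphic_on S" "open S" "z \<in> S"
  shows "deriv (\<lambda>t. F t * deriv G t - deriv F t * G t) z = F z * deriv (deriv G) z - deriv (deriv F) z * G z"
proof -
  have d: "(H has_field_derivative deriv H z) (at z)" if "H holomorphic_on S" for H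
    using that assms(3,4) by (rule holomorphic_derivI)
  note h = assms(1,2)[THEN d] holomorphic_deriv[OF assms(1,3), THEN d] holomorphic_deriv[OF assms(2,3), THEN d]
  have "((\<lambda>t. F t * deriv G t - deriv F t * G t) has_field_derivative
      F z * deriv (deriv G) z - deriv (deriv F) z * G z) (at z)"
    by (rule derivative_eq_intros h refl)+ (simp add: algebra_simps)
  then show ?thesis by (rule DERIV_imp_deriv)
qed

context gauss_codazzi_domain
begin

lemma gc_field_frechet:
  fixes k :: complex
  assumes F: "F holomorphic_on A" and G: "G holomorphic_on B" and xu: "(x, u) \<in> M"
  defines "D \<equiv> frechet_derivative (gc_field F G k) (at (x, u))"
  shows "fst (D h) $ iz = deriv F (x $ iz) * fst h $ iz" "fst (D h) $ izb = deriv G (x $ izb) * fst h $ izb"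
    and "snd (D h) $ iU = snd h $ iU * (2 * k - deriv F (x $ iz) - deriv G (x $ izb))
      - u $ iU * (deriv (deriv F) (x $ iz) * fst h $ iz + deriv (deriv G) (x $ izb) * fst h $ izb)"
    and "snd (D h) $ iH = snd h $ iH * (- k)"
    and "snd (D h) $ iQ = snd h $ iQ * (k - 2 * deriv F (x $ iz)) - 2 * u $ iQ * (deriv (deriv F) (x $ iz) * fst h $ iz)"
    and "snd (D h) $ iR = snd h $ iR * (k - 2 * deriv G (x $ izb)) - 2 * u $ iR * (deriv (deriv G) (x $ izb) * fst h $ izb)"
proof -
  let ?v = "gc_field F G k"
  have xA: "x $ iz \<in> A" "x $ izb \<in> B" using xu by (auto simp: M_iff)
  note hol = gc_field_holomorphic[OF F G, of k]
  have D: "fst (D h) $ i = frechet_derivative (\<lambda>y. fst (?v y) $ i) (at (x, u)) h"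
    "snd (D h) $ \<alpha> = frechet_derivative (\<lambda>y. snd (?v y) $ \<alpha>) (at (x, u)) h" for i \<alpha>
    unfolding D_def by (rule holomorphic_fields_frechet_nth[OF hol xu])+
  have f: "((\<lambda>y. H (fst y $ iz)) has_derivative (\<lambda>h. deriv H (x $ iz) * fst h $ iz)) (at (x, u))"
    if "H holomorphic_on A" for H
    using holomorphic_has_derivative[where f = "\<lambda>y. fst y $ iz" and y = "(x, u)", OF that A(1) _ has_derivative_coordinate(1)] xA by simp
  have g: "((\<lambda>y. H (fst y $ izb)) has_derivative (\<lambda>h. deriv H (x $ izb) * fst h $ izb)) (at (x, u))"
    if "H holomorphic_on B" for H
    using holomorphic_has_derivative[where f = "\<lambda>y. fst y $ izb" and y = "(x, u)", OF that B(1) _ has_derivative_coordinate(1)] xA by simp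
  note fg = f[OF F] f[OF holomorphic_deriv[OF F A(1)]] g[OF G] g[OF holomorphic_deriv[OF G B(1)]]
  have on_M: "frechet_derivative \<psi> (at (x, u)) = E"
    if "(\<rho> has_derivative E) (at (x, u))" "\<And>x u. (x, u) \<in> M \<Longrightarrow> \<psi> (x, u) = \<rho> (x, u)" for \<psi> \<rho> E
  proof (rule frechet_derivative_eq, rule has_derivative_transform_within_open[OF that(1) open_M xu])
    show "\<rho> y = \<psi> y" if "y \<in> M" for y using that \<open>\<And>x u. (x, u) \<in> M \<Longrightarrow> \<psi> (x, u) = \<rho> (x, u)\<close> by (cases y) simp
  qed
  show "fst (D h) $ iz = deriv F (x $ iz) * fst h $ iz"
    unfolding D by (subst on_M[OF fg(1)]) (simp_all add: gc_field_nth)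
  show "fst (D h) $ izb = deriv G (x $ izb) * fst h $ izb"
    unfolding D by (subst on_M[OF fg(3)]) (simp_all add: gc_field_nth)
  have "((\<lambda>y. snd y $ iU * (2 * k - deriv F (fst y $ iz) - deriv G (fst y $ izb))) has_derivative (\<lambda>h. snd h $ iU * (2 * k - deriv F (x $ iz) - deriv G (x $ izb))
      - u $ iU * (deriv (deriv F) (x $ iz) * fst h $ iz + deriv (deriv G) (x $ izb) * fst h $ izb))) (at (x, u))"
    by (rule has_derivative_eq_rhs, (rule fg derivative_intros)+) (simp add: fun_eq_iff algebra_simps)
  from on_M[OF this] show "snd (D h) $ iU = snd h $ iU * (2 * k - deriv F (x $ iz) - deriv G (x $ izb))
      - u $ iU * (deriv (deriv F) (x $ iz) * fst h $ iz + deriv (deriv G) (x $ izb) * fst h $ izb)"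
    unfolding D by (simp add: gc_field_nth)
  have "((\<lambda>y. snd y $ iH * (- k)) has_derivative (\<lambda>h. snd h $ iH * (- k))) (at (x, u))"
    by (rule has_derivative_eq_rhs, (rule fg derivative_intros)+) (simp add: fun_eq_iff algebra_simps)
  from on_M[OF this] show "snd (D h) $ iH = snd h $ iH * (- k)"
    unfolding D by (simp add: gc_field_nth)
  have "((\<lambda>y. snd y $ iQ * (k - 2 * deriv F (fst y $ iz))) has_derivative (\<lambda>h. snd h $ iQ * (k - 2 * deriv F (x $ iz)) - 2 * u $ iQ * (deriv (deriv F) (x $ iz) * fst h $ iz))) (at (x, u))"
    by (rule has_derivative_eq_rhs, (rule fg derivative_intros)+) (simp add: fun_eq_iff algebra_simps)
  from on_M[OF this] show "snd (D h) $ iQ = snd h $ iQ * (k - 2 * deriv F (x $ iz)) - 2 * u $ iQ * (deriv (deriv F) (x $ iz) * fst h $ iz)"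
    unfolding D by (simp add: gc_field_nth)
  have "((\<lambda>y. snd y $ iR * (k - 2 * deriv G (fst y $ izb))) has_derivative (\<lambda>h. snd h $ iR * (k - 2 * deriv G (x $ izb)) - 2 * u $ iR * (deriv (deriv G) (x $ izb) * fst h $ izb))) (at (x, u))"
    by (rule has_derivative_eq_rhs, (rule fg derivative_intros)+) (simp add: fun_eq_iff algebra_simps)
  from on_M[OF this] show "snd (D h) $ iR = snd h $ iR * (k - 2 * deriv G (x $ izb)) - 2 * u $ iR * (deriv (deriv G) (x $ izb) * fst h $ izb)"
    unfolding D by (simp add: gc_field_nth)
qed

lemma eq_gc_fieldI:
  assumes "\<And>y. y \<notin> M \<Longrightarrow> v y = 0"
    and "\<And>x u. (x, u) \<in> M \<Longrightarrow> fst (v (x, u)) $ iz = F (x $ iz)"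
    and "\<And>x u. (x, u) \<in> M \<Longrightarrow> fst (v (x, u)) $ izb = G (x $ izb)"
    and "\<And>x u. (x, u) \<in> M \<Longrightarrow> snd (v (x, u)) $ iU = u $ iU * (2 * k - deriv F (x $ iz) - deriv G (x $ izb))"
    and "\<And>x u. (x, u) \<in> M \<Longrightarrow> snd (v (x, u)) $ iH = u $ iH * (- k)"
    and "\<And>x u. (x, u) \<in> M \<Longrightarrow> snd (v (x, u)) $ iQ = u $ iQ * (k - 2 * deriv F (x $ iz))"
    and "\<And>x u. (x, u) \<in> M \<Longrightarrow> snd (v (x, u)) $ iR = u $ iR * (k - 2 * deriv G (x $ izb))"
  shows "v = gc_field F G k"
proof
  fix y
  show "v y = gc_field F G k y"
  proof (cases "y \<in> M")
    case True
    obtain x u where y: "y = (x, u)" by (cases y)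
    with True have xu: "(x, u) \<in> M" by simp
    show ?thesis
      unfolding y prod_eq_iff vec_eq_iff forall_2 forall_4 gc_field_nth[OF xu] using assms(2-)[OF xu] by simp
  qed (simp add: assms(1) gc_field_outside)
qed

text \<open>The dependent variables are multiplied by weights, that is by diagonal matrices, so
  products of weights cancel in the commutator and only derivatives of weights contribute. The
  constant \<open>k\<close> therefore disappears, and \<open>F'\<close> and \<open>G'\<close>
  contribute the derivatives computed in \<open>deriv_wronskian\<close>.\<close>

lemma gc_field_bracket:
  assumes F: "F1 holomorphic_on A" "F2 holomorphic_on A" and G: "G1 holomorphic_on B" "G2 holomorphic_on B"
  shows "lie_bracket M (gc_field F1 G1 k1) (gc_field F2 G2 k2) =
    gc_field (\<lambda>t. F1 t * deriv F2 t - deriv F1 t * F2 t) (\<lambda>t. G1 t * deriv G2 t - deriv G1 t * G2 t) 0"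
proof -
  have xA: "x $ iz \<in> A" "x $ izb \<in> B" if "(x, u) \<in> M" for x u using that by (auto simp: M_iff)
  note w = deriv_wronskian[OF F A(1) xA(1)] deriv_wronskian[OF G B(1) xA(2)]
  note fr = gc_field_frechet[OF F(1) G(1)] gc_field_frechet[OF F(2) G(2)] gc_field_nth
  show ?thesis
    by (rule eq_gc_fieldI; simp add: lie_bracket_def field_on_def w fr)
      (simp_all add: algebra_simps)
qed

lemma gc_field_add:
  assumes F: "F1 holomorphic_on A" "F2 holomorphic_on A" and G: "G1 holomorphic_on B" "G2 holomorphic_on B"
  shows "gc_field F1 G1 k1 + gc_field F2 G2 k2 = gc_field (\<lambda>t. F1 t + F2 t) (\<lambda>t. G1 t + G2 t) (k1 + k2)"
proof -
  have d: "deriv (\<lambda>t. F1 t + F2 t) (x $ iz) = deriv F1 (x $ iz) + deriv F2 (x $ iz)"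
    "deriv (\<lambda>t. G1 t + G2 t) (x $ izb) = deriv G1 (x $ izb) + deriv G2 (x $ izb)" if "(x, u) \<in> M" for x u
    using that F G A(1) B(1)
    by (auto simp: M_iff intro!: deriv_add holomorphic_on_imp_differentiable_at)
  show ?thesis
    by (rule eq_gc_fieldI) (simp_all add: gc_field_outside gc_field_nth d algebra_simps)
qed

lemma gc_field_scale:
  assumes F: "F holomorphic_on A" and G: "G holomorphic_on B"
  shows "vscale r (gc_field F G k) = gc_field (\<lambda>t. r * F t) (\<lambda>t. r * G t) (r * k)"
proof -
  have d: "deriv (\<lambda>t. r * F t) (x $ iz) = r * deriv F (x $ iz)"
    "deriv (\<lambda>t. r * G t) (x $ izb) = r * deriv G (x $ izb)" if "(x, u) \<in> M" for x u
    using that F G A(1) B(1)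
    by (auto simp: M_iff intro!: deriv_cmult holomorphic_on_imp_differentiable_at)
  show ?thesis
    by (rule eq_gc_fieldI) (simp_all add: vscale_def cscale_def gc_field_outside gc_field_nth d algebra_simps zero_prod_def)
qed

lemma gc_field_zero: "gc_field (\<lambda>_. 0) (\<lambda>_. 0) 0 = 0"
  by (rule eq_gc_fieldI[symmetric]) simp_all

lemma gc_field_generators:
  "gc_X M F = gc_field F (\<lambda>_. 0) 0" "gc_Y M G = gc_field (\<lambda>_. 0) G 0" "gc_a M = gc_field (\<lambda>_. 0) (\<lambda>_. 0) 1"
  by (rule eq_gc_fieldI; simp add: gc_X_def gc_Y_def gc_a_def field_on_def axis_def algebra_simps)+

definition gc_fields :: "complex \<Rightarrow> (2, 4) vfield set" where
  "gc_fields c = {gc_field F G k | F G k. F holomorphic_on A \<and> G holomorphic_on B \<and> (c = 0 \<or> k = 0)}"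

lemma gc_fieldsI:
  "F holomorphic_on A \<Longrightarrow> G holomorphic_on B \<Longrightarrow> c = 0 \<or> k = 0 \<Longrightarrow> gc_field F G k \<in> gc_fields c"
  by (auto simp: gc_fields_def)

lemma gc_symmetries_eq: "gc_symmetries M c = gc_fields c"
proof
  show "gc_fields c \<subseteq> gc_symmetries M c"
    using gc_field_symmetry by (auto simp: gc_fields_def)
  show "gc_symmetries M c \<subseteq> gc_fields c"
  proof
    fix v assume "v \<in> gc_symmetries M c"
    then interpret gc_symmetry A B V M v c by unfold_locales
    show "v \<in> gc_fields c" using symmetry_is_gc_field unfolding gc_fields_def by blast
  qed
qed

lemma gc_fields_lie_subalgebra: "lie_subalgebra M (gc_fields c)"
proof -
  interpret vector_space "vscale :: complex \<Rightarrow> (2, 4) vfield \<Rightarrow> _" by (rule vector_space_vscale)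
  show ?thesis
    unfolding lie_subalgebra_def subspace_def
  proof (intro conjI ballI allI)
    show "0 \<in> gc_fields c" using gc_fieldsI[of "\<lambda>_. 0" "\<lambda>_. 0" c 0] by (simp add: gc_field_zero)
  next
    fix v w assume "v \<in> gc_fields c" "w \<in> gc_fields c"
    then obtain F1 G1 k1 F2 G2 k2 where v: "v = gc_field F1 G1 k1" "w = gc_field F2 G2 k2"
      and h: "F1 holomorphic_on A" "F2 holomorphic_on A" "G1 holomorphic_on B" "G2 holomorphic_on B"
      and k: "c = 0 \<or> k1 = 0" "c = 0 \<or> k2 = 0" unfolding gc_fields_def by blast
    show "v + w \<in> gc_fields c"
      unfolding v gc_field_add[OF h] by (intro gc_fieldsI holomorphic_on_add h) (use k in auto)
    have "lie_bracket M v w = gc_field (\<lambda>t. F1 t * deriv F2 t - deriv F1 t * F2 t) (\<lambda>t. G1 t * deriv G2 t - deriv G1 t * G2 t) 0"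
      unfolding v by (rule gc_field_bracket[OF h])
    moreover have "(\<lambda>t. F1 t * deriv F2 t - deriv F1 t * F2 t) holomorphic_on A"
      "(\<lambda>t. G1 t * deriv G2 t - deriv G1 t * G2 t) holomorphic_on B"
      by (rule holomorphic_on_diff[OF holomorphic_on_mult[OF h(1) holomorphic_deriv[OF h(2) A(1)]]
            holomorphic_on_mult[OF holomorphic_deriv[OF h(1) A(1)] h(2)]],
          rule holomorphic_on_diff[OF holomorphic_on_mult[OF h(3) holomorphic_deriv[OF h(4) B(1)]]
            holomorphic_on_mult[OF holomorphic_deriv[OF h(3) B(1)] h(4)]])
    ultimately show "lie_bracket M v w \<in> gc_fields c" by (simp add: gc_fieldsI)
  next
    fix r v assume "v \<in> gc_fields c"
    then obtain F G k where v: "v = gc_field F G k" and h: "F holomorphic_on A" "G holomorphic_on B"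
      and k: "c = 0 \<or> k = 0" unfolding gc_fields_def by blast
    show "vscale r v \<in> gc_fields c"
      unfolding v gc_field_scale[OF h] by (intro gc_fieldsI holomorphic_on_mult holomorphic_on_const h) (use k in auto)
  qed
qed

text \<open>As the family is closed under brackets, the generated Lie algebra is merely the linear
  span of the generators. Each member is by definition a combination of three of them, with the
  multiple of \<open>gc_a M\<close> zero unless \<open>c = 0\<close>.\<close>

lemma lie_generated_eq:
  "lie_generated M ({gc_X M F | F. F holomorphic_on A} \<union> {gc_Y M G | G. G holomorphic_on B}
     \<union> (if c = 0 then {gc_a M} else {})) = gc_fields c" (is "lie_generated M ?S = _")
  unfolding lie_generated_def
proof
  have "?S \<subseteq> gc_fields c"
    unfolding gc_field_generators by (auto intro!: gc_fieldsI split: if_splits)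
  then show "lie_subalgebra M hull ?S \<subseteq> gc_fields c"
    using gc_fields_lie_subalgebra by (rule hull_minimal)
  interpret vector_space "vscale :: complex \<Rightarrow> (2, 4) vfield \<Rightarrow> _" by (rule vector_space_vscale)
  show "gc_fields c \<subseteq> lie_subalgebra M hull ?S"
    unfolding hull_def
  proof (intro subsetI InterI, elim CollectE conjE)
    fix v T assume "v \<in> gc_fields c" and T: "lie_subalgebra M T" "?S \<subseteq> T"
    then obtain F G k where v: "v = gc_field F G k" and h: "F holomorphic_on A" "G holomorphic_on B"
      and k: "c = 0 \<or> k = 0" unfolding gc_fields_def by blast
    have T': "subspace T" using T by (simp add: lie_subalgebra_def)
    have "vscale k (gc_a M) \<in> T"
    proof (cases "c = 0")
      case True
      then show ?thesis using T(2) by (intro subspace_scale[OF T']) auto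
    next
      case False
      then show ?thesis using k subspace_0[OF T'] by simp
    qed
    moreover have "gc_X M F \<in> T" "gc_Y M G \<in> T" using T(2) h by auto
    ultimately show "v \<in> T" unfolding v gc_field_def by (intro subspace_add[OF T'])
  qed
qed

section \<open>Infinite dimension\<close>

text \<open>The fields \<open>X(z^n)\<close> are linearly independent, because a relation would be a
  nonzero polynomial vanishing on the infinite set \<open>A\<close>. A finite set \<open>S\<close>
  cannot span \<open>Suc (card S)\<close> of them.\<close>

lemma gc_symmetries_infinite_dimensional:
  "\<nexists>S. finite S \<and> S \<subseteq> gc_symmetries M c \<and> gc_symmetries M c \<subseteq> module.span vscale S"
proof (rule notI, elim exE conjE)
  interpret vector_space "vscale :: complex \<Rightarrow> (2, 4) vfield \<Rightarrow> _" by (rule vector_space_vscale)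
  fix S assume S: "finite S" "gc_symmetries M c \<subseteq> span S"
  define b where "b n = gc_X M (\<lambda>t. t ^ n)" for n :: nat
  \<comment> \<open>The fields of polynomials of degree below \<open>n\<close>. This subspace
    contains the span of \<open>b\<close> \<open>{..<n}\<close> but not \<open>b n\<close>, which
    yields independence by induction.\<close>
  define W where "W n = {gc_X M (\<lambda>t. \<Sum>i<n. a i * t ^ i) | a. True}" for n :: nat
  have W_subspace: "subspace (W n)" for n
    unfolding subspace_def
  proof (intro conjI ballI allI)
    have "0 = gc_X M (\<lambda>t. \<Sum>i<n. 0 * t ^ i)" by (simp add: gc_field_generators gc_field_zero)
    then show "0 \<in> W n" unfolding W_def by (intro CollectI exI[of _ "\<lambda>_. 0"]) simp
  next
    fix v w assume "v \<in> W n" "w \<in> W n"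
    then obtain p q where v: "v = gc_X M (\<lambda>t. \<Sum>i<n. p i * t ^ i)" "w = gc_X M (\<lambda>t. \<Sum>i<n. q i * t ^ i)"
      unfolding W_def by blast
    have "v + w = gc_X M (\<lambda>t. \<Sum>i<n. (p i + q i) * t ^ i)"
      unfolding v gc_field_generators
      by (subst gc_field_add) (auto intro!: holomorphic_intros simp: sum.distrib distrib_right)
    then show "v + w \<in> W n" unfolding W_def by (intro CollectI exI[of _ "\<lambda>i. p i + q i"]) simp
  next
    fix r v assume "v \<in> W n"
    then obtain p where v: "v = gc_X M (\<lambda>t. \<Sum>i<n. p i * t ^ i)" unfolding W_def by blast
    have "vscale r v = gc_X M (\<lambda>t. \<Sum>i<n. (r * p i) * t ^ i)"
      unfolding v gc_field_generators
      by (subst gc_field_scale) (auto intro!: holomorphic_intros simp: sum_distrib_left mult.assoc)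
    then show "vscale r v \<in> W n" unfolding W_def by (intro CollectI exI[of _ "\<lambda>i. r * p i"]) simp
  qed
  have b_W: "b m \<in> W n" if "m < n" for m n
  proof -
    have "(\<Sum>i<n. (if i = m then 1 else 0) * t ^ i) = t ^ m" for t :: complex
      using that by (simp add: if_distrib[of "\<lambda>x. x * _"] cong: if_cong)
    then show ?thesis unfolding W_def b_def by (intro CollectI exI[of _ "\<lambda>i. if i = m then 1 else 0"]) simp
  qed
  have notin: "b n \<notin> W n" for n
  proof
    assume "b n \<in> W n"
    then obtain p where p: "b n = gc_X M (\<lambda>t. \<Sum>i<n. p i * t ^ i)" unfolding W_def by blast
    \<comment> \<open>The coefficient -1 at \<open>t ^ n\<close> makes the polynomial nonzero
      whatever \<open>p\<close> is.\<close>
    have root: "(\<Sum>i\<le>n. (if i = n then - 1 else p i) * t ^ i) = 0" if t: "t \<in> A" for t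
    proof -
      obtain x u where xu: "(x, u) \<in> M" "x $ iz = t"
      proof -
        obtain z u where "z \<in> B" "u \<in> V" using B V by blast
        with t have "((\<chi> i. if i = iz then t else z), u) \<in> M" by (simp add: M_iff)
        then show ?thesis by (rule that) simp
      qed
      have "t ^ n = (\<Sum>i<n. p i * t ^ i)"
        using arg_cong[OF p, of "\<lambda>v. fst (v (x, u)) $ iz"] xu unfolding b_def gc_field_generators
        by (simp add: gc_field_nth)
      then show ?thesis by (simp add: lessThan_Suc_atMost[symmetric])
    qed
    have "finite {t. (\<Sum>i\<le>n. (if i = n then - 1 else p i) * t ^ i) = 0}"
      by (rule polyfun_rootbound_finite) (auto intro!: exI[of _ n])
    then have "finite A" by (rule finite_subset[rotated]) (use root in auto)
    then show False using A finite_imp_not_open by blast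
  qed
  have ind: "independent (b ` {..<n}) \<and> card (b ` {..<n}) = n" for n
  proof (induction n)
    case 0 then show ?case by (simp add: independent_empty)
  next
    case (Suc n)
    have sp: "span (b ` {..<n}) \<subseteq> W n"
      by (rule span_minimal[OF _ W_subspace]) (use b_W in auto)
    then have ns: "b n \<notin> span (b ` {..<n})" using notin[of n] by (rule contra_subsetD)
    then have nb: "b n \<notin> b ` {..<n}" using span_base[of "b n"] by (rule contrapos_nn)
    have "independent (insert (b n) (b ` {..<n}))"
      by (rule independent_insertI[OF ns conjunct1[OF Suc]])
    moreover have "card (insert (b n) (b ` {..<n})) = Suc n"
      using Suc nb by (subst card_insert_disjoint) auto
    ultimately show ?case unfolding lessThan_Suc image_insert by (rule conjI)
  qed
  have "b ` {..<Suc (card S)} \<subseteq> span S"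
  proof -
    have "b n \<in> gc_symmetries M c" for n
      unfolding gc_symmetries_eq b_def gc_field_generators by (intro gc_fieldsI holomorphic_intros) auto
    then show ?thesis using S by blast
  qed
  from independent_span_bound[OF S(1) _ this] ind[of "Suc (card S)"] show False by simp
qed

end

theorem mainTheorem5:
  fixes c :: complex and A B :: "complex set" and V :: "(complex ^ 4) set"
    and M :: "(2, 4) jet0 set"
  assumes "open A" "connected A" "A \<noteq> {}"
    and "open B" "connected B" "B \<noteq> {}"
    and "open V" "connected V" "V \<noteq> {}" "\<forall>u\<in>V. u $ iU \<noteq> 0"
    and "M = gc_domain A B V"
  shows
    "gc_symmetries M c =
       lie_generated M ({gc_X M F | F. F holomorphic_on A} \<union> {gc_Y M G | G. G holomorphic_on B}
         \<union> (if c = 0 then {gc_a M} else {}))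
     \<and> (\<nexists>S. finite S \<and> S \<subseteq> gc_symmetries M c \<and> gc_symmetries M c \<subseteq> module.span vscale S)
     \<and> (\<forall>F1 F2. F1 holomorphic_on A \<longrightarrow> F2 holomorphic_on A \<longrightarrow>
          lie_bracket M (gc_X M F1) (gc_X M F2)
            = gc_X M (\<lambda>t. F1 t * deriv F2 t - deriv F1 t * F2 t))
     \<and> (\<forall>G1 G2. G1 holomorphic_on B \<longrightarrow> G2 holomorphic_on B \<longrightarrow>
          lie_bracket M (gc_Y M G1) (gc_Y M G2)
            = gc_Y M (\<lambda>t. G1 t * deriv G2 t - deriv G1 t * G2 t))
     \<and> (\<forall>F G. F holomorphic_on A \<longrightarrow> G holomorphic_on B \<longrightarrow>
          lie_bracket M (gc_X M F) (gc_Y M G) = 0)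
     \<and> (\<forall>F. F holomorphic_on A \<longrightarrow> lie_bracket M (gc_X M F) (gc_a M) = 0)
     \<and> (\<forall>G. G holomorphic_on B \<longrightarrow> lie_bracket M (gc_Y M G) (gc_a M) = 0)"
proof -
  interpret gauss_codazzi_domain A B V M
    using assms by unfold_locales auto
  \<comment> \<open>All five commutation relations are instances with some of the functions zero and
    \<open>k\<close> equal to 0 or 1; in the mixed ones both difference expressions vanish.\<close>
  have b: "lie_bracket M (gc_field F1 G1 k1) (gc_field F2 G2 k2) =
    gc_field (\<lambda>t. F1 t * deriv F2 t - deriv F1 t * F2 t) (\<lambda>t. G1 t * deriv G2 t - deriv G1 t * G2 t) 0"
    if "F1 holomorphic_on A" "F2 holomorphic_on A" "G1 holomorphic_on B" "G2 holomorphic_on B" for F1 F2 G1 G2 k1 k2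
    using that by (rule gc_field_bracket)
  show ?thesis
    unfolding lie_generated_eq gc_symmetries_eq[symmetric]
    using gc_symmetries_infinite_dimensional
    by (intro conjI allI impI refl) (simp_all add: gc_field_generators b gc_field_zero)
qed

end
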